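(* Assume the following. (1) (Local Lipschitz) For each $R>0$ there is $C_R>0$ such that $|f(x)-f(y)|+|g(x)-g(y)|\le C_R|x-y|$ for all $x,y\in\mathbb{R}^d$ with $|x|\vee|y|\le R$. (2) There exist constants $p\ge2$, $K_6>0$, $K_7\ge0$ such that $\langle x,f(x)\rangle+\frac{p-1}{2}|g(x)|^2\le -K_6|x|^2+K_7$ for all $x\in\mathbb{R}^d$. (3) There is $\delta_{\max}\in(0,\infty)$ such that the timestep function $\delta:\mathbb{R}^d\to(0,\delta_{\max}]$ is continuous, $\lim_{|x|\to\infty}\delta(x)=0$, and there is $\gamma\in(0,1/3]$ such that $|f(x)|(\delta(x))^\gamma\le 1+|x|$ and $|g(x)|^2(\delta(x))^\gamma\le(1+|x|)^2$ for all $x\in\mathbb{R}^d$. (4) There are constants $\ell>0$ and $\theta\in(0,1)$ such that $\delta(x)\ge\ell(1+|x|^2)^{-p\theta/2}$ for all $x\in\mathbb{R}^d$, with $p$ as in (2). (5) There is $\lambda>0$ such that $g(x)g^{\rm T}(x)\ge\lambda I_d$ for all $x\in\mathbb{R}^d$. Then the adaptive Euler--Maruyama numerical solution $\{Y_{t_n}\}_{n\ge0}$ is a $\mu^{Leb}$-irreducible, aperiodic Markov chain. Moreover, it admits a unique invariant probability measure $\mu^\Delta$, and $$\lim_{n\to\infty}n^{(1-\theta)/\theta}\,\|P_Y^n(x_0,\cdot)-\mu^\Delta\|_{\rm TV}=0,\qquad x_0\in\mathbb{R}^d.$$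
   Context: $(\Omega,\mathcal{F},\mathbb{P})$ is a complete probability space with a filtration $\{\mathcal{F}_t\}_{t\ge0}$ satisfying the usual conditions, and $W$ is an $m$-dimensional Brownian motion with respect to it. $f:\mathbb{R}^d\to\mathbb{R}^d$, $g:\mathbb{R}^d\to\mathbb{R}^{d\times m}$. $|\cdot|$ is the Euclidean norm on $\mathbb{R}^d$ and the Frobenius norm on $\mathbb{R}^{d\times m}$; $a\vee b=\max\{a,b\}$; $I_d$ is the identity matrix and $\ge$ between matrices is the Loewner order. Adaptive time-stepping Euler--Maruyama scheme with timestep function $\delta$: $t_0=0$, $Y_{t_0}=x_0\in\mathbb{R}^d$, and for $n\ge0$, $\delta_n=\delta(Y_{t_n})$, $t_{n+1}=t_n+\delta_n$, $Y_{t_{n+1}}=Y_{t_n}+f(Y_{t_n})\delta_n+g(Y_{t_n})(W(t_{n+1})-W(t_n))$. $\{Y_{t_n}\}_{n\ge0}$ is a time-homogeneous Markov chain, with $n$-step transition kernel $P_Y^n(x,A)=\mathbb{P}(Y_{t_n}\in A\mid Y_0=x)$. $\mu^{Leb}$ is Lebesgue measure on $\mathbb{R}^d$; the chain is $\mu^{Leb}$-irreducible if for every $x$ and every Borel $A$ with $\mu^{Leb}(A)>0$ there is $n\ge1$ with $P_Y^n(x,A)>0$. Aperiodicity is in the standard sense of Meyn and Tweedie for $\psi$-irreducible chains. $\|\mu-\nu\|_{\rm TV}=\sup_{A\in\mathcal{B}(\mathbb{R}^d)}|\mu(A)-\nu(A)|$. The superscript in $\mu^\Delta$ is only notation for the invariant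 measure of the numerical chain. *)

theory Defs
  imports "HOL-Probability.Probability"
begin

section \<open>Filtered probability spaces and Brownian motion\<close>

text \<open>
  The time index is \<open>real\<close>, but only \<open>F t\<close> and \<open>W t\<close> with \<open>t \<ge> 0\<close> are constrained; the index
  is clipped at 0 in order to use the library locale \<open>filtration\<close>, whose index set is a whole type.
\<close>

locale usual_filtered_prob_space =
  prob_space M + complete_measure M + filtration "space M" "\<lambda>t. F (max 0 t)"
  for M :: "'w measure" and F :: "real \<Rightarrow> 'w measure" +
  assumes subalgebra_F: "\<And>t. 0 \<le> t \<Longrightarrow> subalgebra M (F t)"
    and right_continuous_F: "\<And>t. 0 \<le> t \<Longrightarrow> sets (F t) = (\<Inter>s\<in>{t<..}. sets (F s))"
    and null_sets_F: "null_sets M \<subseteq> sets (F 0)"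

locale brownian_motion = usual_filtered_prob_space M F
  for M :: "'w measure" and F :: "real \<Rightarrow> 'w measure" +
  fixes W :: "real \<Rightarrow> 'w \<Rightarrow> real ^ 'm"
  assumes adapted: "\<And>t. 0 \<le> t \<Longrightarrow> W t \<in> F t \<rightarrow>\<^sub>M borel"
    and start_zero: "AE \<omega> in M. W 0 \<omega> = 0"
    and continuous_paths: "AE \<omega> in M. continuous_on {0..} (\<lambda>t. W t \<omega>)"
    and indep_increments: "\<And>s t. 0 \<le> s \<Longrightarrow> s < t \<Longrightarrow>
          indep_set (sets (F s)) (sets (vimage_algebra (space M) (\<lambda>\<omega>. W t \<omega> - W s \<omega>) borel))"
    and normal_increments: "\<And>s t. 0 \<le> s \<Longrightarrow> s < t \<Longrightarrow>
          distributed M lborel (\<lambda>\<omega>. W t \<omega> - W s \<omega>)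
            (\<lambda>x. ennreal (\<Prod>i\<in>UNIV. normal_density 0 (sqrt (t - s)) (x $ i)))"

section \<open>Markov chains\<close>

text \<open>
  In this section \<open>K n x\<close> is the \<open>n\<close>-step transition probability from the state \<open>x\<close>.
\<close>

definition natural_sigma :: "'w measure \<Rightarrow> (nat \<Rightarrow> 'w \<Rightarrow> 's::topological_space) \<Rightarrow> nat \<Rightarrow> 'w measure" where
  "natural_sigma M X n = sigma (space M) (\<Union>i\<le>n. {X i -` A \<inter> space M | A. A \<in> sets borel})"

text \<open>
  The Markov property is required for every number of steps \<open>k\<close> with the same kernel \<open>K k\<close> at
  every time \<open>n\<close>; this expresses time homogeneity and that \<open>K k\<close> is the \<open>k\<close>-step kernel.
\<close>

definition homogeneous_markov_chain ::
    "'w measure \<Rightarrow> (nat \<Rightarrow> 'w \<Rightarrow> 's::topological_space) \<Rightarrow> (nat \<Rightarrow> 's \<Rightarrow> 's measure) \<Rightarrow> bool" where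
  "homogeneous_markov_chain M X K \<longleftrightarrow>
     (\<forall>k. K k \<in> borel \<rightarrow>\<^sub>M prob_algebra borel) \<and>
     (\<forall>n. X n \<in> borel_measurable M) \<and>
     (\<forall>n k. \<forall>A\<in>sets borel. AE \<omega> in M.
        real_cond_exp M (natural_sigma M X n) (indicator (X (n + k) -` A \<inter> space M)) \<omega>
          = measure (K k (X n \<omega>)) A)"

definition irreducible_wrt ::
    "'s measure \<Rightarrow> (nat \<Rightarrow> 's::topological_space \<Rightarrow> 's measure) \<Rightarrow> bool" where
  "irreducible_wrt \<phi> K \<longleftrightarrow>
     (\<forall>x. \<forall>A\<in>sets borel. emeasure \<phi> A > 0 \<longrightarrow> (\<exists>n\<ge>1. emeasure (K n x) A > 0))"

definition maximal_irreducibility_measure ::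
    "'s measure \<Rightarrow> (nat \<Rightarrow> 's::topological_space \<Rightarrow> 's measure) \<Rightarrow> bool" where
  "maximal_irreducibility_measure \<psi> K \<longleftrightarrow>
     sets \<psi> = sets borel \<and> emeasure \<psi> UNIV > 0 \<and> irreducible_wrt \<psi> K \<and>
     (\<forall>\<phi>. sets \<phi> = sets borel \<and> irreducible_wrt \<phi> K \<longrightarrow> absolutely_continuous \<psi> \<phi>)"

definition is_cycle ::
    "'s measure \<Rightarrow> (nat \<Rightarrow> 's::topological_space \<Rightarrow> 's measure) \<Rightarrow> nat \<Rightarrow> (nat \<Rightarrow> 's set) \<Rightarrow> bool" where
  "is_cycle \<psi> K d D \<longleftrightarrow>
     1 \<le> d \<and> (\<forall>i<d. D i \<in> sets borel) \<and> disjoint_family_on D {..<d} \<and>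
     (\<forall>i<d. \<forall>x\<in>D i. emeasure (K 1 x) (D (Suc i mod d)) = 1) \<and>
     - (\<Union>i<d. D i) \<in> null_sets \<psi>"

text \<open>
  Meyn and Tweedie: the period of a \<open>\<psi>\<close>-irreducible chain (\<open>\<psi>\<close> maximal) is the largest \<open>d\<close> for
  which a \<open>d\<close>-cycle exists, and the chain is aperiodic if the period is 1.  A 1-cycle always exists
  (the whole space), and the choice of \<open>\<psi>\<close> is immaterial, since any two maximal irreducibility
  measures have the same null sets.
\<close>

definition aperiodic :: "(nat \<Rightarrow> 's::topological_space \<Rightarrow> 's measure) \<Rightarrow> bool" where
  "aperiodic K \<longleftrightarrow>
     (\<exists>\<psi>. maximal_irreducibility_measure \<psi> K \<and> (\<forall>d D. is_cycle \<psi> K d D \<longrightarrow> d = 1))"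

definition invariant_prob ::
    "(nat \<Rightarrow> 's::topological_space \<Rightarrow> 's measure) \<Rightarrow> 's measure \<Rightarrow> bool" where
  "invariant_prob K \<mu> \<longleftrightarrow>
     prob_space \<mu> \<and> sets \<mu> = sets borel \<and>
     (\<forall>A\<in>sets borel. emeasure \<mu> A = (\<integral>\<^sup>+ x. emeasure (K 1 x) A \<partial>\<mu>))"

definition tv_dist :: "'s::topological_space measure \<Rightarrow> 's measure \<Rightarrow> real" where
  "tv_dist \<mu> \<nu> = (SUP A\<in>sets borel. \<bar>measure \<mu> A - measure \<nu> A\<bar>)"

section \<open>The adaptive Euler--Maruyama scheme\<close>

text \<open>
  The state of the recursion is the pair of the current time \<open>t\<^sub>n\<close> and the current value.
  A \<open>d \<times> m\<close> matrix has type \<open>real ^ 'm ^ 'd\<close>; its \<open>norm\<close> is the Frobenius norm.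
\<close>

context
  fixes f :: "real ^ 'd \<Rightarrow> real ^ 'd" and g :: "real ^ 'd \<Rightarrow> real ^ 'm ^ 'd"
    and \<delta> :: "real ^ 'd \<Rightarrow> real" and W :: "real \<Rightarrow> 'w \<Rightarrow> real ^ 'm"
begin

primrec adaptive_em :: "real ^ 'd \<Rightarrow> nat \<Rightarrow> 'w \<Rightarrow> real \<times> (real ^ 'd)" where
  "adaptive_em x0 0 \<omega> = (0, x0)"
| "adaptive_em x0 (Suc n) \<omega> =
     (let (t, y) = adaptive_em x0 n \<omega>; t' = t + \<delta> y
      in (t', y + \<delta> y *\<^sub>R f y + g y *v (W t' \<omega> - W t \<omega>)))"

definition em_value :: "real ^ 'd \<Rightarrow> nat \<Rightarrow> 'w \<Rightarrow> real ^ 'd" where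
  "em_value x0 n \<omega> = snd (adaptive_em x0 n \<omega>)"

definition em_kernel :: "'w measure \<Rightarrow> nat \<Rightarrow> real ^ 'd \<Rightarrow> (real ^ 'd) measure" where
  "em_kernel M n x = distr M borel (em_value x n)"

end

definition loewner_le :: "real ^ 'd ^ 'd \<Rightarrow> real ^ 'd ^ 'd \<Rightarrow> bool" where
  "loewner_le A B \<longleftrightarrow> transpose (B - A) = B - A \<and> (\<forall>v. 0 \<le> v \<bullet> ((B - A) *v v))"

end

theory Submission
  imports Defs
begin

text \<open>
  One step of the scheme from \<open>x\<close> has the law of \<open>x + \<delta>(x) f(x) + \<surd>\<delta>(x) g(x) Z\<close> with a standard
  Gaussian \<open>Z\<close>.  The increments of \<open>W\<close> are taken between the random times \<open>t\<^sub>n\<close> and \<open>t\<^sub>n\<^sub>+\<^sub>1\<close>, so that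
  this, and the Markov property, is the strong Markov property of \<open>W\<close> at \<open>t\<^sub>n\<close>; it applies because
  \<open>t\<^sub>n\<^sub>+\<^sub>1\<close> is known at time \<open>t\<^sub>n\<close> (\<open>strong_markov\<close>, \<open>em_markov\<close>).  The rest of the proof is about the
  kernel \<open>P\<close> of this Gaussian step.

  Ellipticity makes \<open>P(x, \<cdot>)\<close> equivalent to Lebesgue measure, uniformly on balls in the lower bound
  (\<open>em_minorization\<close>, \<open>affine_gauss_null\<close>).  Hence every set of positive Lebesgue measure is reached
  in a single step from everywhere, which gives irreducibility, makes Lebesgue measure a maximal
  irreducibility measure and excludes cycles of length at least 2.

  The Lyapunov function is \<open>V(x) = (1 + |x|\<^sup>2)\<^bsup>p/2\<^esup>\<close>.  The first-order term of \<open>PV - V\<close> is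
  \<open>p \<delta> V (\<langle>x, f\<rangle> + (p-1)/2 |g|\<^sup>2) / (1 + |x|\<^sup>2)\<close>, which dissipativity bounds by a negative multiple of
  \<open>\<delta> V\<close>.  The martingale part of the step has relative size \<open>\<delta>\<^bsup>(1-\<gamma>)/2\<^esup>\<close>, so that its cube can be as
  large as \<open>\<delta>\<close>; but all odd powers have mean 0, and the remaining errors are
  \<open>O(\<delta>\<^bsup>2(1-\<gamma>)\<^esup>) = O(\<delta>\<^bsup>4/3\<^esup>) = o(\<delta>)\<close>, because \<open>\<delta>\<close> tends to 0 at infinity.  With the lower bound on \<open>\<delta>\<close>
  this becomes \<open>PV \<le> V - c V\<^bsup>1-\<theta>\<^esup> + b 1\<^sub>C\<close> for a ball \<open>C\<close> (\<open>em_drift\<close>).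

  From the drift and a minorization \<open>P(x, \<cdot>) \<ge> \<epsilon> \<nu>\<close> on \<open>C\<close>, the rate follows without constructing any
  chain.  Let \<open>R = P - \<epsilon> 1\<^sub>C \<otimes> \<nu>\<close> be the residual kernel.  On \<open>C\<close> it loses mass \<open>\<epsilon>\<close>, so that adding the
  constant \<open>b/\<epsilon>\<close> to \<open>V\<close> absorbs the term \<open>b 1\<^sub>C\<close>: the shifted function \<open>V\<^sub>s\<close> satisfies
  \<open>R V\<^sub>s \<le> V\<^sub>s - c' V\<^sub>s\<^bsup>1-\<theta>\<^esup>\<close> everywhere.  Comparison with the flow of \<open>w' = c' w\<^bsup>1-\<theta>\<^esup>\<close> then gives
  \<open>R\<^sup>n 1 \<le> V\<^sub>s / (\<kappa> n)\<^bsup>1/\<theta>\<^esup>\<close> (\<open>survival_bound\<close>), and summing the drift inequality along the measures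
  \<open>\<nu> R\<^sup>n\<close> shows that their sum is a finite invariant measure which integrates \<open>V\<^bsup>1-\<theta>\<^esup>\<close>
  (\<open>invariant_prob_exists\<close>).

  The same estimate holds for two independent copies of the chain, with \<open>V(x) + V(y)\<close> and \<open>C \<times> C\<close>, as
  soon as \<open>C\<close> is large; there \<open>R\<^sup>n 1(x, y)\<close> bounds the total variation distance of \<open>P\<^sup>n(x, \<cdot>)\<close> and
  \<open>P\<^sup>n(y, \<cdot>)\<close> (\<open>coupling_bound\<close>).  So this distance is at most \<open>min(1, s)\<close> with
  \<open>s = K n\<^bsup>-1/\<theta>\<^esup> (V(x) + V(y))\<close>.  Multiplied by \<open>n\<^bsup>(1-\<theta>)/\<theta>\<^esup>\<close> it tends to 0 for fixed \<open>x\<close> and \<open>y\<close>, and since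
  \<open>min(1, s) \<le> s\<^bsup>1-\<theta>\<^esup>\<close> it stays below a multiple of \<open>(V(x) + V(y))\<^bsup>1-\<theta>\<^esup>\<close>, which is integrable in \<open>y\<close>
  with respect to the invariant measure.  Dominated convergence gives the rate with limit 0
  (\<open>polynomial_ergodicity\<close>).
\<close>

section \<open>Power functions and the flow of a polynomial drift\<close>

lemma powr_convex_tangent:
  fixes a s t :: real
  assumes "1 \<le> a" "0 < s" "0 < t"
  shows "s powr a + a * s powr (a - 1) * (t - s) \<le> t powr a"
proof -
  have "a * s powr (a - 1) * (t - s) \<le> t powr a - s powr a"
  proof (rule convex_on_imp_above_tangent[where A = "{0<..}"])
    show "convex_on {0<..} (\<lambda>x::real. x powr a)" using assms powr_convex by blast
    show "s \<in> interior {0<..}" using assms by (simp add: interior_open)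
    show "((\<lambda>x. x powr a) has_real_derivative a * s powr (a - 1)) (at s within {0<..})"
      using assms by (auto intro!: derivative_eq_intros)
  qed (use assms in auto)
  then show ?thesis by simp
qed

lemma powr_subadditive:
  fixes a b r :: real
  assumes "0 < a" "0 < b" "0 < r" "r \<le> 1"
  shows "(a + b) powr r \<le> a powr r + b powr r"
proof -
  have *: "x \<le> x powr r" if "0 < x" "x \<le> 1" for x :: real
    using powr_mono'[of r 1 x] that assms by simp
  have "1 = a / (a + b) + b / (a + b)" using assms by (simp add: add_divide_distrib[symmetric])
  also have "\<dots> \<le> (a / (a + b)) powr r + (b / (a + b)) powr r"
    using assms by (intro add_mono *) auto
  also have "\<dots> = (a powr r + b powr r) / (a + b) powr r"
    using assms by (simp add: powr_divide add_divide_distrib)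
  finally show ?thesis using assms by (simp add: field_simps)
qed

text \<open>
  Up to the scaling of \<open>k\<close>, this is the solution at time \<open>k\<close> of \<open>w' = w\<^bsup>1-\<theta>\<^esup>\<close> started in \<open>w\<close>.
\<close>

definition polyflow :: "real \<Rightarrow> real \<Rightarrow> real \<Rightarrow> real" where
  "polyflow \<theta> k w = (w powr \<theta> + k) powr (1 / \<theta>)"

text \<open>
  The flow is concave in the initial value.  With \<open>l = w\<^bsup>\<theta>\<^esup> / s\<close> and \<open>r = v / w\<close> this is Jensen's
  inequality for \<open>x \<mapsto> x\<^bsup>1/\<theta>\<^esup>\<close> at the points \<open>1\<close> and \<open>r\<^bsup>\<theta>\<^esup>\<close> with weights \<open>1 - l\<close> and \<open>l\<close>.
\<close>

lemma polyflow_tangent: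
  assumes th: "0 < \<theta>" "\<theta> < 1" and k: "0 \<le> k" and w: "0 < w" and v: "0 < v"
  defines "s \<equiv> w powr \<theta> + k"
  shows "polyflow \<theta> k v \<le> polyflow \<theta> k w + s powr (1/\<theta> - 1) * w powr (\<theta> - 1) * (v - w)"
proof -
  define l where "l = w powr \<theta> / s"
  define r where "r = v / w"
  have s: "0 < s" using w k by (simp add: s_def add_pos_nonneg)
  have l: "0 \<le> l" "l \<le> 1" using s k by (auto simp: l_def s_def divide_simps)
  have r: "0 < r" using v w by (simp add: r_def)
  have conv: "convex_on {0<..} (\<lambda>x::real. x powr (1/\<theta>))" using th by (intro powr_convex) simp
  have vw: "v powr \<theta> = w powr \<theta> * r powr \<theta>" using v w by (simp add: r_def powr_divide)
  have eq: "v powr \<theta> + k = s * ((1 - l) *\<^sub>R 1 + l *\<^sub>R (r powr \<theta>))"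
    using s by (simp add: l_def vw algebra_simps) (simp add: s_def)
  have pos: "0 < (1 - l) * 1 + l * (r powr \<theta>)"
  proof (cases "l = 1")
    case False then show ?thesis using l r by (intro add_pos_nonneg) auto
  qed (use r in auto)
  have "polyflow \<theta> k v = s powr (1/\<theta>) * ((1 - l) *\<^sub>R 1 + l *\<^sub>R (r powr \<theta>)) powr (1/\<theta>)"
    unfolding polyflow_def eq using s pos by (simp add: powr_mult)
  also have "\<dots> \<le> s powr (1/\<theta>) * ((1 - l) * 1 powr (1/\<theta>) + l * (r powr \<theta>) powr (1/\<theta>))"
    using l r by (intro mult_left_mono convex_onD[OF conv]) auto
  also have "(r powr \<theta>) powr (1/\<theta>) = r" using r th by (simp add: powr_powr)
  also have "s powr (1/\<theta>) * ((1 - l) * 1 powr (1/\<theta>) + l * r) = s powr (1/\<theta>) + s powr (1/\<theta>) * l * (r - 1)"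
    by (simp add: algebra_simps)
  also have "s powr (1/\<theta>) * l * (r - 1) = s powr (1/\<theta> - 1) * w powr (\<theta> - 1) * (v - w)"
    using s w by (simp add: l_def r_def powr_diff field_simps)
  finally show ?thesis by (simp add: polyflow_def s_def)
qed

text \<open>
  The tangent of the concave flow meets the vertical axis at a nonnegative height.  This makes Jensen's
  inequality available for measures of total mass less than 1.
\<close>

lemma polyflow_slope:
  assumes th: "0 < \<theta>" "\<theta> < 1" and k: "0 \<le> k" and w: "0 < w"
  shows "(w powr \<theta> + k) powr (1/\<theta> - 1) * w powr (\<theta> - 1) * w \<le> polyflow \<theta> k w"
proof -
  let ?s = "w powr \<theta> + k"
  have s: "0 < ?s" using w k by (simp add: add_pos_nonneg)
  have "?s powr (1/\<theta> - 1) * w powr (\<theta> - 1) * w = ?s powr (1/\<theta> - 1) * w powr \<theta>"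
    using w by (simp add: powr_diff)
  also have "\<dots> \<le> ?s powr (1/\<theta> - 1) * ?s" using k by (intro mult_left_mono) auto
  also have "\<dots> = polyflow \<theta> k w" using s by (simp add: powr_diff polyflow_def)
  finally show ?thesis .
qed

text \<open>
  To first order, lowering the initial value by \<open>c w\<^bsup>1-\<theta>\<^esup>\<close> undoes at least a time step of length
  \<open>c \<theta>\<close>, since \<open>x \<mapsto> x\<^bsup>1/\<theta>\<^esup>\<close> is convex.
\<close>

lemma polyflow_decrement:
  assumes th: "0 < \<theta>" "\<theta> < 1" and k: "0 \<le> k" and w: "0 < w" and c: "0 < c"
  defines "s \<equiv> w powr \<theta> + (k + c * \<theta>)"
  shows "polyflow \<theta> (k + c * \<theta>) w - s powr (1/\<theta> - 1) * w powr (\<theta> - 1) * (c * w powr (1 - \<theta>))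
    \<le> polyflow \<theta> k w"
proof -
  have t: "0 < w powr \<theta> + k" using w k by (simp add: add_pos_nonneg)
  have s: "0 < s" using t th c unfolding s_def by (simp add: add_pos_pos add.assoc[symmetric])
  have diff: "(w powr \<theta> + k) - s = - (c * \<theta>)" by (simp add: s_def)
  have "s powr (1/\<theta>) + (1/\<theta>) * s powr (1/\<theta> - 1) * ((w powr \<theta> + k) - s) \<le> (w powr \<theta> + k) powr (1/\<theta>)"
    using th s t by (intro powr_convex_tangent) auto
  moreover have "w powr (\<theta> - 1) * w powr (1 - \<theta>) = 1" using w by (simp add: powr_add[symmetric])
  then have "s powr (1/\<theta> - 1) * w powr (\<theta> - 1) * (c * w powr (1 - \<theta>)) = s powr (1/\<theta> - 1) * c"
    by (metis (no_types, lifting) mult.assoc mult.commute mult.right_neutral)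
  moreover have "(1/\<theta>) * s powr (1/\<theta> - 1) * (- (c * \<theta>)) = - (s powr (1/\<theta> - 1) * c)"
    using th by simp
  ultimately show ?thesis unfolding polyflow_def s_def[symmetric] diff by linarith
qed

section \<open>Kernels with a minorized set\<close>

lemma prob_algebraD:
  assumes "M \<in> space (prob_algebra S)"
  shows "prob_space M" "sets M = sets S" "space M = space S" "emeasure M (space S) = 1"
  using assms prob_space.emeasure_space_1[of M] by (auto simp: space_prob_algebra dest: sets_eq_imp_space_eq)

text \<open>
  A Markov kernel \<open>P\<close> with a set \<open>C\<close> that is small in the sense of Meyn and Tweedie, with one-step
  minorization.
\<close>

locale minorized_kernel =
  fixes S :: "'s measure" and P :: "'s \<Rightarrow> 's measure" and C :: "'s set" and \<nu> :: "'s measure"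
    and \<epsilon> :: real
  assumes kernel: "P \<in> S \<rightarrow>\<^sub>M prob_algebra S"
    and small_set [measurable]: "C \<in> sets S"
    and nu: "\<nu> \<in> space (prob_algebra S)"
    and eps_pos: "0 < \<epsilon>"
    and minorization: "\<And>x A. x \<in> C \<Longrightarrow> A \<in> sets S \<Longrightarrow> ennreal \<epsilon> * emeasure \<nu> A \<le> emeasure (P x) A"
begin

lemma kernel_sub [measurable]: "P \<in> S \<rightarrow>\<^sub>M subprob_algebra S"
  using kernel by (rule measurable_prob_algebraD)

lemma P_prob: "x \<in> space S \<Longrightarrow> P x \<in> space (prob_algebra S)"
  using kernel by (rule measurable_space)

lemmas P_facts = prob_algebraD[OF P_prob]
lemmas nu_facts = prob_algebraD[OF nu]

text \<open>
  The chain is killed when it regenerates, that is, when its step from \<open>C\<close> is drawn from \<open>\<nu>\<close>, which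
  happens with probability \<open>\<epsilon>\<close>.
\<close>

definition resid :: "'s \<Rightarrow> 's measure" where
  "resid x = diff_measure (P x) (scale_measure (ennreal \<epsilon> * indicator C x) \<nu>)"

lemma sets_resid: "x \<in> space S \<Longrightarrow> sets (resid x) = sets S"
  by (simp add: resid_def P_facts)

lemma emeasure_resid:
  assumes x: "x \<in> space S" and A: "A \<in> sets S"
  shows "emeasure (resid x) A = emeasure (P x) A - ennreal \<epsilon> * indicator C x * emeasure \<nu> A"
proof -
  have fin: "finite_measure (P x)" "finite_measure \<nu>"
    using P_facts(1)[OF x] nu_facts(1) by (auto simp: prob_space_def)
  have "finite_measure (scale_measure (ennreal \<epsilon> * indicator C x) \<nu>)"
    using nu_facts by (intro finite_measureI) (auto simp: space_scale_measure indicator_def)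
  then show ?thesis
    unfolding resid_def using fin P_facts[OF x] nu_facts A minorization[of x]
    by (subst emeasure_diff_measure) (auto simp: indicator_def)
qed

lemma resid_plus:
  assumes x: "x \<in> space S" and A: "A \<in> sets S"
  shows "emeasure (resid x) A + ennreal \<epsilon> * indicator C x * emeasure \<nu> A = emeasure (P x) A"
proof (cases "x \<in> C")
  case True
  then show ?thesis using minorization[OF True A] emeasure_resid[OF x A]
    by (simp add: diff_add_cancel_ennreal)
next
  case False
  then show ?thesis by (simp add: emeasure_resid[OF x A])
qed

lemma resid_kernel [measurable]: "resid \<in> S \<rightarrow>\<^sub>M subprob_algebra S"
proof (rule measurable_subprob_algebra)
  fix x assume x: "x \<in> space S"
  show "subprob_space (resid x)"
  proof (rule subprob_spaceI)
    have "emeasure (resid x) (space S) \<le> emeasure (P x) (space S)"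
      using emeasure_resid[OF x sets.top] by (simp add: diff_le_self_ennreal)
    then show "emeasure (resid x) (space (resid x)) \<le> 1"
      using P_facts[OF x] by (simp add: resid_def)
    show "space (resid x) \<noteq> {}" using x P_facts[OF x] by (auto simp: resid_def)
  qed
  show "sets (resid x) = sets S" by (rule sets_resid[OF x])
next
  fix A assume [measurable]: "A \<in> sets S"
  show "(\<lambda>x. emeasure (resid x) A) \<in> borel_measurable S"
    by (subst measurable_cong[OF emeasure_resid]) auto
qed

text \<open>
  The kernel is the mixture of its residual part and the regenerating part.  In this additive form the
  decomposition avoids subtraction of possibly infinite integrals.
\<close>

lemma nn_integral_kernel:
  assumes x: "x \<in> space S" and h[measurable]: "h \<in> borel_measurable S"
  shows "(\<integral>\<^sup>+y. h y \<partial>P x) = (\<integral>\<^sup>+y. h y \<partial>resid x) + ennreal \<epsilon> * indicator C x * (\<integral>\<^sup>+y. h y \<partial>\<nu>)"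
proof -
  let ?p = "\<lambda>i. if i then resid x else scale_measure (ennreal \<epsilon> * indicator C x) \<nu>"
  have ep: "ennreal \<epsilon> \<le> 1" if "x \<in> C"
    using minorization[OF that sets.top] P_facts[OF x] nu_facts by simp
  have "subprob_space (scale_measure (ennreal \<epsilon> * indicator C x) \<nu>)"
    using nu_facts ep prob_space.not_empty[OF nu_facts(1)]
    by (intro subprob_spaceI) (auto simp: space_scale_measure indicator_def)
  then have p[measurable]: "?p \<in> count_space UNIV \<rightarrow>\<^sub>M subprob_algebra S"
    using measurable_space[OF resid_kernel x] nu_facts(2) by (simp add: space_subprob_algebra)
  have "P x = count_space UNIV \<bind> ?p"
  proof (rule measure_eqI)
    show "sets (P x) = sets (count_space UNIV \<bind> ?p)"
      by (subst sets_bind[where N = S]) (auto simp: P_facts[OF x] sets_resid[OF x] nu_facts)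
    fix A assume "A \<in> sets (P x)"
    then have A: "A \<in> sets S" by (simp add: P_facts[OF x])
    then show "emeasure (P x) A = emeasure (count_space UNIV \<bind> ?p) A"
      by (subst emeasure_bind[OF _ p])
         (auto simp: nn_integral_count_space_finite UNIV_bool resid_plus[OF x A, symmetric] add.commute)
  qed
  then have "(\<integral>\<^sup>+y. h y \<partial>P x) = (\<integral>\<^sup>+i. \<integral>\<^sup>+y. h y \<partial>?p i \<partial>count_space UNIV)"
    using nn_integral_bind[OF h p] by simp
  also have "\<dots> = (\<integral>\<^sup>+y. h y \<partial>resid x) + ennreal \<epsilon> * indicator C x * (\<integral>\<^sup>+y. h y \<partial>\<nu>)"
    using h nu_facts by (simp add: nn_integral_count_space_finite UNIV_bool nn_integral_scale_measure add.commute measurable_cong_sets[OF nu_facts(2) refl])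
  finally show ?thesis .
qed

lemma resid_space:
  assumes x: "x \<in> space S"
  shows "emeasure (resid x) (space S) + ennreal \<epsilon> * indicator C x = 1"
  using resid_plus[OF x sets.top] P_facts[OF x] nu_facts by simp

text \<open>
  The probability that the chain started in \<open>x\<close> does not regenerate during \<open>n\<close> steps.
\<close>

primrec survival :: "nat \<Rightarrow> 's \<Rightarrow> ennreal" where
  "survival 0 x = 1"
| "survival (Suc n) x = (\<integral>\<^sup>+y. survival n y \<partial>resid x)"

lemma survival_measurable [measurable]: "survival n \<in> borel_measurable S"
  by (induction n) (auto intro!: nn_integral_measurable_subprob_algebra2 simp: split_beta')

lemma survival_le_1: "x \<in> space S \<Longrightarrow> survival n x \<le> 1"
proof (induction n arbitrary: x)
  case (Suc n)
  have "survival (Suc n) x \<le> (\<integral>\<^sup>+y. 1 \<partial>resid x)"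
    unfolding survival.simps using Suc sets_eq_imp_space_eq[OF sets_resid[OF Suc.prems]]
    by (intro nn_integral_mono) auto
  also have "\<dots> \<le> 1"
    using measurable_space[OF resid_kernel Suc.prems]
    by (simp add: space_subprob_algebra subprob_space.emeasure_space_le_1)
  finally show ?case .
qed simp

text \<open>
  The law at time \<open>n\<close> of the chain started from \<open>\<nu>\<close> and killed at its next regeneration.
\<close>

primrec excursion :: "nat \<Rightarrow> 's measure" where
  "excursion 0 = \<nu>"
| "excursion (Suc n) = excursion n \<bind> resid"

lemma excursion_sub: "excursion n \<in> space (subprob_algebra S)"
proof (induction n)
  case 0
  then show ?case using nu_facts by (simp add: space_subprob_algebra prob_space_imp_subprob_space)
next
  case (Suc n)
  then have sub: "subprob_space (excursion n)" and sets: "sets (excursion n) = sets S"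
    by (auto simp: space_subprob_algebra)
  have r: "resid \<in> excursion n \<rightarrow>\<^sub>M subprob_algebra S"
    by (simp add: measurable_cong_sets[OF sets refl])
  show ?case
    using subprob_space_bind[OF sub r] sets_bind[of "excursion n" resid S]
      subprob_space.subprob_not_empty[OF sub] sets_resid sets_eq_imp_space_eq[OF sets]
    by (simp add: space_subprob_algebra)
qed

lemma sets_excursion: "sets (excursion n) = sets S"
  using excursion_sub[of n] by (simp add: space_subprob_algebra)

lemma space_excursion: "space (excursion n) = space S"
  using sets_excursion by (rule sets_eq_imp_space_eq)

lemma measurable_excursion: "h \<in> borel_measurable S \<Longrightarrow> h \<in> borel_measurable (excursion n)"
  by (simp add: measurable_cong_sets[OF sets_excursion refl])

lemma nn_integral_excursion_Suc:
  "h \<in> borel_measurable S \<Longrightarrow>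
    (\<integral>\<^sup>+y. h y \<partial>excursion (Suc n)) = (\<integral>\<^sup>+x. \<integral>\<^sup>+y. h y \<partial>resid x \<partial>excursion n)"
  unfolding excursion.simps
  by (rule nn_integral_bind) (auto simp: measurable_cong_sets[OF sets_excursion refl])

text \<open>
  The sum of the excursion measures, written as a bind over the counting measure of the time.
\<close>

definition occupation :: "'s measure" where
  "occupation = count_space UNIV \<bind> excursion"

lemma excursion_measurable: "excursion \<in> count_space UNIV \<rightarrow>\<^sub>M subprob_algebra S"
  using excursion_sub by simp

lemma sets_occupation: "sets occupation = sets S"
  unfolding occupation_def by (rule sets_bind) (auto simp: sets_excursion)

lemma space_occupation: "space occupation = space S"
  using sets_occupation by (rule sets_eq_imp_space_eq)

lemma nn_integral_occupation:
  "h \<in> borel_measurable S \<Longrightarrow> (\<integral>\<^sup>+y. h y \<partial>occupation) = (\<Sum>n. \<integral>\<^sup>+y. h y \<partial>excursion n)"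
  unfolding occupation_def
  by (subst nn_integral_bind[OF _ excursion_measurable]) (auto simp: nn_integral_count_space_nat)

lemma emeasure_occupation:
  "A \<in> sets S \<Longrightarrow> emeasure occupation A = (\<Sum>n. emeasure (excursion n) A)"
  unfolding occupation_def
  by (subst emeasure_bind[OF _ excursion_measurable]) (auto simp: nn_integral_count_space_nat)

end

section \<open>Polynomial Lyapunov drift\<close>

text \<open>
  The drift condition with rate function \<open>c v\<^bsup>1-\<theta>\<^esup>\<close>, stated with a sum on the left-hand side because
  the integral is extended real.
\<close>

locale drifting_kernel = minorized_kernel S P C \<nu> \<epsilon>
  for S :: "'s measure" and P :: "'s \<Rightarrow> 's measure" and C :: "'s set" and \<nu> :: "'s measure"
    and \<epsilon> :: real +
  fixes V :: "'s \<Rightarrow> real" and \<theta> c b :: real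
  assumes V_measurable [measurable]: "V \<in> borel_measurable S"
    and V_ge_1: "\<And>x. x \<in> space S \<Longrightarrow> 1 \<le> V x"
    and theta: "0 < \<theta>" "\<theta> < 1"
    and c_pos: "0 < c" and b_nonneg: "0 \<le> b"
    and drift: "\<And>x. x \<in> space S \<Longrightarrow> (\<integral>\<^sup>+y. V y \<partial>P x) + ennreal (c * V x powr (1 - \<theta>))
        \<le> ennreal (V x + b * indicator C x)"
    and V_nu: "(\<integral>\<^sup>+y. V y \<partial>\<nu>) < \<infinity>"
begin

text \<open>
  On \<open>C\<close> the residual kernel has mass \<open>1 - \<epsilon>\<close>, so that the added constant drops there by
  \<open>\<epsilon> (b / \<epsilon>) = b\<close> in the mean, exactly what the drift condition permits as an increase.
\<close>

definition Vs :: "'s \<Rightarrow> real" where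
  "Vs x = V x + b / \<epsilon>"

definition cs :: real where
  "cs = c / (1 + b / \<epsilon>) powr (1 - \<theta>)"

lemma Vs_measurable [measurable]: "Vs \<in> borel_measurable S"
  unfolding Vs_def by measurable

lemma Vs_ge_1: "x \<in> space S \<Longrightarrow> 1 \<le> Vs x"
  using V_ge_1[of x] eps_pos b_nonneg by (simp add: Vs_def add_increasing2)

lemma cs_pos: "0 < cs"
proof -
  have "0 < 1 + b / \<epsilon>" using eps_pos b_nonneg by (simp add: add_pos_nonneg)
  then show ?thesis unfolding cs_def using c_pos by (intro divide_pos_pos) auto
qed

text \<open>
  The constant \<open>cs\<close> is smaller than \<open>c\<close> by the factor that is lost in replacing \<open>V\<close> by
  \<open>Vs \<le> (1 + b / \<epsilon>) V\<close> in the rate function.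
\<close>

lemma Vs_drift:
  assumes x: "x \<in> space S"
  shows "(\<integral>\<^sup>+y. Vs y \<partial>resid x) + ennreal (cs * Vs x powr (1 - \<theta>)) \<le> ennreal (Vs x)"
proof -
  let ?a = "b / \<epsilon>"
  have a: "0 \<le> ?a" using eps_pos b_nonneg by simp
  have [simp]: "space (resid x) = space S" using sets_resid[OF x] by (rule sets_eq_imp_space_eq)
  have "Vs x \<le> (1 + ?a) * V x"
    using V_ge_1[OF x] a mult_left_mono[OF V_ge_1[OF x] a] by (simp add: Vs_def algebra_simps)
  then have "Vs x powr (1 - \<theta>) \<le> (1 + ?a) powr (1 - \<theta>) * V x powr (1 - \<theta>)"
    using Vs_ge_1[OF x] V_ge_1[OF x] a theta by (subst powr_mult[symmetric]) (auto intro!: powr_mono2)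
  then have le: "cs * Vs x powr (1 - \<theta>) \<le> c * V x powr (1 - \<theta>)"
    using c_pos a by (simp add: cs_def field_simps add_pos_nonneg)
  have "(\<integral>\<^sup>+y. Vs y \<partial>resid x) = (\<integral>\<^sup>+y. ennreal (V y) + ennreal ?a \<partial>resid x)"
    using V_ge_1 a by (intro nn_integral_cong) (fastforce simp: Vs_def intro!: ennreal_plus)
  also have "\<dots> = (\<integral>\<^sup>+y. V y \<partial>resid x) + ennreal ?a * emeasure (resid x) (space S)"
    by (subst nn_integral_add) (auto simp: measurable_cong_sets[OF sets_resid[OF x] refl])
  finally have Vs: "(\<integral>\<^sup>+y. Vs y \<partial>resid x) = \<dots>" .
  have "(\<integral>\<^sup>+y. V y \<partial>resid x) \<le> (\<integral>\<^sup>+y. V y \<partial>P x)"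
    by (subst nn_integral_kernel[OF x]) auto
  then have "(\<integral>\<^sup>+y. Vs y \<partial>resid x) + ennreal (cs * Vs x powr (1 - \<theta>)) + ennreal (b * indicator C x)
      \<le> ((\<integral>\<^sup>+y. V y \<partial>P x) + ennreal ?a * emeasure (resid x) (space S)) + ennreal (c * V x powr (1 - \<theta>)) + ennreal (b * indicator C x)"
    unfolding Vs using le by (intro add_mono ennreal_leI order_refl)
  also have "\<dots> = ((\<integral>\<^sup>+y. V y \<partial>P x) + ennreal (c * V x powr (1 - \<theta>))) + ennreal ?a * (emeasure (resid x) (space S) + ennreal \<epsilon> * indicator C x)"
    using eps_pos b_nonneg by (simp add: distrib_left ennreal_mult[symmetric] ennreal_indicator[symmetric] mult.assoc[symmetric] ac_simps)
  also have "\<dots> \<le> ennreal (V x + b * indicator C x) + ennreal ?a"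
    unfolding resid_space[OF x] using drift[OF x] by (intro add_mono) auto
  also have "\<dots> = ennreal (Vs x) + ennreal (b * indicator C x)"
    using V_ge_1[OF x] b_nonneg a by (simp add: Vs_def ennreal_plus[symmetric] ac_simps del: ennreal_plus)
  finally show ?thesis using ennreal_add_left_cancel_le[of "ennreal (b * indicator C x)"] by (simp add: add.commute)
qed

text \<open>
  The space-time function \<open>polyflow \<theta> (cs \<theta> (n - j)) (Vs x)\<close> is a supermartingale in the time \<open>j\<close>
  for the killed chain: concavity bounds its mean by a tangent evaluated at the mean of \<open>Vs\<close>, and the
  drift pays for one step of the flow.
\<close>

lemma polyflow_supermartingale:
  assumes x: "x \<in> space S" and k: "0 \<le> k"
  shows "(\<integral>\<^sup>+y. polyflow \<theta> (k + cs * \<theta>) (Vs y) \<partial>resid x) \<le> ennreal (polyflow \<theta> k (Vs x))"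
proof -
  define s where "s = Vs x powr \<theta> + (k + cs * \<theta>)"
  define D where "D = s powr (1/\<theta> - 1) * Vs x powr (\<theta> - 1)"
  let ?p = "polyflow \<theta> (k + cs * \<theta>)"
  define r where "r = ?p (Vs x) - D * Vs x"
  have w: "0 < Vs x" using Vs_ge_1[OF x] by simp
  have k': "0 \<le> k + cs * \<theta>" using k cs_pos theta by simp
  have D: "0 \<le> D" by (simp add: D_def)
  have r: "0 \<le> r" using polyflow_slope[OF theta k' w] by (simp add: r_def D_def s_def)
  note [simp] = sets_eq_imp_space_eq[OF sets_resid[OF x]]
  have "(\<integral>\<^sup>+y. ?p (Vs y) \<partial>resid x) \<le> (\<integral>\<^sup>+y. ennreal r + ennreal D * ennreal (Vs y) \<partial>resid x)"
  proof (rule nn_integral_mono)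
    fix y assume "y \<in> space (resid x)"
    then have y: "0 < Vs y" using Vs_ge_1[of y] by simp
    have "?p (Vs y) \<le> r + D * Vs y"
      using polyflow_tangent[OF theta k' w y] by (simp add: r_def D_def s_def algebra_simps)
    then show "ennreal (?p (Vs y)) \<le> ennreal r + ennreal D * ennreal (Vs y)"
      using D r y by (simp add: ennreal_mult[symmetric] ennreal_plus[symmetric] ennreal_leI del: ennreal_plus)
  qed
  also have "\<dots> = ennreal r * emeasure (resid x) (space S) + ennreal D * (\<integral>\<^sup>+y. Vs y \<partial>resid x)"
    by (subst nn_integral_add) (auto simp: measurable_cong_sets[OF sets_resid[OF x] refl] nn_integral_cmult)
  also have "\<dots> \<le> ennreal r * 1 + ennreal D * (\<integral>\<^sup>+y. Vs y \<partial>resid x)"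
    using measurable_space[OF resid_kernel x] subprob_space.emeasure_space_le_1[of "resid x"]
    by (intro add_mono mult_left_mono) (auto simp: space_subprob_algebra)
  finally have "(\<integral>\<^sup>+y. ?p (Vs y) \<partial>resid x) + ennreal (D * (cs * Vs x powr (1 - \<theta>)))
      \<le> ennreal r + ennreal D * ((\<integral>\<^sup>+y. Vs y \<partial>resid x) + ennreal (cs * Vs x powr (1 - \<theta>)))"
    using D cs_pos by (simp add: distrib_left ennreal_mult add.assoc[symmetric] add_mono)
  also have "\<dots> \<le> ennreal r + ennreal D * ennreal (Vs x)"
    by (intro add_mono mult_left_mono Vs_drift[OF x]) auto
  also have "\<dots> = ennreal (?p (Vs x))"
    using D r w by (simp add: ennreal_mult[symmetric] ennreal_plus[symmetric] r_def del: ennreal_plus)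
  finally have "(\<integral>\<^sup>+y. ?p (Vs y) \<partial>resid x) \<le> ennreal (?p (Vs x)) - ennreal (D * (cs * Vs x powr (1 - \<theta>)))"
    by (simp add: ennreal_le_minus_iff add.commute)
  also have "\<dots> = ennreal (?p (Vs x) - D * (cs * Vs x powr (1 - \<theta>)))"
    using D cs_pos by (simp add: ennreal_minus)
  also have "\<dots> \<le> ennreal (polyflow \<theta> k (Vs x))"
    using polyflow_decrement[OF theta k w cs_pos] by (intro ennreal_leI) (simp add: D_def s_def)
  finally show ?thesis .
qed

text \<open>
  At the final time the supermartingale is at least \<open>(cs \<theta> n)\<^bsup>1/\<theta>\<^esup>\<close>, at time 0 it is \<open>Vs x\<close>.
\<close>

lemma survival_bound:
  assumes x: "x \<in> space S"
  shows "ennreal ((cs * \<theta> * n) powr (1 / \<theta>)) * survival n x \<le> ennreal (Vs x)"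
proof -
  have "ennreal ((cs * \<theta> * n) powr (1 / \<theta>)) * survival j x \<le> ennreal (polyflow \<theta> (cs * \<theta> * (n - j)) (Vs x))"
    if "j \<le> n" "x \<in> space S" for j x
    using that
  proof (induction j arbitrary: x)
    case 0
    have "0 \<le> Vs x powr \<theta>" "0 \<le> cs * \<theta>" using theta cs_pos by auto
    then show ?case
      using theta by (auto simp: polyflow_def intro!: ennreal_leI powr_mono2)
  next
    case (Suc j)
    note [simp] = sets_eq_imp_space_eq[OF sets_resid[OF Suc.prems(2)]]
    have "ennreal ((cs * \<theta> * n) powr (1 / \<theta>)) * survival (Suc j) x
        = (\<integral>\<^sup>+y. ennreal ((cs * \<theta> * n) powr (1 / \<theta>)) * survival j y \<partial>resid x)"
      by (simp add: nn_integral_cmult measurable_cong_sets[OF sets_resid[OF Suc.prems(2)] refl])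
    also have "\<dots> \<le> (\<integral>\<^sup>+y. polyflow \<theta> (cs * \<theta> * (n - j)) (Vs y) \<partial>resid x)"
      using Suc by (intro nn_integral_mono) auto
    also have "cs * \<theta> * (n - j) = cs * \<theta> * (n - Suc j) + cs * \<theta>"
      using Suc.prems by (simp add: of_nat_diff algebra_simps)
    also have "(\<integral>\<^sup>+y. polyflow \<theta> (cs * \<theta> * (n - Suc j) + cs * \<theta>) (Vs y) \<partial>resid x)
        \<le> ennreal (polyflow \<theta> (cs * \<theta> * (n - Suc j)) (Vs x))"
      using cs_pos theta by (intro polyflow_supermartingale Suc.prems) auto
    finally show ?case .
  qed
  from this[of n x] x show ?thesis
    using Vs_ge_1[OF x] theta by (simp add: polyflow_def powr_powr)
qed

text \<open>
  The drift inequality telescopes along the excursion measures.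
\<close>

lemma occupation_Vs: "(\<integral>\<^sup>+x. ennreal (cs * Vs x powr (1 - \<theta>)) \<partial>occupation) \<le> (\<integral>\<^sup>+x. Vs x \<partial>\<nu>)"
proof -
  have "(\<Sum>i<n. \<integral>\<^sup>+x. ennreal (cs * Vs x powr (1 - \<theta>)) \<partial>excursion i) + (\<integral>\<^sup>+x. Vs x \<partial>excursion n)
      \<le> (\<integral>\<^sup>+x. Vs x \<partial>\<nu>)" for n
  proof (induction n)
    case (Suc n)
    have "(\<integral>\<^sup>+x. Vs x \<partial>excursion (Suc n)) + (\<integral>\<^sup>+x. ennreal (cs * Vs x powr (1 - \<theta>)) \<partial>excursion n)
        = (\<integral>\<^sup>+x. (\<integral>\<^sup>+y. Vs y \<partial>resid x) + ennreal (cs * Vs x powr (1 - \<theta>)) \<partial>excursion n)"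
      by (subst nn_integral_excursion_Suc, measurable, subst nn_integral_add) (auto intro!: measurable_excursion)
    also have "\<dots> \<le> (\<integral>\<^sup>+x. Vs x \<partial>excursion n)"
      by (intro nn_integral_mono Vs_drift) (simp add: space_excursion)
    finally have step: "(\<integral>\<^sup>+x. Vs x \<partial>excursion (Suc n)) + (\<integral>\<^sup>+x. ennreal (cs * Vs x powr (1 - \<theta>)) \<partial>excursion n)
        \<le> (\<integral>\<^sup>+x. Vs x \<partial>excursion n)" .
    have "(\<Sum>i<Suc n. \<integral>\<^sup>+x. ennreal (cs * Vs x powr (1 - \<theta>)) \<partial>excursion i) + (\<integral>\<^sup>+x. Vs x \<partial>excursion (Suc n))
        = (\<Sum>i<n. \<integral>\<^sup>+x. ennreal (cs * Vs x powr (1 - \<theta>)) \<partial>excursion i)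
          + ((\<integral>\<^sup>+x. Vs x \<partial>excursion (Suc n)) + (\<integral>\<^sup>+x. ennreal (cs * Vs x powr (1 - \<theta>)) \<partial>excursion n))"
      by (simp add: ac_simps del: excursion.simps)
    also have "\<dots> \<le> (\<Sum>i<n. \<integral>\<^sup>+x. ennreal (cs * Vs x powr (1 - \<theta>)) \<partial>excursion i) + (\<integral>\<^sup>+x. Vs x \<partial>excursion n)"
      by (rule add_left_mono[OF step])
    finally show ?case using Suc by (rule order_trans)
  qed simp
  note telescope = this
  have "(\<Sum>i<n. \<integral>\<^sup>+x. ennreal (cs * Vs x powr (1 - \<theta>)) \<partial>excursion i) \<le> (\<integral>\<^sup>+x. Vs x \<partial>\<nu>)" for n
    by (rule order_trans[OF _ telescope[of n]]) simp
  then show ?thesis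
    by (subst nn_integral_occupation) (auto simp: suminf_eq_SUP intro!: SUP_least)
qed

lemma nu_Vs: "(\<integral>\<^sup>+x. Vs x \<partial>\<nu>) < \<infinity>"
proof -
  have "(\<integral>\<^sup>+y. Vs y \<partial>\<nu>) = (\<integral>\<^sup>+y. ennreal (V y) + ennreal (b / \<epsilon>) \<partial>\<nu>)"
    using V_ge_1 eps_pos b_nonneg nu_facts
    by (intro nn_integral_cong) (fastforce simp: Vs_def intro!: ennreal_plus)
  also have "\<dots> = (\<integral>\<^sup>+y. V y \<partial>\<nu>) + ennreal (b / \<epsilon>)"
    using nu_facts by (subst nn_integral_add) (auto simp: measurable_cong_sets[OF nu_facts(2) refl])
  finally show ?thesis using V_nu by (simp add: ennreal_add_eq_top less_top)
qed

lemma occupation_finite: "emeasure occupation (space S) < \<infinity>"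
proof -
  \<comment> \<open>\<open>Vs \<ge> 1\<close>, so that the rate function is bounded below by \<open>cs\<close>.\<close>
  have "ennreal cs * emeasure occupation (space S) = (\<integral>\<^sup>+x. ennreal cs \<partial>occupation)"
    by (simp add: space_occupation)
  also have "\<dots> \<le> (\<integral>\<^sup>+x. ennreal (cs * Vs x powr (1 - \<theta>)) \<partial>occupation)"
    using Vs_ge_1 cs_pos theta
    by (intro nn_integral_mono ennreal_leI) (auto simp: space_occupation ge_one_powr_ge_zero)
  also have "\<dots> < \<infinity>" using occupation_Vs nu_Vs by (rule le_less_trans)
  finally show ?thesis using cs_pos by (auto simp: ennreal_mult_less_top)
qed

text \<open>
  Shifting the time by one in the sum of the excursion measures loses exactly its first term \<open>\<nu>\<close>.
\<close>

lemma occupation_split: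
  assumes A: "A \<in> sets S"
  shows "emeasure occupation A = (\<integral>\<^sup>+x. emeasure (resid x) A \<partial>occupation) + emeasure \<nu> A"
proof -
  have "(\<integral>\<^sup>+x. emeasure (resid x) A \<partial>occupation) = (\<Sum>n. emeasure (excursion (Suc n)) A)"
    using A prob_space.not_empty[OF nu_facts(1)]
    by (subst nn_integral_occupation)
       (auto simp: emeasure_bind[where N = S] space_excursion nu_facts measurable_cong_sets[OF sets_excursion refl])
  moreover have "(\<lambda>n. emeasure (excursion n) A) sums ((\<Sum>n. emeasure (excursion (Suc n)) A) + emeasure (excursion 0) A)"
    by (intro sums_Suc summable_sums summableI)
  ultimately show ?thesis using emeasure_occupation[OF A] by (simp add: sums_iff)
qed

text \<open>
  By the splitting of \<open>P\<close>, the occupation measure is mapped to its own time shift plus \<open>\<epsilon>\<close> times its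
  mass on \<open>C\<close> times \<open>\<nu>\<close>.  Comparing total masses, which are finite, shows that this last factor is 1,
  so that the missing first term \<open>\<nu>\<close> is restored.
\<close>

lemma occupation_invariant:
  assumes A: "A \<in> sets S"
  shows "(\<integral>\<^sup>+x. emeasure (P x) A \<partial>occupation) = emeasure occupation A"
proof -
  have eq: "(\<integral>\<^sup>+x. emeasure (P x) A \<partial>occupation)
      = (\<integral>\<^sup>+x. emeasure (resid x) A \<partial>occupation) + ennreal \<epsilon> * emeasure occupation C * emeasure \<nu> A"
    if A: "A \<in> sets S" for A
  proof -
    have "(\<integral>\<^sup>+x. emeasure (P x) A \<partial>occupation)
        = (\<integral>\<^sup>+x. emeasure (resid x) A + ennreal \<epsilon> * indicator C x * emeasure \<nu> A \<partial>occupation)"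
      using A by (intro nn_integral_cong) (simp add: resid_plus space_occupation)
    also have "\<dots> = (\<integral>\<^sup>+x. emeasure (resid x) A \<partial>occupation) + ennreal \<epsilon> * emeasure occupation C * emeasure \<nu> A"
      using A by (subst nn_integral_add)
        (auto simp: measurable_cong_sets[OF sets_occupation refl] nn_integral_cmult nn_integral_multc sets_occupation)
    finally show ?thesis .
  qed
  have "(\<integral>\<^sup>+x. emeasure (P x) (space S) \<partial>occupation) = (\<integral>\<^sup>+x. 1 \<partial>occupation)"
    by (intro nn_integral_cong) (simp add: P_facts space_occupation)
  then have "(\<integral>\<^sup>+x. emeasure (resid x) (space S) \<partial>occupation) + ennreal \<epsilon> * emeasure occupation C
      = (\<integral>\<^sup>+x. emeasure (resid x) (space S) \<partial>occupation) + 1"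
    using eq[OF sets.top] occupation_split[OF sets.top] nu_facts by (simp add: space_occupation)
  moreover have "(\<integral>\<^sup>+x. emeasure (resid x) (space S) \<partial>occupation) \<noteq> \<infinity>"
    using occupation_split[OF sets.top] occupation_finite by (auto simp: ennreal_add_eq_top less_top)
  ultimately have "ennreal \<epsilon> * emeasure occupation C = 1"
    by (simp add: ennreal_add_left_cancel)
  then show ?thesis using eq[OF A] occupation_split[OF A] by simp
qed

lemma invariant_prob_exists:
  "\<exists>\<pi>\<in>space (prob_algebra S). (\<forall>A\<in>sets S. (\<integral>\<^sup>+x. emeasure (P x) A \<partial>\<pi>) = emeasure \<pi> A) \<and>
     (\<integral>\<^sup>+x. V x powr (1 - \<theta>) \<partial>\<pi>) < \<infinity>"
proof -
  let ?m = "emeasure occupation (space S)"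
  let ?\<pi> = "scale_measure (1 / ?m) occupation"
  have "1 \<le> ?m" using occupation_split[OF sets.top] nu_facts by simp
  then have m: "?m \<noteq> 0" "?m \<noteq> \<infinity>" using occupation_finite by auto
  have [simp]: "sets ?\<pi> = sets S" "space ?\<pi> = space S" by (simp_all add: sets_occupation space_scale_measure space_occupation)
  have int: "(\<integral>\<^sup>+x. h x \<partial>?\<pi>) = (1 / ?m) * (\<integral>\<^sup>+x. h x \<partial>occupation)" if "h \<in> borel_measurable S" for h
    using that by (intro nn_integral_scale_measure) (simp add: measurable_cong_sets[OF sets_occupation refl])
  have "prob_space ?\<pi>"
    using m by (intro prob_spaceI) (simp add: ennreal_divide_times less_top)
  moreover have "(\<integral>\<^sup>+x. emeasure (P x) A \<partial>?\<pi>) = emeasure ?\<pi> A" if "A \<in> sets S" for A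
    using that by (subst int) (auto simp: occupation_invariant)
  moreover have minv: "inverse ?m < \<top>"
    using m by (cases ?m) (auto simp: inverse_ennreal less_top[symmetric])
  have "(\<integral>\<^sup>+x. V x powr (1 - \<theta>) \<partial>occupation) < \<infinity>"
  proof -
    have "ennreal cs * (\<integral>\<^sup>+x. V x powr (1 - \<theta>) \<partial>occupation) = (\<integral>\<^sup>+x. ennreal (cs * V x powr (1 - \<theta>)) \<partial>occupation)"
      using cs_pos by (subst nn_integral_cmult[symmetric]) (auto simp: ennreal_mult measurable_cong_sets[OF sets_occupation refl])
    also have "\<dots> \<le> (\<integral>\<^sup>+x. ennreal (cs * Vs x powr (1 - \<theta>)) \<partial>occupation)"
      using V_ge_1 cs_pos theta eps_pos b_nonneg
      by (intro nn_integral_mono ennreal_leI mult_left_mono powr_mono2)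
         (auto simp: space_occupation Vs_def intro: order_trans[OF zero_le_one])
    also have "\<dots> < \<infinity>" using occupation_Vs nu_Vs by (rule le_less_trans)
    finally show ?thesis using cs_pos by (auto simp: ennreal_mult_less_top)
  qed
  then have "(\<integral>\<^sup>+x. V x powr (1 - \<theta>) \<partial>?\<pi>) < \<infinity>"
    using m minv by (subst int) (auto simp: ennreal_mult_less_top divide_ennreal_def less_top)
  ultimately show ?thesis
    by (intro bexI[of _ ?\<pi>]) (auto simp: space_prob_algebra sets_occupation)
qed

end

section \<open>Coupling and polynomial ergodicity\<close>

primrec kernel_power :: "'s measure \<Rightarrow> ('s \<Rightarrow> 's measure) \<Rightarrow> nat \<Rightarrow> 's \<Rightarrow> 's measure" where
  "kernel_power S P 0 = return S"
| "kernel_power S P (Suc n) = (\<lambda>x. P x \<bind> kernel_power S P n)"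

lemma kernel_power_measurable [measurable]:
  assumes [measurable]: "P \<in> S \<rightarrow>\<^sub>M prob_algebra S"
  shows "kernel_power S P n \<in> S \<rightarrow>\<^sub>M prob_algebra S"
  by (induction n) (auto intro: measurable_bind_prob_space[OF assms])

lemma emeasure_kernel_power_Suc:
  assumes P: "P \<in> S \<rightarrow>\<^sub>M prob_algebra S" and x: "x \<in> space S" and A: "A \<in> sets S"
  shows "emeasure (kernel_power S P (Suc n) x) A = (\<integral>\<^sup>+y. emeasure (kernel_power S P n y) A \<partial>P x)"
  using emeasure_bind_prob_algebra[OF measurable_space[OF P x] kernel_power_measurable[OF P] A] by simp

lemma invariant_kernel_power:
  assumes P: "P \<in> S \<rightarrow>\<^sub>M prob_algebra S" and pi: "\<pi> \<in> space (prob_algebra S)"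
    and inv: "\<And>A. A \<in> sets S \<Longrightarrow> (\<integral>\<^sup>+x. emeasure (P x) A \<partial>\<pi>) = emeasure \<pi> A"
    and A: "A \<in> sets S"
  shows "(\<integral>\<^sup>+x. emeasure (kernel_power S P n x) A \<partial>\<pi>) = emeasure \<pi> A"
proof (induction n)
  case 0
  have "(\<integral>\<^sup>+x. emeasure (return S x) A \<partial>\<pi>) = (\<integral>\<^sup>+x. indicator A x \<partial>\<pi>)"
    using A prob_algebraD[OF pi] by (intro nn_integral_cong) simp
  then show ?case using A prob_algebraD[OF pi] by simp
next
  case (Suc n)
  have "\<pi> \<bind> P = \<pi>"
  proof (rule measure_eqI)
    show "sets (\<pi> \<bind> P) = sets \<pi>"
      using sets_bind'[OF pi P] prob_algebraD[OF pi] by simp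
    show "emeasure (\<pi> \<bind> P) B = emeasure \<pi> B" if "B \<in> sets (\<pi> \<bind> P)" for B
      using that sets_bind'[OF pi P] emeasure_bind_prob_algebra[OF pi P] inv by simp
  qed
  moreover have "(\<integral>\<^sup>+x. emeasure (kernel_power S P (Suc n) x) A \<partial>\<pi>)
      = (\<integral>\<^sup>+x. \<integral>\<^sup>+y. emeasure (kernel_power S P n y) A \<partial>P x \<partial>\<pi>)"
    using prob_algebraD[OF pi] by (intro nn_integral_cong emeasure_kernel_power_Suc P A) auto
  moreover have "P \<in> \<pi> \<rightarrow>\<^sub>M subprob_algebra S"
    using measurable_prob_algebraD[OF P] by (simp add: measurable_cong_sets[OF prob_algebraD(2)[OF pi] refl])
  moreover have "(\<lambda>y. emeasure (kernel_power S P n y) A) \<in> borel_measurable S"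
    using A by (intro measurable_emeasure_kernel[OF measurable_prob_algebraD[OF kernel_power_measurable[OF P]]])
  ultimately show ?case
    using Suc nn_integral_bind[of "\<lambda>y. emeasure (kernel_power S P n y) A" S P \<pi>] by simp
qed

lemma nn_integral_pair_fst:
  assumes "prob_space M" "prob_space N" "h \<in> borel_measurable M"
  shows "(\<integral>\<^sup>+z. h (fst z) \<partial>(M \<Otimes>\<^sub>M N)) = (\<integral>\<^sup>+x. h x \<partial>M)"
proof -
  interpret N: prob_space N by fact
  show ?thesis using assms by (subst N.nn_integral_fst[symmetric]) (auto simp: N.emeasure_space_1)
qed

lemma nn_integral_pair_snd:
  assumes "prob_space M" "prob_space N" "h \<in> borel_measurable N"
  shows "(\<integral>\<^sup>+z. h (snd z) \<partial>(M \<Otimes>\<^sub>M N)) = (\<integral>\<^sup>+x. h x \<partial>N)"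
proof -
  interpret M: prob_space M by fact
  interpret N: prob_space N by fact
  show ?thesis using assms by (subst N.nn_integral_fst[symmetric]) (auto simp: M.emeasure_space_1)
qed

definition pair_kernel :: "('s \<Rightarrow> 's measure) \<Rightarrow> 's \<times> 's \<Rightarrow> ('s \<times> 's) measure" where
  "pair_kernel P z = P (fst z) \<Otimes>\<^sub>M P (snd z)"

text \<open>
  The additional condition says that \<open>C\<close> is so large that the drift outside \<open>C\<close> outweighs twice the
  constant \<open>b\<close>.  It is what makes the drift condition pass to two independent copies of the chain, where
  only one of them needs to be outside \<open>C\<close>.
\<close>

locale ergodic_kernel = drifting_kernel +
  assumes high_outside: "\<And>x. x \<in> space S \<Longrightarrow> x \<notin> C \<Longrightarrow> 2 * b \<le> c * V x powr (1 - \<theta>)"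
begin

lemma minorized_integral:
  assumes "x \<in> C" "h \<in> borel_measurable S"
  shows "ennreal \<epsilon> * (\<integral>\<^sup>+y. h y \<partial>\<nu>) \<le> (\<integral>\<^sup>+y. h y \<partial>P x)"
  using assms sets.sets_into_space[OF small_set] by (subst nn_integral_kernel) auto

lemma nu_sub: "prob_space \<nu>" using nu_facts by simp

text \<open>
  Two independent copies satisfy the drift condition with half the rate.  If exactly one component is
  outside \<open>C\<close>, the other may still contribute \<open>b\<close>; half of the drift of the former pays for it.  The
  power \<open>1 - \<theta> < 1\<close> is subadditive, which allows the rate to be expressed through the sum.
\<close>

sublocale pair: drifting_kernel "S \<Otimes>\<^sub>M S" "pair_kernel P" "C \<times> C" "\<nu> \<Otimes>\<^sub>M \<nu>" "\<epsilon>\<^sup>2"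
  "\<lambda>z. V (fst z) + V (snd z)" \<theta> "c / 2" "2 * b"
proof
  note [measurable] = kernel
  show "pair_kernel P \<in> S \<Otimes>\<^sub>M S \<rightarrow>\<^sub>M prob_algebra (S \<Otimes>\<^sub>M S)"
    unfolding pair_kernel_def by measurable
  show "C \<times> C \<in> sets (S \<Otimes>\<^sub>M S)" by measurable
  show "\<nu> \<Otimes>\<^sub>M \<nu> \<in> space (prob_algebra (S \<Otimes>\<^sub>M S))"
    using nu_facts prob_space_pair[of \<nu> \<nu>] by (auto simp: space_prob_algebra intro: sets_pair_measure_cong)
  show "0 < \<epsilon>\<^sup>2" using eps_pos by simp
  fix z A assume z: "z \<in> C \<times> C" and A: "A \<in> sets (S \<Otimes>\<^sub>M S)"
  then obtain x y where xy: "z = (x, y)" "x \<in> C" "y \<in> C" by auto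
  then have sp: "x \<in> space S" "y \<in> space S" using sets.sets_into_space[OF small_set] by auto
  interpret nu: prob_space \<nu> by (rule nu_sub)
  interpret py: prob_space "P y" by (rule P_facts[OF sp(2)])
  have sec: "Pair u -` A \<in> sets S" for u using A by (rule sets_Pair1)
  have m: "(\<lambda>u. emeasure \<nu> (Pair u -` A)) \<in> borel_measurable S"
    using A by (intro nu.measurable_emeasure_Pair) (simp add: sets_pair_measure_cong[OF refl nu_facts(2)])
  have "ennreal (\<epsilon>\<^sup>2) * emeasure (\<nu> \<Otimes>\<^sub>M \<nu>) A = ennreal \<epsilon> * (ennreal \<epsilon> * (\<integral>\<^sup>+u. emeasure \<nu> (Pair u -` A) \<partial>\<nu>))"
    using A eps_pos
    by (subst nu.emeasure_pair_measure_alt)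
       (auto simp: sets_pair_measure_cong[OF nu_facts(2) nu_facts(2)] power2_eq_square ennreal_mult mult.assoc)
  also have "\<dots> \<le> ennreal \<epsilon> * (\<integral>\<^sup>+u. emeasure \<nu> (Pair u -` A) \<partial>P x)"
    by (intro mult_left_mono minorized_integral xy m) auto
  also have "\<dots> = (\<integral>\<^sup>+u. ennreal \<epsilon> * emeasure \<nu> (Pair u -` A) \<partial>P x)"
    using m by (subst nn_integral_cmult) (auto simp: measurable_cong_sets[OF P_facts(2)[OF sp(1)] refl])
  also have "\<dots> \<le> (\<integral>\<^sup>+u. emeasure (P y) (Pair u -` A) \<partial>P x)"
    by (intro nn_integral_mono minorization xy sec)
  also have "\<dots> = emeasure (pair_kernel P z) A"
    unfolding pair_kernel_def xy fst_conv snd_conv using A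
    by (subst py.emeasure_pair_measure_alt)
       (auto simp: sets_pair_measure_cong[OF P_facts(2)[OF sp(1)] P_facts(2)[OF sp(2)]])
  finally show "ennreal (\<epsilon>\<^sup>2) * emeasure (\<nu> \<Otimes>\<^sub>M \<nu>) A \<le> emeasure (pair_kernel P z) A" .
next
  show "(\<lambda>z. V (fst z) + V (snd z)) \<in> borel_measurable (S \<Otimes>\<^sub>M S)" by measurable
  show "1 \<le> V (fst z) + V (snd z)" if "z \<in> space (S \<Otimes>\<^sub>M S)" for z
    using that V_ge_1[of "fst z"] V_ge_1[of "snd z"] by (auto simp: space_pair_measure)
  show "0 < \<theta>" "\<theta> < 1" "0 < c / 2" "0 \<le> 2 * b" using theta c_pos b_nonneg by auto
  have sum: "(\<integral>\<^sup>+z. ennreal (V (fst z) + V (snd z)) \<partial>(A \<Otimes>\<^sub>M B)) = (\<integral>\<^sup>+u. V u \<partial>A) + (\<integral>\<^sup>+u. V u \<partial>B)"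
    if "A \<in> space (prob_algebra S)" "B \<in> space (prob_algebra S)" for A B
  proof -
    note [simp] = prob_algebraD[OF that(1)] prob_algebraD[OF that(2)]
    have [measurable]: "V \<in> borel_measurable A" "V \<in> borel_measurable B"
      by (simp_all cong: measurable_cong_sets)
    have "(\<integral>\<^sup>+z. ennreal (V (fst z) + V (snd z)) \<partial>(A \<Otimes>\<^sub>M B)) = (\<integral>\<^sup>+z. ennreal (V (fst z)) + ennreal (V (snd z)) \<partial>(A \<Otimes>\<^sub>M B))"
      using V_ge_1
      by (intro nn_integral_cong ennreal_plus) (auto simp: space_pair_measure intro: order_trans[OF zero_le_one])
    also have "\<dots> = (\<integral>\<^sup>+z. ennreal (V (fst z)) \<partial>(A \<Otimes>\<^sub>M B)) + (\<integral>\<^sup>+z. ennreal (V (snd z)) \<partial>(A \<Otimes>\<^sub>M B))"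
      by (rule nn_integral_add) measurable
    also have "\<dots> = (\<integral>\<^sup>+u. V u \<partial>A) + (\<integral>\<^sup>+u. V u \<partial>B)"
      using nn_integral_pair_fst[of A B "\<lambda>u. ennreal (V u)"] nn_integral_pair_snd[of A B "\<lambda>u. ennreal (V u)"] by simp
    finally show ?thesis .
  qed
  show "(\<integral>\<^sup>+z. ennreal (V (fst z) + V (snd z)) \<partial>(\<nu> \<Otimes>\<^sub>M \<nu>)) < \<infinity>"
    using V_nu by (simp add: sum nu)
  fix z assume "z \<in> space (S \<Otimes>\<^sub>M S)"
  then obtain x y where z: "z = (x, y)" and x: "x \<in> space S" and y: "y \<in> space S"
    by (auto simp: space_pair_measure)
  let ?I = "\<lambda>x. \<integral>\<^sup>+u. V u \<partial>P x" and ?v = "\<lambda>x. V x powr (1 - \<theta>)"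
  have sub: "(V x + V y) powr (1 - \<theta>) \<le> ?v x + ?v y"
    using V_ge_1[OF x] V_ge_1[OF y] theta by (intro powr_subadditive) auto
  have "?I x + ?I y + ennreal (c / 2 * (V x + V y) powr (1 - \<theta>)) + ennreal (c / 2 * (?v x + ?v y))
      \<le> ?I x + ?I y + ennreal (c / 2 * (?v x + ?v y)) + ennreal (c / 2 * (?v x + ?v y))"
    using sub c_pos by (intro add_mono ennreal_leI mult_left_mono) auto
  also have "\<dots> = (?I x + ennreal (c * ?v x)) + (?I y + ennreal (c * ?v y))"
  proof -
    have "ennreal (c / 2 * (?v x + ?v y)) + ennreal (c / 2 * (?v x + ?v y)) = ennreal (c * ?v x) + ennreal (c * ?v y)"
      using c_pos by (simp add: ennreal_plus[symmetric] distrib_left del: ennreal_plus)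
    then show ?thesis by (simp only: add.assoc) (simp only: ac_simps)
  qed
  also have "\<dots> \<le> ennreal (V x + b * indicator C x) + ennreal (V y + b * indicator C y)"
    by (intro add_mono drift x y)
  also have "\<dots> = ennreal (V x + V y + b * (indicator C x + indicator C y))"
    using V_ge_1[OF x] V_ge_1[OF y] b_nonneg
    by (simp add: ennreal_plus[symmetric] algebra_simps del: ennreal_plus)
  also have "\<dots> \<le> ennreal ((V x + V y + 2 * b * indicator (C \<times> C) (x, y)) + c / 2 * (?v x + ?v y))"
  proof (rule ennreal_leI)
    have "b * (indicator C x + indicator C y) \<le> 2 * b * indicator (C \<times> C) (x, y) + c / 2 * (?v x + ?v y)"
      using high_outside[OF x] high_outside[OF y] b_nonneg mult_pos_pos[OF c_pos, of "?v x"] mult_pos_pos[OF c_pos, of "?v y"]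
        V_ge_1[OF x] V_ge_1[OF y]
      by (cases "x \<in> C"; cases "y \<in> C") (auto simp: distrib_left)
    then show "V x + V y + b * (indicator C x + indicator C y)
      \<le> (V x + V y + 2 * b * indicator (C \<times> C) (x, y)) + c / 2 * (?v x + ?v y)" by simp
  qed
  also have "\<dots> = ennreal (V x + V y + 2 * b * indicator (C \<times> C) (x, y)) + ennreal (c / 2 * (?v x + ?v y))"
    using V_ge_1[OF x] V_ge_1[OF y] b_nonneg c_pos by (intro ennreal_plus) auto
  finally have "?I x + ?I y + ennreal (c / 2 * (V x + V y) powr (1 - \<theta>)) \<le> ennreal (V x + V y + 2 * b * indicator (C \<times> C) (x, y))"
    using ennreal_add_left_cancel_le[of "ennreal (c / 2 * (?v x + ?v y))"] by (simp only: add.commute infinity_ennreal_def ennreal_neq_top simp_thms)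
  then show "(\<integral>\<^sup>+w. ennreal (V (fst w) + V (snd w)) \<partial>pair_kernel P z) + ennreal (c / 2 * (V (fst z) + V (snd z)) powr (1 - \<theta>))
      \<le> ennreal (V (fst z) + V (snd z) + 2 * b * indicator (C \<times> C) z)"
    by (simp add: z pair_kernel_def sum[OF P_prob[OF x] P_prob[OF y]])
qed

text \<open>
  The regenerating part of the product kernel draws both components from \<open>\<nu>\<close> and therefore contributes
  equally to both sides.  Only the residual part can distinguish the two starting points, and it does
  so by at most its mass.
\<close>

lemma coupling_bound:
  assumes A: "A \<in> sets S" and "x \<in> space S" "y \<in> space S"
  shows "emeasure (kernel_power S P n x) A \<le> emeasure (kernel_power S P n y) A + pair.survival n (x, y)"
  using assms(2,3)
proof (induction n arbitrary: x y)
  case 0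
  then show ?case using A by (simp add: indicator_def)
next
  case (Suc n)
  let ?u = "\<lambda>x. emeasure (kernel_power S P n x) A"
  have u[measurable]: "?u \<in> borel_measurable S"
    using A by (intro measurable_emeasure_kernel[OF measurable_prob_algebraD[OF kernel_power_measurable[OF kernel]]])
  have xy: "(x, y) \<in> space (S \<Otimes>\<^sub>M S)" using Suc.prems by (simp add: space_pair_measure)
  let ?R = "pair.resid (x, y)" and ?e = "ennreal (\<epsilon>\<^sup>2) * indicator (C \<times> C) (x, y)"
  have sR: "sets ?R = sets (S \<Otimes>\<^sub>M S)" by (rule pair.sets_resid[OF xy])
  have spR: "space ?R = space (S \<Otimes>\<^sub>M S)" using sR by (rule sets_eq_imp_space_eq)
  have mP: "?u \<in> borel_measurable (P x)" "?u \<in> borel_measurable (P y)" "?u \<in> borel_measurable \<nu>"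
    using u P_facts(2)[OF Suc.prems(1)] P_facts(2)[OF Suc.prems(2)] nu_facts(2) by (simp_all cong: measurable_cong_sets)
  have "emeasure (kernel_power S P (Suc n) x) A = (\<integral>\<^sup>+v. ?u v \<partial>P x)"
    by (rule emeasure_kernel_power_Suc[OF kernel Suc.prems(1) A])
  also have "\<dots> = (\<integral>\<^sup>+z. ?u (fst z) \<partial>pair_kernel P (x, y))"
    unfolding pair_kernel_def
    using P_facts(1)[OF Suc.prems(1)] P_facts(1)[OF Suc.prems(2)] mP nn_integral_pair_fst[of "P x" "P y" ?u] by simp
  also have "\<dots> = (\<integral>\<^sup>+z. ?u (fst z) \<partial>?R) + ?e * (\<integral>\<^sup>+z. ?u (fst z) \<partial>(\<nu> \<Otimes>\<^sub>M \<nu>))"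
    by (rule pair.nn_integral_kernel[OF xy]) measurable
  also have "(\<integral>\<^sup>+z. ?u (fst z) \<partial>(\<nu> \<Otimes>\<^sub>M \<nu>)) = (\<integral>\<^sup>+z. ?u (snd z) \<partial>(\<nu> \<Otimes>\<^sub>M \<nu>))"
    using nu_sub mP nn_integral_pair_fst[of \<nu> \<nu> ?u] nn_integral_pair_snd[of \<nu> \<nu> ?u] by simp
  also have "(\<integral>\<^sup>+z. ?u (fst z) \<partial>?R) \<le> (\<integral>\<^sup>+z. ?u (snd z) + pair.survival n z \<partial>?R)"
    using Suc.IH by (intro nn_integral_mono) (auto simp: spR space_pair_measure)
  also have "(\<integral>\<^sup>+z. ?u (snd z) + pair.survival n z \<partial>?R) = (\<integral>\<^sup>+z. ?u (snd z) \<partial>?R) + pair.survival (Suc n) (x, y)"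
    by (simp add: nn_integral_add measurable_cong_sets[OF sR refl])
  finally have "emeasure (kernel_power S P (Suc n) x) A
      \<le> ((\<integral>\<^sup>+z. ?u (snd z) \<partial>?R) + ?e * (\<integral>\<^sup>+z. ?u (snd z) \<partial>(\<nu> \<Otimes>\<^sub>M \<nu>))) + pair.survival (Suc n) (x, y)"
    by (simp add: ac_simps)
  also have "(\<integral>\<^sup>+z. ?u (snd z) \<partial>?R) + ?e * (\<integral>\<^sup>+z. ?u (snd z) \<partial>(\<nu> \<Otimes>\<^sub>M \<nu>)) = (\<integral>\<^sup>+z. ?u (snd z) \<partial>pair_kernel P (x, y))"
    by (rule pair.nn_integral_kernel[OF xy, symmetric]) measurable
  also have "\<dots> = emeasure (kernel_power S P (Suc n) y) A"
    unfolding emeasure_kernel_power_Suc[OF kernel Suc.prems(2) A] pair_kernel_def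
    using P_facts(1)[OF Suc.prems(1)] P_facts(1)[OF Suc.prems(2)] mP nn_integral_pair_snd[of "P x" "P y" ?u] by simp
  finally show ?case .
qed

definition invariant_measure :: "'a measure \<Rightarrow> bool" where
  "invariant_measure \<pi> \<longleftrightarrow> \<pi> \<in> space (prob_algebra S) \<and>
     (\<forall>A\<in>sets S. (\<integral>\<^sup>+x. emeasure (P x) A \<partial>\<pi>) = emeasure \<pi> A)"

text \<open>
  A real upper bound of the probability that two copies have not yet coupled.  It is meaningful for
  \<open>n \<ge> 1\<close> only, since the quotient is 0 for \<open>n = 0\<close>.
\<close>

definition separation :: "nat \<Rightarrow> 'a \<Rightarrow> 'a \<Rightarrow> real" where
  "separation n x y = min 1 ((V x + V y + 2 * b / \<epsilon>\<^sup>2) / (pair.cs * \<theta> * n) powr (1 / \<theta>))"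

lemma separation_measurable [measurable]:
  "(\<lambda>(x, y). separation n x y) \<in> borel_measurable (S \<Otimes>\<^sub>M S)"
  unfolding separation_def by measurable

lemma separation_nonneg:
  assumes "x \<in> space S" "y \<in> space S" shows "0 \<le> separation n x y"
  using V_ge_1[OF assms(1)] V_ge_1[OF assms(2)] b_nonneg by (simp add: separation_def)

lemma survival_le_separation:
  assumes x: "x \<in> space S" and y: "y \<in> space S" and n: "1 \<le> n"
  shows "pair.survival n (x, y) \<le> ennreal (separation n x y)"
proof -
  have z: "(x, y) \<in> space (S \<Otimes>\<^sub>M S)" using x y by (simp add: space_pair_measure)
  let ?h = "(pair.cs * \<theta> * n) powr (1 / \<theta>)"
  have h: "0 < ?h" using pair.cs_pos theta n by simp
  have fin: "pair.survival n (x, y) \<noteq> \<top>" using pair.survival_le_1[OF z, of n] by (auto simp: top_unique)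
  then obtain r where r: "0 \<le> r" "pair.survival n (x, y) = ennreal r" by (cases "pair.survival n (x, y)") auto
  have "ennreal (?h * r) \<le> ennreal (pair.Vs (x, y))"
    using pair.survival_bound[OF z, of n] r by (simp add: ennreal_mult)
  then have "?h * r \<le> pair.Vs (x, y)"
    using pair.Vs_ge_1[OF z] by (subst (asm) ennreal_le_iff) auto
  then have "r \<le> pair.Vs (x, y) / ?h" using h by (simp add: pos_le_divide_eq mult.commute)
  moreover have "r \<le> 1" using pair.survival_le_1[OF z, of n] r by simp
  ultimately show ?thesis using r by (auto simp: separation_def pair.Vs_def intro!: ennreal_leI)
qed

lemma kernel_power_separation:
  assumes A: "A \<in> sets S" and x: "x \<in> space S" and y: "y \<in> space S" and n: "1 \<le> n"
  shows "\<bar>measure (kernel_power S P n x) A - measure (kernel_power S P n y) A\<bar> \<le> separation n x y"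
proof -
  have le: "measure (kernel_power S P n u) A \<le> measure (kernel_power S P n v) A + separation n u v"
    if u: "u \<in> space S" and v: "v \<in> space S" for u v
  proof -
    have "finite_measure (kernel_power S P n u)" "finite_measure (kernel_power S P n v)"
      using measurable_space[OF kernel_power_measurable[OF kernel]] u v
      by (auto simp: space_prob_algebra prob_space_def)
    then have "ennreal (measure (kernel_power S P n u) A) \<le> ennreal (measure (kernel_power S P n v) A + separation n u v)"
      using coupling_bound[OF A u v, of n] survival_le_separation[OF u v n] separation_nonneg[OF u v, of n]
      by (simp add: finite_measure.emeasure_eq_measure ennreal_plus) (meson add_left_mono order_trans)
    then show ?thesis using separation_nonneg[OF u v, of n] by (subst (asm) ennreal_le_iff) auto
  qed
  have "separation n x y = separation n y x" by (simp add: separation_def add.commute)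
  then show ?thesis using le[OF x y] le[OF y x] by linarith
qed

text \<open>
  An invariant measure is the mixture of the laws \<open>P\<^sup>n(y, \<cdot>)\<close> over itself.
\<close>

lemma invariant_distance:
  assumes inv: "invariant_measure \<pi>" and A: "A \<in> sets S" and x: "x \<in> space S" and n: "1 \<le> n"
  shows "\<bar>measure (kernel_power S P n x) A - measure \<pi> A\<bar> \<le> (\<integral>y. separation n x y \<partial>\<pi>)"
proof -
  have pi: "\<pi> \<in> space (prob_algebra S)" and inv': "\<And>A. A \<in> sets S \<Longrightarrow> (\<integral>\<^sup>+x. emeasure (P x) A \<partial>\<pi>) = emeasure \<pi> A"
    using inv by (auto simp: invariant_measure_def)
  note pif = prob_algebraD[OF pi]
  interpret pi: prob_space \<pi> by (rule pif)
  let ?u = "\<lambda>y. measure (kernel_power S P n y) A"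
  have K: "prob_space (kernel_power S P n y)" if "y \<in> space S" for y
    using measurable_space[OF kernel_power_measurable[OF kernel] that] by (auto simp: space_prob_algebra)
  have mc: "h \<in> borel_measurable \<pi> \<longleftrightarrow> h \<in> borel_measurable S" for h :: "'a \<Rightarrow> real"
    using pif(2) by (simp cong: measurable_cong_sets)
  have "?u \<in> borel_measurable S"
    using kernel_power_measurable[OF kernel, of n] A by measurable
  then have m: "?u \<in> borel_measurable \<pi>" by (simp add: mc)
  have ui: "integrable \<pi> ?u"
    by (rule pi.integrable_const_bound[of _ 1]) (use m K pif(3) in \<open>auto simp: prob_space.prob_le_1\<close>)
  have "separation n x \<in> borel_measurable S"
    using measurable_Pair2[OF separation_measurable x] by (simp add: split_beta')
  then have si: "integrable \<pi> (separation n x)"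
    using separation_nonneg[OF x]
    by (intro pi.integrable_const_bound[of _ 1]) (auto simp: mc pif(3) separation_def)
  have "ennreal (\<integral>y. ?u y \<partial>\<pi>) = (\<integral>\<^sup>+y. ?u y \<partial>\<pi>)"
    by (intro nn_integral_eq_integral[symmetric] ui) simp
  also have "\<dots> = (\<integral>\<^sup>+y. emeasure (kernel_power S P n y) A \<partial>\<pi>)"
    using K pif(3) by (intro nn_integral_cong) (auto simp: finite_measure.emeasure_eq_measure prob_space_def)
  also have "\<dots> = emeasure \<pi> A" by (rule invariant_kernel_power[OF kernel pi inv' A])
  finally have "measure \<pi> A = (\<integral>y. ?u y \<partial>\<pi>)"
    by (simp add: pi.emeasure_eq_measure)
  then have "?u x - measure \<pi> A = (\<integral>y. ?u x - ?u y \<partial>\<pi>)"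
    using ui by (simp add: Bochner_Integration.integral_diff pi.prob_space)
  also have "\<bar>\<dots>\<bar> \<le> (\<integral>y. \<bar>?u x - ?u y\<bar> \<partial>\<pi>)" by (rule integral_abs_bound)
  also have "\<dots> \<le> (\<integral>y. separation n x y \<partial>\<pi>)"
    using kernel_power_separation[OF A x _ n] pif(3) ui by (intro integral_mono si) auto
  finally show ?thesis .
qed

text \<open>
  The exponents differ by one: \<open>(1 - \<theta>) / \<theta> - 1 / \<theta> = -1\<close>.
\<close>

lemma separation_rate:
  assumes x: "x \<in> space S" and y: "y \<in> space S"
  shows "(\<lambda>n. real n powr ((1 - \<theta>) / \<theta>) * separation n x y) \<longlonglongrightarrow> 0"
proof (rule tendsto_sandwich)
  let ?B = "(V x + V y + 2 * b / \<epsilon>\<^sup>2) / (pair.cs * \<theta>) powr (1 / \<theta>)"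
  show "\<forall>\<^sub>F n in sequentially. 0 \<le> real n powr ((1 - \<theta>) / \<theta>) * separation n x y"
    using separation_nonneg[OF x y] by simp
  have "real n powr ((1 - \<theta>) / \<theta>) * separation n x y \<le> ?B * (1 / real n)" if "1 \<le> n" for n
  proof -
    have "real n powr ((1 - \<theta>) / \<theta>) * separation n x y
        \<le> real n powr ((1 - \<theta>) / \<theta>) * ((V x + V y + 2 * b / \<epsilon>\<^sup>2) / (pair.cs * \<theta> * n) powr (1 / \<theta>))"
      by (intro mult_left_mono) (auto simp: separation_def)
    also have "\<dots> = ?B * (real n powr ((1 - \<theta>) / \<theta>) / real n powr (1 / \<theta>))"
      using pair.cs_pos theta by (simp add: powr_mult)
    also have "real n powr ((1 - \<theta>) / \<theta>) / real n powr (1 / \<theta>) = real n powr (-1)"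
      using theta by (simp add: powr_diff[symmetric] diff_divide_distrib)
    also have "\<dots> = 1 / real n" using that by (simp add: powr_minus_divide)
    finally show ?thesis .
  qed
  then show "\<forall>\<^sub>F n in sequentially. real n powr ((1 - \<theta>) / \<theta>) * separation n x y \<le> ?B * (1 / real n)"
    by (auto simp: eventually_sequentially)
  show "(\<lambda>n. ?B * (1 / real n)) \<longlonglongrightarrow> 0"
    by (rule tendsto_mult_right_zero) (rule lim_1_over_n)
qed simp

text \<open>
  The interpolation \<open>min 1 q \<le> q\<^bsup>1-\<theta>\<^esup>\<close> trades the part \<open>\<theta>\<close> of the decay for the integrability of the
  bound: an invariant measure integrates \<open>V\<^bsup>1-\<theta>\<^esup>\<close>, but in general not \<open>V\<close>.
\<close>

lemma separation_dominated:
  assumes x: "x \<in> space S" and y: "y \<in> space S"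
  shows "real n powr ((1 - \<theta>) / \<theta>) * separation n x y
    \<le> ((V x + 2 * b / \<epsilon>\<^sup>2 + 1) / (pair.cs * \<theta>) powr (1 / \<theta>)) powr (1 - \<theta>) * V y powr (1 - \<theta>)"
proof (cases "n = 0")
  case False
  let ?a = "2 * b / \<epsilon>\<^sup>2" and ?h = "(pair.cs * \<theta>) powr (1 / \<theta>)"
  have a: "0 \<le> ?a" using b_nonneg by simp
  have h: "0 < ?h" using pair.cs_pos theta by simp
  define q where "q = (V x + V y + ?a) / (pair.cs * \<theta> * n) powr (1 / \<theta>)"
  have hn: "(pair.cs * \<theta> * n) powr (1 / \<theta>) = ?h * real n powr (1 / \<theta>)"
    using pair.cs_pos theta by (simp add: powr_mult)
  have q: "0 < q" unfolding q_def hn using V_ge_1[OF x] V_ge_1[OF y] a h False by (intro divide_pos_pos) auto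
  have "min 1 q \<le> q powr (1 - \<theta>)"
  proof (cases "q \<le> 1")
    case True
    then show ?thesis using powr_mono'[of "1 - \<theta>" 1 q] q theta by simp
  next
    case False
    then show ?thesis using ge_one_powr_ge_zero[of q "1 - \<theta>"] theta by simp
  qed
  then have "separation n x y \<le> q powr (1 - \<theta>)" by (simp add: separation_def q_def)
  then have "real n powr ((1 - \<theta>) / \<theta>) * separation n x y \<le> real n powr ((1 - \<theta>) / \<theta>) * q powr (1 - \<theta>)"
    by (intro mult_left_mono) auto
  also have "\<dots> = (real n powr (1 / \<theta>) * q) powr (1 - \<theta>)"
    using q by (simp add: powr_mult powr_powr)
  also have "real n powr (1 / \<theta>) * q = (V x + V y + ?a) / ?h"
    using False by (simp add: q_def hn)
  also have "\<dots> powr (1 - \<theta>) \<le> ((V x + ?a + 1) / ?h * V y) powr (1 - \<theta>)"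
  proof (rule powr_mono2)
    have "V x + V y + ?a \<le> (V x + ?a + 1) * V y"
      using mult_left_mono[OF V_ge_1[OF y], of "V x + ?a"] V_ge_1[OF x] a by (simp add: distrib_right)
    then show "(V x + V y + ?a) / ?h \<le> (V x + ?a + 1) / ?h * V y"
      using h by (simp add: divide_right_mono)
  qed (use V_ge_1[OF x] V_ge_1[OF y] a theta in auto)
  also have "\<dots> = ((V x + ?a + 1) / ?h) powr (1 - \<theta>) * V y powr (1 - \<theta>)"
    by (rule powr_mult)
  finally show ?thesis .
qed simp

text \<open>
  Dominated convergence with respect to \<open>\<pi>\<close> gives the rate.  For uniqueness, the resulting bounds
  \<open>e n x\<close> are integrated against another invariant measure; they are at most 1 and tend to 0
  pointwise in \<open>x\<close>.
\<close>

theorem polynomial_ergodicity: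
  obtains \<pi> where "invariant_measure \<pi>"
    and "\<And>\<pi>'. invariant_measure \<pi>' \<Longrightarrow> \<pi>' = \<pi>"
    and "\<And>x. x \<in> space S \<Longrightarrow> \<exists>e. (\<forall>n\<ge>1. \<forall>A\<in>sets S. \<bar>measure (kernel_power S P n x) A - measure \<pi> A\<bar> \<le> e n) \<and>
        (\<lambda>n. real n powr ((1 - \<theta>) / \<theta>) * e n) \<longlonglongrightarrow> 0"
proof -
  obtain \<pi> where inv: "invariant_measure \<pi>" and Vint: "(\<integral>\<^sup>+x. V x powr (1 - \<theta>) \<partial>\<pi>) < \<infinity>"
    using invariant_prob_exists by (auto simp: invariant_measure_def)
  then have pi: "\<pi> \<in> space (prob_algebra S)" by (simp add: invariant_measure_def)
  note pif = prob_algebraD[OF pi]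
  interpret pi: prob_space \<pi> by (rule pif)
  have mc: "h \<in> borel_measurable \<pi> \<longleftrightarrow> h \<in> borel_measurable S" for h :: "'a \<Rightarrow> real"
    using pif(2) by (simp cong: measurable_cong_sets)
  have sm: "separation n x \<in> borel_measurable \<pi>" if "x \<in> space S" for n x
    using measurable_Pair2[OF separation_measurable that] by (simp add: split_beta' mc)
  define e where "e n x = (\<integral>y. separation n x y \<partial>\<pi>)" for n x
  have Vi: "integrable \<pi> (\<lambda>y. V y powr (1 - \<theta>))"
    using Vint by (intro integrableI_bounded) (auto simp: mc)
  have rate: "(\<lambda>n. real n powr ((1 - \<theta>) / \<theta>) * e n x) \<longlonglongrightarrow> 0" if x: "x \<in> space S" for x
  proof -
    let ?c = "((V x + 2 * b / \<epsilon>\<^sup>2 + 1) / (pair.cs * \<theta>) powr (1 / \<theta>)) powr (1 - \<theta>)"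
    have "(\<lambda>n. \<integral>y. real n powr ((1 - \<theta>) / \<theta>) * separation n x y \<partial>\<pi>) \<longlonglongrightarrow> (\<integral>y. 0 \<partial>\<pi>)"
    proof (rule integral_dominated_convergence)
      show "integrable \<pi> (\<lambda>y. ?c * V y powr (1 - \<theta>))" using Vi by simp
      show "AE y in \<pi>. (\<lambda>n. real n powr ((1 - \<theta>) / \<theta>) * separation n x y) \<longlonglongrightarrow> 0"
        using separation_rate[OF x] pif(3) by auto
      show "AE y in \<pi>. norm (real n powr ((1 - \<theta>) / \<theta>) * separation n x y) \<le> ?c * V y powr (1 - \<theta>)" for n
        using separation_dominated[OF x] separation_nonneg[OF x] pif(3) by (auto simp: abs_mult)
      show "(\<lambda>y. real n powr ((1 - \<theta>) / \<theta>) * separation n x y) \<in> borel_measurable \<pi>" for n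
        using sm[OF x] by measurable
    qed simp
    then show ?thesis by (simp add: e_def)
  qed
  have e0: "0 \<le> e n x" "e n x \<le> 1" if x: "x \<in> space S" for n x
  proof -
    show "0 \<le> e n x" unfolding e_def
      by (rule integral_nonneg_AE) (use separation_nonneg[OF x] pif(3) in auto)
    have "e n x \<le> (\<integral>y. 1 \<partial>\<pi>)" unfolding e_def
      using separation_nonneg[OF x] sm[OF x] pif(3)
      by (intro integral_mono pi.integrable_const_bound[of _ 1]) (auto simp: separation_def)
    then show "e n x \<le> 1" by (simp add: pi.prob_space)
  qed
  have lim: "(\<lambda>n. e n x) \<longlonglongrightarrow> 0" if x: "x \<in> space S" for x
  proof (rule tendsto_sandwich[OF _ _ tendsto_const rate[OF x]])
    show "\<forall>\<^sub>F n in sequentially. 0 \<le> e n x" using e0[OF x] by simp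
    have "e n x \<le> real n powr ((1 - \<theta>) / \<theta>) * e n x" if "1 \<le> n" for n
      using ge_one_powr_ge_zero[of "real n" "(1 - \<theta>) / \<theta>"] that theta mult_right_mono[of 1 _ "e n x"] e0[OF x] by simp
    then show "\<forall>\<^sub>F n in sequentially. e n x \<le> real n powr ((1 - \<theta>) / \<theta>) * e n x"
      by (auto simp: eventually_sequentially)
  qed
  have unique: "\<pi>' = \<pi>" if inv': "invariant_measure \<pi>'" for \<pi>'
  proof (rule measure_eqI)
    have pi': "\<pi>' \<in> space (prob_algebra S)" using inv' by (simp add: invariant_measure_def)
    note pif' = prob_algebraD[OF pi']
    interpret pi': prob_space \<pi>' by (rule pif')
    show "sets \<pi>' = sets \<pi>" by (simp add: pif pif')
    fix A assume "A \<in> sets \<pi>'"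
    then have A: "A \<in> sets S" by (simp add: pif')
    have mc': "h \<in> borel_measurable \<pi>' \<longleftrightarrow> h \<in> borel_measurable S" for h :: "'a \<Rightarrow> real"
      using pif'(2) by (simp cong: measurable_cong_sets)
    have "(\<lambda>(x, y). separation n x y) \<in> borel_measurable (S \<Otimes>\<^sub>M \<pi>)" for n
      using separation_measurable pif(2) by (simp cong: measurable_cong_sets sets_pair_measure_cong)
    then have em: "e n \<in> borel_measurable \<pi>'" for n
      unfolding mc' e_def by (rule pi.borel_measurable_lebesgue_integral)
    have lim': "(\<lambda>n. \<integral>x. e n x \<partial>\<pi>') \<longlonglongrightarrow> (\<integral>x. 0 \<partial>\<pi>')"
      by (rule integral_dominated_convergence[where w = "\<lambda>_. 1"])
         (use lim e0 em pif'(3) in auto)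
    have K: "prob_space (kernel_power S P n y)" if "y \<in> space S" for y n
      using measurable_space[OF kernel_power_measurable[OF kernel] that] by (auto simp: space_prob_algebra)
    have "\<bar>measure \<pi>' A - measure \<pi> A\<bar> \<le> (\<integral>x. e n x \<partial>\<pi>')" if n: "1 \<le> n" for n
    proof -
      let ?u = "\<lambda>y. measure (kernel_power S P n y) A"
      have "?u \<in> borel_measurable S"
        using kernel_power_measurable[OF kernel, of n] A by measurable
      then have ui: "integrable \<pi>' ?u"
        by (intro pi'.integrable_const_bound[of _ 1]) (use K pif'(3) in \<open>auto simp: mc' prob_space.prob_le_1\<close>)
      have "ennreal (\<integral>y. ?u y \<partial>\<pi>') = (\<integral>\<^sup>+y. ?u y \<partial>\<pi>')"
        by (intro nn_integral_eq_integral[symmetric] ui) simp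
      also have "\<dots> = (\<integral>\<^sup>+y. emeasure (kernel_power S P n y) A \<partial>\<pi>')"
        using K pif'(3) by (intro nn_integral_cong) (auto simp: finite_measure.emeasure_eq_measure prob_space_def)
      also have "\<dots> = emeasure \<pi>' A"
        using inv' by (intro invariant_kernel_power[OF kernel pi' _ A]) (auto simp: invariant_measure_def)
      finally have "measure \<pi>' A = (\<integral>y. ?u y \<partial>\<pi>')" by (simp add: pi'.emeasure_eq_measure)
      then have "measure \<pi>' A - measure \<pi> A = (\<integral>y. ?u y - measure \<pi> A \<partial>\<pi>')"
        using ui by (simp add: Bochner_Integration.integral_diff pi'.prob_space)
      also have "\<bar>\<dots>\<bar> \<le> (\<integral>y. \<bar>?u y - measure \<pi> A\<bar> \<partial>\<pi>')" by (rule integral_abs_bound)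
      also have "\<dots> \<le> (\<integral>y. e n y \<partial>\<pi>')"
      proof (rule integral_mono)
        show "integrable \<pi>' (\<lambda>y. \<bar>?u y - measure \<pi> A\<bar>)" using ui by simp
        show "integrable \<pi>' (e n)"
          by (rule pi'.integrable_const_bound[of _ 1]) (use e0 em pif'(3) in auto)
        show "\<bar>?u y - measure \<pi> A\<bar> \<le> e n y" if "y \<in> space \<pi>'" for y
          unfolding e_def using that pif'(3) by (intro invariant_distance[OF inv A _ n]) simp
      qed
      finally show ?thesis .
    qed
    then have "\<bar>measure \<pi>' A - measure \<pi> A\<bar> \<le> 0"
      using lim' by (intro LIMSEQ_le_const[of _ 0]) auto
    then show "emeasure \<pi>' A = emeasure \<pi> A"
      by (simp add: pi.emeasure_eq_measure pi'.emeasure_eq_measure)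
  qed
  show thesis
  proof (rule that[OF inv unique])
    fix x assume x: "x \<in> space S"
    show "\<exists>e. (\<forall>n\<ge>1. \<forall>A\<in>sets S. \<bar>measure (kernel_power S P n x) A - measure \<pi> A\<bar> \<le> e n) \<and>
        (\<lambda>n. real n powr ((1 - \<theta>) / \<theta>) * e n) \<longlonglongrightarrow> 0"
      using invariant_distance[OF inv _ x] rate[OF x] by (intro exI[of _ "\<lambda>n. e n x"]) (auto simp: e_def)
  qed
qed

end

section \<open>The standard Gaussian measure\<close>

definition std_gauss :: "(real ^ 'm) measure" where
  "std_gauss = density lborel (\<lambda>z. ennreal (\<Prod>i\<in>UNIV. normal_density 0 1 (z $ i)))"

lemma sets_std_gauss [simp, measurable_cong]: "sets std_gauss = sets borel"
  by (simp add: std_gauss_def)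

lemma space_std_gauss [simp]: "space std_gauss = UNIV"
  by (simp add: std_gauss_def)

lemma prod_Basis_vec:
  fixes h :: "real ^ 'm \<Rightarrow> 'b::comm_monoid_mult"
  shows "(\<Prod>b\<in>Basis. h b) = (\<Prod>i\<in>UNIV. h (axis i 1))"
proof -
  have "(Basis :: (real ^ 'm) set) = range (\<lambda>i. axis i 1)" by (auto simp: Basis_vec_def)
  moreover have "inj (\<lambda>i::'m. axis i (1::real))" by (auto simp: inj_on_def axis_eq_axis)
  ultimately show ?thesis using prod.reindex[of "\<lambda>i::'m. axis i (1::real)" UNIV h] by (simp add: comp_def)
qed

lemma sum_Basis_vec:
  fixes h :: "real ^ 'm \<Rightarrow> 'b::comm_monoid_add"
  shows "(\<Sum>b\<in>Basis. h b) = (\<Sum>i\<in>UNIV. h (axis i 1))"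
proof -
  have "(Basis :: (real ^ 'm) set) = range (\<lambda>i. axis i 1)" by (auto simp: Basis_vec_def)
  moreover have "inj (\<lambda>i::'m. axis i (1::real))" by (auto simp: inj_on_def axis_eq_axis)
  ultimately show ?thesis using sum.reindex[of "\<lambda>i::'m. axis i (1::real)" UNIV h] by (simp add: comp_def)
qed

lemma nn_integral_std_gauss:
  fixes h :: "real ^ 'm \<Rightarrow> ennreal"
  assumes [measurable]: "h \<in> borel_measurable borel"
  shows "(\<integral>\<^sup>+z. h z \<partial>std_gauss) = (\<integral>\<^sup>+z. ennreal (\<Prod>i\<in>UNIV. normal_density 0 1 (z $ i)) * h z \<partial>lborel)"
  unfolding std_gauss_def by (subst nn_integral_density) auto

lemma nn_integral_std_gauss_prod:
  fixes h :: "'m::finite \<Rightarrow> real \<Rightarrow> ennreal"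
  assumes [measurable]: "\<And>i. h i \<in> borel_measurable borel"
  shows "(\<integral>\<^sup>+z. (\<Prod>i\<in>UNIV. h i (z $ i)) \<partial>std_gauss)
    = (\<Prod>i\<in>UNIV. \<integral>\<^sup>+u. ennreal (normal_density 0 1 u) * h i u \<partial>lborel)"
proof -
  define k :: "real ^ 'm \<Rightarrow> 'm" where "k b = (THE i. b = axis i 1)" for b
  have k[simp]: "k (axis i 1) = i" for i by (simp add: k_def axis_eq_axis)
  have "(\<integral>\<^sup>+z. (\<Prod>i\<in>UNIV. h i (z $ i)) \<partial>(std_gauss :: (real ^ 'm) measure))
      = (\<integral>\<^sup>+z. (\<Prod>b\<in>Basis. ennreal (normal_density 0 1 (z \<bullet> b)) * h (k b) (z \<bullet> b)) \<partial>lborel)"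
    by (subst nn_integral_std_gauss) (simp_all add: prod_Basis_vec prod.distrib prod_ennreal inner_axis)
  also have "\<dots> = (\<Prod>b\<in>(Basis :: (real ^ 'm) set). \<integral>\<^sup>+u. ennreal (normal_density 0 1 u) * h (k b) u \<partial>lborel)"
    by (rule nn_integral_lborel_prod) auto
  finally show ?thesis by (simp add: prod_Basis_vec)
qed

lemma nn_integral_normal_density: "0 < s \<Longrightarrow> (\<integral>\<^sup>+u. ennreal (normal_density 0 s u) \<partial>lborel) = 1"
  by (subst nn_integral_eq_integral) auto

lemma prob_space_std_gauss: "prob_space std_gauss"
proof (rule prob_spaceI)
  show "emeasure (std_gauss :: (real ^ 'm) measure) (space std_gauss) = 1"
    using nn_integral_std_gauss_prod[of "\<lambda>(_::'m) _. 1"] by (simp add: nn_integral_normal_density)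
qed

interpretation std_gauss: prob_space "std_gauss :: (real ^ 'm) measure"
  by (rule prob_space_std_gauss)

lemma normal_density_scale:
  assumes "c \<noteq> 0" shows "\<bar>c\<bar> * normal_density 0 \<bar>c\<bar> (c * u) = normal_density 0 1 u"
  using assms by (simp add: normal_density_def real_sqrt_mult power_mult_distrib)

text \<open>
  The change of variables for diagonal maps covers both the scaling by \<open>\<surd>t\<close> and the reflections of
  coordinates, which replace the computation of odd moments.
\<close>

lemma distr_std_gauss_diagonal:
  fixes c :: "'m::finite \<Rightarrow> real"
  assumes c: "\<And>i. c i \<noteq> 0"
  shows "distr std_gauss borel (\<lambda>z. \<chi> i. c i * z $ i)
    = density lborel (\<lambda>y. ennreal (\<Prod>i\<in>UNIV. normal_density 0 \<bar>c i\<bar> (y $ i)))" (is "?L = ?R")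
proof (rule measure_eqI)
  let ?T = "\<lambda>z::real ^ 'm. (\<chi> i. c i * z $ i) :: real ^ 'm"
  have T: "?T z = (\<Sum>b\<in>Basis. (inner (\<chi> i. c i) b * (z \<bullet> b)) *\<^sub>R b)" for z
    by (simp add: sum_Basis_vec inner_axis vec_eq_iff) (simp add: axis_def if_distrib cong: if_cong)
  have [measurable]: "?T \<in> borel_measurable borel"
    by (intro borel_measurable_continuous_onI continuous_intros)
  have nz: "inner (\<chi> i. c i) b \<noteq> 0" if "b \<in> Basis" for b
    using c that by (auto simp: Basis_vec_def inner_axis)
  have pr: "(\<Prod>b\<in>Basis. \<bar>inner (\<chi> i. c i) b\<bar>) = (\<Prod>i\<in>UNIV. \<bar>c i\<bar>)"
    by (simp add: prod_Basis_vec inner_axis)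
  have lb: "lborel = density (distr lborel borel ?T) (\<lambda>_. ennreal (\<Prod>i\<in>UNIV. \<bar>c i\<bar>))"
    using lborel_affine_euclidean[of "\<lambda>b. inner (\<chi> i. c i) b" 0, OF nz] by (simp only: T pr add_0)
  show "sets ?L = sets ?R" by simp
  fix A assume "A \<in> sets ?L"
  then have [measurable]: "A \<in> sets borel" by simp
  have "emeasure ?R A = (\<integral>\<^sup>+y. ennreal (\<Prod>i\<in>UNIV. normal_density 0 \<bar>c i\<bar> (y $ i)) * indicator A y \<partial>lborel)"
    by (simp add: emeasure_density)
  also have "\<dots> = (\<integral>\<^sup>+z. ennreal (\<Prod>i\<in>UNIV. \<bar>c i\<bar>) * (ennreal (\<Prod>i\<in>UNIV. normal_density 0 \<bar>c i\<bar> (?T z $ i)) * indicator A (?T z)) \<partial>lborel)"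
    by (subst lb, subst nn_integral_density, measurable, subst nn_integral_distr) auto
  also have "\<dots> = (\<integral>\<^sup>+z. ennreal (\<Prod>i\<in>UNIV. normal_density 0 1 (z $ i)) * indicator A (?T z) \<partial>lborel)"
    by (intro nn_integral_cong)
       (simp add: mult.assoc[symmetric] ennreal_mult[symmetric] prod_nonneg prod.distrib[symmetric] normal_density_scale c)
  also have "\<dots> = (\<integral>\<^sup>+z. indicator A (?T z) \<partial>std_gauss)"
    by (subst nn_integral_std_gauss) auto
  also have "\<dots> = (\<integral>\<^sup>+y. indicator A y \<partial>?L)"
    by (subst nn_integral_distr) auto
  also have "\<dots> = emeasure ?L A" by simp
  finally show "emeasure ?L A = emeasure ?R A" by simp
qed

lemma distr_std_gauss_scale:
  assumes "0 < s"
  shows "distr std_gauss borel (\<lambda>z. s *\<^sub>R z)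
    = density lborel (\<lambda>y::real ^ 'm. ennreal (\<Prod>i\<in>UNIV. normal_density 0 s (y $ i)))"
proof -
  have "(\<lambda>z::real ^ 'm. s *\<^sub>R z) = (\<lambda>z. \<chi> i. s * z $ i)" by (auto simp: vec_eq_iff)
  then show ?thesis using distr_std_gauss_diagonal[of "\<lambda>_::'m. s"] assms by simp
qed

lemma distr_std_gauss_reflect:
  assumes "\<And>i. \<bar>c i\<bar> = 1"
  shows "distr std_gauss borel (\<lambda>z::real ^ 'm. \<chi> i. c i * z $ i) = std_gauss"
proof -
  have "c i \<noteq> 0" for i using assms[of i] by auto
  then show ?thesis using distr_std_gauss_diagonal[of c] assms by (simp add: std_gauss_def)
qed

lemma integral_std_gauss_reflect:
  fixes h :: "real ^ 'm \<Rightarrow> real"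
  assumes "\<And>i. \<bar>c i\<bar> = 1" and [measurable]: "h \<in> borel_measurable borel"
  shows "(\<integral>z. h (\<chi> i. c i * z $ i) \<partial>std_gauss) = (\<integral>z. h z \<partial>std_gauss)"
proof -
  have [measurable]: "(\<lambda>z. (\<chi> i. c i * z $ i) :: real ^ 'm) \<in> borel_measurable borel"
    by (intro borel_measurable_continuous_onI continuous_intros)
  have "(\<integral>z. h z \<partial>std_gauss) = (\<integral>z. h z \<partial>distr std_gauss borel (\<lambda>z::real ^ 'm. \<chi> i. c i * z $ i))"
    using assms(1) by (simp add: distr_std_gauss_reflect)
  also have "\<dots> = (\<integral>z. h (\<chi> i. c i * z $ i) \<partial>std_gauss)"
    by (subst integral_distr) auto
  finally show ?thesis by simp
qed

lemma integral_std_gauss_uminus: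
  fixes h :: "real ^ 'm \<Rightarrow> real"
  assumes [measurable]: "h \<in> borel_measurable borel"
  shows "(\<integral>z. h (- z) \<partial>std_gauss) = (\<integral>z. h z \<partial>std_gauss)"
proof -
  have "(\<lambda>z::real ^ 'm. - z) = (\<lambda>z. \<chi> i. (-1) * z $ i)" by (auto simp: vec_eq_iff)
  then have "h (- z) = h (\<chi> i. (-1) * z $ i)" for z by metis
  then show ?thesis using integral_std_gauss_reflect[of "\<lambda>_. -1" h] by simp
qed

lemma integrable_normal_poly:
  "integrable lborel (\<lambda>u. normal_density 0 1 u * (1 + u\<^sup>2) ^ n)"
proof -
  have eq: "(\<lambda>u::real. normal_density 0 1 u * (1 + u\<^sup>2) ^ n)
      = (\<lambda>u. \<Sum>k\<le>n. of_nat (n choose k) * (normal_density 0 1 u * (u\<^sup>2) ^ (n - k)))"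
    by (rule ext) (simp add: binomial_ring sum_distrib_left mult_ac)
  have "integrable lborel (\<lambda>u. of_nat (n choose k) * (normal_density 0 1 u * (u\<^sup>2) ^ (n - k)))" for k
    using integrable_normal_moment[of 1 0 "2 * (n - k)"] unfolding power_mult by simp
  then show ?thesis unfolding eq by (rule Bochner_Integration.integrable_sum)
qed

text \<open>
  The bound \<open>1 + |z|\<^sup>2 \<le> \<Prod>\<^sub>i (1 + z\<^sub>i\<^sup>2)\<close> reduces the moments to one-dimensional ones by independence.
\<close>

lemma integrable_std_gauss_poly:
  "integrable std_gauss (\<lambda>z::real ^ 'm. (1 + (norm z)\<^sup>2) ^ n)"
proof (rule integrableI_bounded)
  have le: "1 + (norm z)\<^sup>2 \<le> (\<Prod>i\<in>UNIV. 1 + (z $ i)\<^sup>2)" for z :: "real ^ 'm"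
  proof -
    have "(norm z)\<^sup>2 = (\<Sum>i\<in>UNIV. (z $ i)\<^sup>2)"
      by (simp add: norm_vec_def L2_set_def real_norm_def sum_nonneg)
    moreover have "1 + (\<Sum>i\<in>A. (z $ i)\<^sup>2) \<le> (\<Prod>i\<in>A. 1 + (z $ i)\<^sup>2)" for A :: "'m set"
    proof (induction A rule: infinite_finite_induct)
      case (insert i A)
      have "1 \<le> (\<Prod>i\<in>A. 1 + (z $ i)\<^sup>2)" by (rule order_trans[OF _ insert.IH]) (simp add: sum_nonneg)
      then have "(z $ i)\<^sup>2 * 1 \<le> (z $ i)\<^sup>2 * (\<Prod>i\<in>A. 1 + (z $ i)\<^sup>2)" by (intro mult_left_mono) auto
      then show ?case using insert by (simp add: algebra_simps)
    qed auto
    ultimately show ?thesis by simp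
  qed
  have "(\<integral>\<^sup>+z. ennreal (norm ((1 + (norm z)\<^sup>2) ^ n)) \<partial>(std_gauss :: (real ^ 'm) measure))
      \<le> (\<integral>\<^sup>+z. (\<Prod>i\<in>UNIV. ennreal ((1 + (z $ i)\<^sup>2) ^ n)) \<partial>(std_gauss :: (real ^ 'm) measure))"
  proof (rule nn_integral_mono)
    fix z :: "real ^ 'm"
    have "norm ((1 + (norm z)\<^sup>2) ^ n) = (1 + (norm z)\<^sup>2) ^ n" by simp
    also have "\<dots> \<le> (\<Prod>i\<in>UNIV. 1 + (z $ i)\<^sup>2) ^ n" using le by (intro power_mono) auto
    also have "\<dots> = (\<Prod>i\<in>UNIV. (1 + (z $ i)\<^sup>2) ^ n)" by (simp add: prod_power_distrib)
    finally show "ennreal (norm ((1 + (norm z)\<^sup>2) ^ n)) \<le> (\<Prod>i\<in>UNIV. ennreal ((1 + (z $ i)\<^sup>2) ^ n))"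
      by (simp add: prod_ennreal ennreal_leI)
  qed
  also have "\<dots> = (\<Prod>i\<in>(UNIV::'m set). \<integral>\<^sup>+u. ennreal (normal_density 0 1 u) * ennreal ((1 + u\<^sup>2) ^ n) \<partial>lborel)"
    by (rule nn_integral_std_gauss_prod) simp
  also have "\<dots> < \<infinity>"
    using integrable_normal_poly[of n]
    by (auto simp: ennreal_mult[symmetric] nn_integral_eq_integral less_top[symmetric] power_eq_top_ennreal)
  finally show "(\<integral>\<^sup>+z. ennreal (norm ((1 + (norm z)\<^sup>2) ^ n)) \<partial>(std_gauss :: (real ^ 'm) measure)) < \<infinity>" .
qed simp

lemma integrable_std_gauss_bound:
  fixes h :: "real ^ 'm \<Rightarrow> real"
  assumes "h \<in> borel_measurable borel" and "\<And>z. \<bar>h z\<bar> \<le> C * (1 + (norm z)\<^sup>2) ^ n"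
  shows "integrable std_gauss h"
proof (rule Bochner_Integration.integrable_bound)
  show "integrable std_gauss (\<lambda>z::real ^ 'm. C * (1 + (norm z)\<^sup>2) ^ n)"
    by (intro integrable_mult_right integrable_std_gauss_poly)
  show "AE z in std_gauss. norm (h z) \<le> norm (C * (1 + (norm z)\<^sup>2) ^ n)"
    using assms(2) by (intro AE_I2) (metis abs_ge_self order_trans real_norm_def)
qed (use assms in simp)

lemma integrable_std_gauss_coords: "integrable std_gauss (\<lambda>z::real ^ 'm. z $ i * z $ j)"
proof (rule integrable_std_gauss_bound[where C = 1 and n = 1])
  fix z :: "real ^ 'm"
  have "\<bar>z $ i * z $ j\<bar> \<le> norm z * norm z"
    unfolding abs_mult by (intro mult_mono component_le_norm_cart) auto
  then show "\<bar>z $ i * z $ j\<bar> \<le> 1 * (1 + (norm z)\<^sup>2) ^ 1" by (simp add: power2_eq_square)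
qed measurable

lemma integral_std_gauss_coords:
  "(\<integral>z. z $ i * z $ j \<partial>(std_gauss :: (real ^ 'm) measure)) = (if i = j then 1 else 0)"
proof (cases "i = j")
  case True
  have "ennreal (\<integral>z. z $ i * z $ i \<partial>(std_gauss :: (real ^ 'm) measure)) = (\<integral>\<^sup>+z. ennreal (z $ i * z $ i) \<partial>(std_gauss :: (real ^ 'm) measure))"
    by (intro nn_integral_eq_integral[symmetric] integrable_std_gauss_coords) simp
  also have "\<dots> = (\<integral>\<^sup>+z. (\<Prod>k\<in>UNIV. if k = i then ennreal ((z $ k)\<^sup>2) else 1) \<partial>(std_gauss :: (real ^ 'm) measure))"
    by (simp add: prod.delta power2_eq_square)
  also have "\<dots> = (\<Prod>k\<in>(UNIV :: 'm set). \<integral>\<^sup>+u. ennreal (normal_density 0 1 u) * (if k = i then ennreal (u\<^sup>2) else 1) \<partial>lborel)"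
    by (rule nn_integral_std_gauss_prod) measurable
  also have "\<dots> = (\<Prod>k\<in>(UNIV :: 'm set). 1)"
  proof (rule prod.cong)
    fix k :: 'm
    have "(\<integral>\<^sup>+u. ennreal (normal_density 0 1 u) * ennreal (u\<^sup>2) \<partial>lborel) = ennreal (\<integral>u. normal_density 0 1 u * u\<^sup>2 \<partial>lborel)"
      using integrable_normal_moment[of 1 0 2]
      by (subst nn_integral_eq_integral[symmetric]) (auto simp: ennreal_mult)
    also have "\<dots> = 1" using integral_normal_moment_even[of 1 0 1] by simp
    finally show "(\<integral>\<^sup>+u. ennreal (normal_density 0 1 u) * (if k = i then ennreal (u\<^sup>2) else 1) \<partial>lborel) = 1"
      by (cases "k = i") (simp_all add: nn_integral_normal_density)
  qed simp
  finally show ?thesis using True by simp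
next
  case False
  \<comment> \<open>Reflecting the coordinate \<open>i\<close> preserves the measure and changes the sign of the product.\<close>
  let ?c = "\<lambda>k. if k = i then -1 else 1 :: real"
  have "(\<integral>z. z $ i * z $ j \<partial>(std_gauss :: (real ^ 'm) measure)) = (\<integral>z. (\<chi> k. ?c k * z $ k) $ i * (\<chi> k. ?c k * z $ k) $ j \<partial>(std_gauss :: (real ^ 'm) measure))"
    by (rule integral_std_gauss_reflect[symmetric]) auto
  also have "\<dots> = - (\<integral>z. z $ i * z $ j \<partial>(std_gauss :: (real ^ 'm) measure))"
    using False by simp
  finally show ?thesis using False by simp
qed

lemma norm_vec_power2:
  fixes v :: "'a::real_inner ^ 'n"
  shows "(norm v)\<^sup>2 = (\<Sum>k\<in>UNIV. (norm (v $ k))\<^sup>2)"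
  by (simp add: power2_norm_eq_inner inner_vec_def)

lemma continuous_on_matrix_vector_mult:
  fixes A :: "'a::topological_space \<Rightarrow> real ^ 'm ^ 'd"
  assumes "continuous_on S A" "continuous_on S u"
  shows "continuous_on S (\<lambda>x. A x *v u x)"
  unfolding matrix_vector_mult_def
  by (intro continuous_on_vec_lambda continuous_on_sum continuous_on_mult continuous_on_component assms)

lemma measurable_matrix_vector_mult2 [measurable (raw)]:
  fixes A :: "'a \<Rightarrow> real ^ 'm ^ 'd"
  assumes "A \<in> borel_measurable M" "u \<in> borel_measurable M"
  shows "(\<lambda>x. A x *v u x) \<in> borel_measurable M"
  using assms
  by (rule borel_measurable_continuous_Pair) (intro continuous_on_matrix_vector_mult continuous_intros)

lemma integral_std_gauss_quadratic:
  fixes B :: "real ^ 'm ^ 'd"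
  shows "integrable std_gauss (\<lambda>z. (norm (B *v z))\<^sup>2)"
    and "(\<integral>z. (norm (B *v z))\<^sup>2 \<partial>std_gauss) = (norm B)\<^sup>2"
proof -
  have eq: "(norm (B *v z))\<^sup>2 = (\<Sum>k\<in>UNIV. \<Sum>i\<in>UNIV. \<Sum>j\<in>UNIV. B $ k $ i * B $ k $ j * (z $ i * z $ j))" for z
    unfolding norm_vec_power2 by (simp add: matrix_vector_mult_def power2_eq_square sum_product mult_ac)
  have nB: "(norm B)\<^sup>2 = (\<Sum>k\<in>UNIV. \<Sum>i\<in>UNIV. (B $ k $ i)\<^sup>2)"
    by (simp add: norm_vec_power2)
  show "integrable std_gauss (\<lambda>z. (norm (B *v z))\<^sup>2)"
    unfolding eq by (intro Bochner_Integration.integrable_sum integrable_mult_right integrable_std_gauss_coords)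
  show "(\<integral>z. (norm (B *v z))\<^sup>2 \<partial>std_gauss) = (norm B)\<^sup>2"
    unfolding eq nB
    by (simp add: Bochner_Integration.integral_sum integrable_std_gauss_coords integral_std_gauss_coords
        power2_eq_square if_distrib cong: if_cong)
qed

text \<open>
  Every coordinate of a point of the ball has absolute value at most \<open>R\<close>.
\<close>

lemma std_gauss_lower:
  assumes E: "E \<in> sets borel" and R: "E \<subseteq> cball 0 R"
  shows "ennreal (normal_density 0 1 R ^ CARD('m)) * emeasure lborel E \<le> emeasure (std_gauss :: (real ^ 'm) measure) E"
proof -
  have "normal_density 0 1 R ^ CARD('m) \<le> (\<Prod>i\<in>UNIV. normal_density 0 1 (z $ i))" if "z \<in> E" for z :: "real ^ 'm"
  proof -
    have "normal_density 0 1 R \<le> normal_density 0 1 (z $ i)" for i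
    proof -
      have "\<bar>z $ i\<bar> \<le> \<bar>R\<bar>" using component_le_norm_cart[of z i] that R by force
      then have "(z $ i)\<^sup>2 \<le> R\<^sup>2" by (rule abs_le_square_iff[THEN iffD1])
      then show ?thesis by (simp add: normal_density_def divide_right_mono)
    qed
    then have "(\<Prod>i\<in>(UNIV::'m set). normal_density 0 1 R) \<le> (\<Prod>i\<in>UNIV. normal_density 0 1 (z $ i))"
      by (intro prod_mono) auto
    then show ?thesis by simp
  qed
  then have "(\<integral>\<^sup>+z. ennreal (normal_density 0 1 R ^ CARD('m)) * indicator E z \<partial>lborel)
      \<le> (\<integral>\<^sup>+z. ennreal (\<Prod>i\<in>UNIV. normal_density 0 1 (z $ i)) * indicator E (z :: real ^ 'm) \<partial>lborel)"
    by (intro nn_integral_mono) (auto simp: indicator_def intro!: ennreal_leI)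
  then show ?thesis using E by (simp add: nn_integral_cmult std_gauss_def emeasure_density)
qed

lemma null_sets_std_gauss: "E \<in> null_sets lborel \<Longrightarrow> E \<in> null_sets std_gauss"
  by (auto simp: std_gauss_def null_sets_density_iff intro: eventually_mono[OF AE_not_in])

text \<open>
  The transition kernel of the scheme; the variance \<open>\<delta> x\<close> of the increment enters through the scaling
  of a standard Gaussian, so that the source measure does not depend on \<open>x\<close>.
\<close>

definition em_transition ::
  "(real ^ 'd \<Rightarrow> real ^ 'd) \<Rightarrow> (real ^ 'd \<Rightarrow> real ^ 'm ^ 'd) \<Rightarrow> (real ^ 'd \<Rightarrow> real) \<Rightarrow> real ^ 'd \<Rightarrow> (real ^ 'd) measure" where
  "em_transition f g \<delta> x = distr std_gauss borel (\<lambda>z. x + \<delta> x *\<^sub>R f x + g x *v (sqrt (\<delta> x) *\<^sub>R z))"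

section \<open>Minorization of affine Gaussian laws\<close>

text \<open>
  The solution of minimal norm is \<open>B\<^sup>T (B B\<^sup>T)\<^sup>-\<^sup>1 y\<close>, where ellipticity makes \<open>B B\<^sup>T\<close> injective.
\<close>

lemma elliptic_right_inverse:
  fixes B :: "real ^ 'm ^ 'd"
  assumes lam: "0 < \<kappa>" and ell: "\<And>v. \<kappa> * (norm v)\<^sup>2 \<le> (norm (transpose B *v v))\<^sup>2"
  obtains k where "B *v k = y" "norm k \<le> norm y / sqrt \<kappa>"
proof -
  have adj: "v \<bullet> (B *v w) = (transpose B *v v) \<bullet> w" for v w
    by (simp add: dot_lmul_matrix)
  let ?G = "\<lambda>u. B *v (transpose B *v u)"
  have lin: "linear ?G"
    using linear_compose[OF matrix_vector_mul_linear[of "transpose B"] matrix_vector_mul_linear[of B]]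
    unfolding comp_def .
  moreover have "inj ?G"
  proof (subst linear_injective_0[OF lin], intro allI impI)
    fix u assume "?G u = 0"
    then have "(norm (transpose B *v u))\<^sup>2 = 0"
      using adj[of u "transpose B *v u"] by (simp add: power2_norm_eq_inner)
    then have "\<kappa> * (norm u)\<^sup>2 \<le> 0" using ell[of u] by simp
    then show "u = 0" using lam by (simp add: mult_le_0_iff)
  qed
  ultimately have "surj ?G" by (intro linear_injective_imp_surjective) simp_all
  then obtain u where u: "?G u = y" by (metis surjD)
  define k where "k = transpose B *v u"
  have "(norm k)\<^sup>2 = u \<bullet> y" using adj[of u k] u by (simp add: k_def power2_norm_eq_inner)
  also have "\<dots> \<le> norm u * norm y" by (rule norm_cauchy_schwarz)
  finally have k2: "(norm k)\<^sup>2 \<le> norm u * norm y" .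
  have "sqrt (\<kappa> * (norm u)\<^sup>2) \<le> sqrt ((norm k)\<^sup>2)"
    unfolding k_def by (rule real_sqrt_le_mono[OF ell])
  then have su: "sqrt \<kappa> * norm u \<le> norm k" using lam by (simp add: real_sqrt_mult)
  have "norm k \<le> norm y / sqrt \<kappa>"
  proof (cases "norm k = 0")
    case False
    have "sqrt \<kappa> * (norm k * norm k) \<le> (sqrt \<kappa> * norm u) * norm y"
      using k2 lam by (simp add: power2_eq_square mult.assoc mult_left_mono)
    also have "\<dots> \<le> norm k * norm y" using su by (intro mult_right_mono) auto
    finally have "sqrt \<kappa> * norm k \<le> norm y" using False by (simp add: mult.left_commute)
    then show ?thesis using lam by (simp add: field_simps)
  qed (use lam in simp)
  then show ?thesis using that u by (simp add: k_def)
qed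

lemma emeasure_lborel_shift:
  fixes k :: "'a::euclidean_space"
  assumes "E \<in> sets borel"
  shows "emeasure lborel {z. k + z \<in> E} = emeasure lborel E"
proof -
  have "emeasure lborel E = emeasure (distr lborel borel ((+) k)) E" by (simp add: lborel_distr_plus)
  also have "\<dots> = emeasure lborel {z. k + z \<in> E}"
    using assms by (subst emeasure_distr) (auto simp: vimage_def)
  finally show ?thesis by simp
qed

text \<open>
  If \<open>B k = y\<close>, then translation by \<open>k\<close> maps \<open>{z. b + B z + y \<in> A}\<close> to \<open>{z. b + B z \<in> A}\<close>.  Averaging this
  over \<open>y\<close> in a ball of radius \<open>r\<close> and exchanging the order of integration, the inner integral runs over
  \<open>y\<close> for fixed \<open>z\<close> and is the Lebesgue measure of a translate of \<open>A\<close>.  Thus no density of the image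
  measure has to be computed.
\<close>

lemma affine_lborel_minorization:
  fixes B :: "real ^ 'm ^ 'd"
  assumes A: "A \<in> sets borel" and lam: "0 < \<kappa>"
    and ell: "\<And>v. \<kappa> * (norm v)\<^sup>2 \<le> (norm (transpose B *v v))\<^sup>2"
    and r: "\<And>z a. norm z \<le> 1 \<Longrightarrow> norm a \<le> \<rho> \<Longrightarrow> norm (a - (b + B *v z)) \<le> r"
  shows "emeasure lborel (cball (0 :: real ^ 'm) 1) * emeasure lborel (A \<inter> cball 0 \<rho>)
    \<le> emeasure lborel {z \<in> cball 0 (1 + r / sqrt \<kappa>). b + B *v z \<in> A} * emeasure lborel (cball (0 :: real ^ 'd) r)"
proof -
  let ?E = "{z \<in> cball 0 (1 + r / sqrt \<kappa>). b + B *v z \<in> A}"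
  note [measurable] = A
  have [measurable]: "cball (0 :: real ^ 'm) s \<in> sets borel" "cball (0 :: real ^ 'd) s \<in> sets borel" for s
    by simp_all
  have E: "?E \<in> sets borel" by measurable
  have shift: "emeasure lborel {z \<in> cball 0 1. b + B *v z + y \<in> A} \<le> emeasure lborel ?E" if y: "norm y \<le> r" for y
  proof -
    obtain k where k: "B *v k = y" "norm k \<le> norm y / sqrt \<kappa>"
      using elliptic_right_inverse[OF lam ell] by metis
    have "norm k \<le> r / sqrt \<kappa>" using k(2) y lam by (meson divide_right_mono order_trans real_sqrt_ge_zero less_imp_le)
    then have "{z \<in> cball 0 1. b + B *v z + y \<in> A} \<subseteq> {z. k + z \<in> ?E}"
      by (auto simp: matrix_vector_right_distrib k(1) add_ac intro: order_trans[OF norm_triangle_ineq])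
    moreover have "{z. k + z \<in> ?E} \<in> sets lborel"
      using measurable_sets_borel[of "(+) k" borel ?E] E by (simp add: vimage_def)
    ultimately have "emeasure lborel {z \<in> cball 0 1. b + B *v z + y \<in> A} \<le> emeasure lborel {z. k + z \<in> ?E}"
      by (rule emeasure_mono)
    then show ?thesis using emeasure_lborel_shift[OF E] by simp
  qed
  have "emeasure lborel (cball (0 :: real ^ 'm) 1) * emeasure lborel (A \<inter> cball 0 \<rho>)
      = (\<integral>\<^sup>+z. indicator (cball (0 :: real ^ 'm) 1) z * emeasure lborel (A \<inter> cball 0 \<rho>) \<partial>lborel)"
    by (subst nn_integral_multc) (simp_all add: borel_measurable_indicator)
  also have "\<dots> \<le> (\<integral>\<^sup>+z. \<integral>\<^sup>+y. indicator (cball 0 1) z * indicator (cball 0 r) y * indicator A (b + B *v z + y) \<partial>lborel \<partial>lborel)"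
  proof (rule nn_integral_mono)
    fix z :: "real ^ 'm"
    let ?v = "b + B *v z"
    have "emeasure lborel (A \<inter> cball 0 \<rho>) = emeasure lborel {y. ?v + y \<in> A \<inter> cball 0 \<rho>}"
      by (rule emeasure_lborel_shift[symmetric]) measurable
    also have "\<dots> \<le> emeasure lborel {y. norm y \<le> r \<and> ?v + y \<in> A}" if "norm z \<le> 1"
    proof (rule emeasure_mono)
      show "{y. ?v + y \<in> A \<inter> cball 0 \<rho>} \<subseteq> {y. norm y \<le> r \<and> ?v + y \<in> A}"
      proof safe
        fix y assume "?v + y \<in> A" "?v + y \<in> cball 0 \<rho>"
        then show "norm y \<le> r" using r[OF that, of "?v + y"] by simp
      qed
    qed measurable
    also have "\<dots> = (\<integral>\<^sup>+y. indicator {y. norm y \<le> r \<and> ?v + y \<in> A} y \<partial>lborel)" by simp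
    finally have le: "norm z \<le> 1 \<Longrightarrow> emeasure lborel (A \<inter> cball 0 \<rho>) \<le> (\<integral>\<^sup>+y. indicator {y. norm y \<le> r \<and> ?v + y \<in> A} y \<partial>lborel)" .
    show "indicator (cball 0 1) z * emeasure lborel (A \<inter> cball 0 \<rho>)
        \<le> (\<integral>\<^sup>+y. indicator (cball 0 1) z * indicator (cball 0 r) y * indicator A (?v + y) \<partial>lborel)"
    proof (cases "norm z \<le> 1")
      case True
      have "(\<integral>\<^sup>+y. indicator {y. norm y \<le> r \<and> ?v + y \<in> A} y \<partial>lborel)
          = (\<integral>\<^sup>+y. indicator (cball 0 1) z * indicator (cball 0 r) y * indicator A (?v + y) \<partial>lborel)"
        using True by (intro nn_integral_cong) (auto simp: indicator_def)
      then show ?thesis using le[OF True] True by simp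
    qed simp
  qed
  also have "\<dots> = (\<integral>\<^sup>+y. \<integral>\<^sup>+z. indicator (cball 0 1) z * indicator (cball 0 r) y * indicator A (b + B *v z + y) \<partial>lborel \<partial>lborel)"
    by (rule lborel_pair.Fubini') measurable
  also have "\<dots> \<le> (\<integral>\<^sup>+y. emeasure lborel ?E * indicator (cball (0 :: real ^ 'd) r) y \<partial>lborel)"
  proof (rule nn_integral_mono)
    fix y :: "real ^ 'd"
    have E1: "{z \<in> cball 0 1. b + B *v z + y \<in> A} \<in> sets lborel" by measurable
    have "(\<integral>\<^sup>+z. indicator (cball 0 1) z * indicator (cball 0 r) y * indicator A (b + B *v z + y) \<partial>lborel)
        = indicator (cball 0 r) y * (\<integral>\<^sup>+z. indicator {z \<in> cball 0 1. b + B *v z + y \<in> A} z \<partial>lborel)"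
      by (subst nn_integral_cmult[symmetric]) (auto intro!: nn_integral_cong simp: indicator_def)
    also have "\<dots> = indicator (cball 0 r) y * emeasure lborel {z \<in> cball 0 1. b + B *v z + y \<in> A}"
      by (simp only: nn_integral_indicator[OF E1])
    also have "\<dots> \<le> emeasure lborel ?E * indicator (cball 0 r) y"
      using shift[of y] by (cases "norm y \<le> r") auto
    finally show "(\<integral>\<^sup>+z. indicator (cball 0 1) z * indicator (cball 0 r) y * indicator A (b + B *v z + y) \<partial>lborel)
        \<le> emeasure lborel ?E * indicator (cball 0 r) y" .
  qed
  also have "\<dots> = emeasure lborel ?E * emeasure lborel (cball (0 :: real ^ 'd) r)"
    by (simp add: nn_integral_cmult)
  finally show ?thesis .
qed

text \<open>
  The constant depends on \<open>B\<close> and \<open>b\<close> only through the ellipticity constant and the radius \<open>r\<close>, which is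
  what makes the bound uniform over bounded sets of starting points.
\<close>

lemma affine_gauss_minorization:
  fixes \<kappa> \<rho> r :: real
  assumes lam: "0 < \<kappa>" and r0: "0 < r"
  obtains c where "0 < c"
    "\<And>(B :: real ^ 'm ^ 'd) b A. A \<in> sets borel \<Longrightarrow> (\<And>v. \<kappa> * (norm v)\<^sup>2 \<le> (norm (transpose B *v v))\<^sup>2) \<Longrightarrow>
      (\<And>z a. norm z \<le> 1 \<Longrightarrow> norm a \<le> \<rho> \<Longrightarrow> norm (a - (b + B *v z)) \<le> r) \<Longrightarrow>
      ennreal c * emeasure lborel (A \<inter> cball 0 \<rho>) \<le> emeasure (distr std_gauss borel (\<lambda>z. b + B *v z)) A"
proof -
  define R where "R = 1 + r / sqrt \<kappa>"
  define nd where "nd = normal_density 0 1 R ^ CARD('m)"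
  define L1 where "L1 = measure lborel (cball (0 :: real ^ 'm) 1)"
  define Lr where "Lr = measure lborel (cball (0 :: real ^ 'd) r)"
  have pos: "0 < nd" "0 < L1" "0 < Lr"
    using r0 content_cball_pos[of 1 "0 :: real ^ 'm"] content_cball_pos[of r "0 :: real ^ 'd"]
    by (auto simp: nd_def L1_def Lr_def normal_density_pos)
  have em: "emeasure lborel (cball (0 :: real ^ 'm) 1) = ennreal L1" "emeasure lborel (cball (0 :: real ^ 'd) r) = ennreal Lr"
    using emeasure_lborel_cball_finite[of "0 :: real ^ 'm" 1] emeasure_lborel_cball_finite[of "0 :: real ^ 'd" r]
    by (auto simp: L1_def Lr_def emeasure_eq_ennreal_measure less_top)
  show thesis
  proof (rule that[of "nd * L1 / Lr"])
    show "0 < nd * L1 / Lr" using pos by simp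
    fix B :: "real ^ 'm ^ 'd" and b :: "real ^ 'd" and A :: "(real ^ 'd) set"
    assume A[measurable]: "A \<in> sets borel" and ell: "\<And>v. \<kappa> * (norm v)\<^sup>2 \<le> (norm (transpose B *v v))\<^sup>2"
      and r: "\<And>z a. norm z \<le> 1 \<Longrightarrow> norm a \<le> \<rho> \<Longrightarrow> norm (a - (b + B *v z)) \<le> r"
    let ?E = "{z \<in> cball 0 R. b + B *v z \<in> A}"
    have E[measurable]: "?E \<in> sets borel" by measurable
    have "ennreal L1 * emeasure lborel (A \<inter> cball 0 \<rho>) \<le> emeasure lborel ?E * ennreal Lr"
      using affine_lborel_minorization[OF A lam ell r] by (simp add: em R_def)
    then have "ennreal (nd / Lr) * (ennreal L1 * emeasure lborel (A \<inter> cball 0 \<rho>)) \<le> ennreal (nd / Lr) * (emeasure lborel ?E * ennreal Lr)"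
      by (intro mult_left_mono) auto
    also have "ennreal (nd / Lr) * (emeasure lborel ?E * ennreal Lr) = ennreal nd * emeasure lborel ?E"
    proof -
      have "ennreal nd = ennreal (nd / Lr) * ennreal Lr" using pos by (subst ennreal_mult[symmetric]) auto
      then show ?thesis by (simp add: mult_ac)
    qed
    also have "\<dots> \<le> emeasure std_gauss ?E"
      unfolding nd_def by (rule std_gauss_lower[OF E]) auto
    also have "\<dots> \<le> emeasure std_gauss ((\<lambda>z. b + B *v z) -` A \<inter> space std_gauss)"
      by (rule emeasure_mono[OF _ measurable_sets[OF _ A]]) auto
    also have "\<dots> = emeasure (distr std_gauss borel (\<lambda>z. b + B *v z)) A"
      by (rule emeasure_distr[symmetric]) measurable
    finally show "ennreal (nd * L1 / Lr) * emeasure lborel (A \<inter> cball 0 \<rho>) \<le> emeasure (distr std_gauss borel (\<lambda>z. b + B *v z)) A"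
      using pos by (simp add: mult.assoc[symmetric] ennreal_mult[symmetric])
  qed
qed

text \<open>
  By translation invariance the measure of \<open>{z. b + B z + y \<in> A}\<close> does not depend on \<open>y\<close>, and by Fubini it
  vanishes for almost every \<open>y\<close>.
\<close>

lemma affine_gauss_null:
  fixes B :: "real ^ 'm ^ 'd"
  assumes A: "A \<in> null_sets lborel" and lam: "0 < \<kappa>"
    and ell: "\<And>v. \<kappa> * (norm v)\<^sup>2 \<le> (norm (transpose B *v v))\<^sup>2"
  shows "emeasure (distr std_gauss borel (\<lambda>z. b + B *v z)) A = 0"
proof -
  have [measurable]: "A \<in> sets borel" using A by auto
  let ?N = "\<lambda>y. {z. b + B *v z + y \<in> A}"
  have eq: "emeasure lborel (?N y) = emeasure lborel (?N 0)" for y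
  proof -
    obtain k where k: "B *v k = y" using elliptic_right_inverse[OF lam ell] by metis
    have "?N y = {z. k + z \<in> ?N 0}" by (auto simp: matrix_vector_right_distrib k add_ac)
    moreover have "?N 0 \<in> sets borel" by measurable
    ultimately show ?thesis using emeasure_lborel_shift[of "?N 0" k] by simp
  qed
  have m: "?N y \<in> sets borel" "{y. b + B *v z + y \<in> A} \<in> sets borel" for y z by measurable
  have ind: "indicator A (b + B *v z + y) = (indicator (?N y) z :: ennreal)"
    "indicator A (b + B *v z + y) = (indicator {y. b + B *v z + y \<in> A} y :: ennreal)" for z y
    by (simp_all add: indicator_def)
  have "(\<integral>\<^sup>+y. emeasure lborel (?N y) \<partial>lborel) = (\<integral>\<^sup>+y. \<integral>\<^sup>+z. indicator A (b + B *v z + y) \<partial>lborel \<partial>lborel)"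
    unfolding ind(1) using m by simp
  also have "\<dots> = (\<integral>\<^sup>+z. \<integral>\<^sup>+y. indicator A (b + B *v z + y) \<partial>lborel \<partial>lborel)"
    by (rule lborel_pair.Fubini') measurable
  also have "\<dots> = (\<integral>\<^sup>+z. emeasure lborel {y. (b + B *v z) + y \<in> A} \<partial>lborel)"
    unfolding ind(2) using m by simp
  also have "\<dots> = 0"
    using A by (subst emeasure_lborel_shift) auto
  finally have "emeasure lborel (?N 0) * emeasure lborel (UNIV :: (real ^ 'd) set) = 0" by (simp add: eq)
  then have "emeasure lborel (?N 0) = 0" by simp
  then have "?N 0 \<in> null_sets lborel" by (intro null_setsI) auto
  then have "emeasure std_gauss (?N 0) = 0" using null_sets_std_gauss by blast
  then show ?thesis by (subst emeasure_distr) (auto simp: vimage_def)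
qed

section \<open>Moments of one Euler--Maruyama step\<close>

text \<open>
  Powers with exponents of either sign are treated alike: \<open>y \<ge> 1/2\<close> keeps negative powers bounded, and
  \<open>a\<close> controls positive ones.
\<close>

lemma powr_poly_bound:
  fixes y a r :: real
  assumes y: "1/2 \<le> y" "y \<le> a" and a: "1 \<le> a" and r: "\<bar>r\<bar> \<le> real N"
  shows "y powr r \<le> (2 * a) ^ N"
proof -
  have "y powr r \<le> (2 * a) powr \<bar>r\<bar>"
  proof (cases "0 \<le> r")
    case True
    then show ?thesis using y a by (auto intro!: powr_mono2)
  next
    case False
    have "y powr r = (1 / y) powr \<bar>r\<bar>" using y False by (simp add: powr_minus_divide powr_divide)
    also have "\<dots> \<le> (2 * a) powr \<bar>r\<bar>"
    proof (rule powr_mono2)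
      have "1 / y \<le> 2" using y by (simp add: field_simps)
      then show "1 / y \<le> 2 * a" using a by linarith
    qed (use y in auto)
    finally show ?thesis .
  qed
  also have "\<dots> \<le> (2 * a) powr real N" using r a by (intro powr_mono) auto
  also have "\<dots> = (2 * a) ^ N" using a by (simp add: powr_realpow)
  finally show ?thesis .
qed

lemma powr_lipschitz_bound:
  fixes y a r :: real
  assumes y: "1/2 \<le> y" "y \<le> a" and a: "1 \<le> a" and r: "\<bar>r - 1\<bar> \<le> real N"
  shows "\<bar>y powr r - 1\<bar> \<le> \<bar>r\<bar> * (2 * a) ^ N * \<bar>y - 1\<bar>"
proof -
  have "norm (y powr r - 1 powr r) \<le> \<bar>r\<bar> * (2 * a) ^ N * norm (y - 1)"
  proof (rule field_differentiable_bound[of "{1/2..a}"])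
    fix s assume s: "s \<in> {1/2..a}"
    then show "((\<lambda>s. s powr r) has_field_derivative r * s powr (r - 1)) (at s within {1/2..a})"
      by (auto intro!: derivative_eq_intros)
    show "norm (r * s powr (r - 1)) \<le> \<bar>r\<bar> * (2 * a) ^ N"
      using powr_poly_bound[of s a "r - 1" N] s a r by (auto simp: abs_mult intro!: mult_left_mono)
  qed (use y a in auto)
  then show ?thesis by simp
qed

text \<open>
  Taylor's formula of order 4 at \<open>t\<close> and \<open>-t\<close>, in which the odd terms cancel, for \<open>|t| \<le> 1/2\<close>; for the
  other \<open>t\<close> the left-hand side is at most \<open>2\<^bsup>q\<^esup> \<le> 2\<^bsup>q\<^esup> 16 t\<^sup>4\<close>.
\<close>

lemma symmetric_powr_expansion:
  fixes q :: real
  assumes q: "1 \<le> q"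
  obtains C where "0 \<le> C" "\<And>t. \<bar>t\<bar> \<le> 1 \<Longrightarrow>
    ((1 + t) powr q + (1 - t) powr q) / 2 \<le> 1 + q * (q - 1) / 2 * t\<^sup>2 + C * t ^ 4"
proof -
  define d where "d m t = (\<Prod>i<m. q - real i) * (1 + t) powr (q - real m)" for m and t :: real
  obtain N where N: "\<bar>q - 4\<bar> \<le> real N" using real_arch_simple by blast
  define K where "K = \<bar>\<Prod>i<4. q - real i\<bar> * (2 * 2) ^ N"
  have taylor: "(1 + t) powr q \<le> 1 + q * t + q * (q - 1) / 2 * t\<^sup>2 + q * (q - 1) * (q - 2) / 6 * t ^ 3 + K / 24 * t ^ 4"
    if t: "\<bar>t\<bar> \<le> 1/2" for t
  proof -
    have "\<exists>s. \<bar>s\<bar> \<le> \<bar>t\<bar> \<and> d 0 t = (\<Sum>m<4. d m 0 / fact m * t ^ m) + d 4 s / fact 4 * t ^ 4"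
    proof (rule Maclaurin_bi_le)
      show "\<forall>m s. m < 4 \<and> \<bar>s\<bar> \<le> \<bar>t\<bar> \<longrightarrow> ((\<lambda>s. d m s) has_real_derivative d (Suc m) s) (at s)"
      proof (intro allI impI)
        fix m :: nat and s assume "m < 4 \<and> \<bar>s\<bar> \<le> \<bar>t\<bar>"
        then have "0 < 1 + s" using t by linarith
        then show "((\<lambda>s. d m s) has_real_derivative d (Suc m) s) (at s)"
          unfolding d_def by (auto intro!: derivative_eq_intros simp: algebra_simps)
      qed
    qed simp
    then obtain s where s: "\<bar>s\<bar> \<le> \<bar>t\<bar>" and eq: "d 0 t = (\<Sum>m<4. d m 0 / fact m * t ^ m) + d 4 s / fact 4 * t ^ 4"
      by blast
    have "d 4 s \<le> \<bar>d 4 s\<bar>" by simp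
    also have "\<dots> \<le> K"
      unfolding d_def K_def abs_mult
      using powr_poly_bound[of "1 + s" 2 "q - 4" N] s t N by (intro mult_left_mono) auto
    finally have "d 4 s / 24 * t ^ 4 \<le> K / 24 * t ^ 4" by (intro mult_right_mono) auto
    moreover have "d 0 t = (1 + t) powr q" by (simp add: d_def)
    moreover have "(\<Sum>m<4. d m 0 / fact m * t ^ m) = 1 + q * t + q * (q - 1) / 2 * t\<^sup>2 + q * (q - 1) * (q - 2) / 6 * t ^ 3"
      by (simp add: d_def eval_nat_numeral)
    moreover have "fact 4 = (24::real)" by (simp add: eval_nat_numeral)
    ultimately show ?thesis using eq by simp
  qed
  have K0: "0 \<le> K" by (simp add: K_def)
  show thesis
  proof (rule that[of "K / 24 + 16 * 2 powr q"])
    show "0 \<le> K / 24 + 16 * 2 powr q" using K0 by simp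
    fix t :: real assume t: "\<bar>t\<bar> \<le> 1"
    show "((1 + t) powr q + (1 - t) powr q) / 2 \<le> 1 + q * (q - 1) / 2 * t\<^sup>2 + (K / 24 + 16 * 2 powr q) * t ^ 4"
    proof (cases "\<bar>t\<bar> \<le> 1/2")
      case True
      have "(1 - t) powr q \<le> 1 - q * t + q * (q - 1) / 2 * t\<^sup>2 - q * (q - 1) * (q - 2) / 6 * t ^ 3 + K / 24 * t ^ 4"
        using taylor[of "- t"] True by simp
      moreover have "(K / 24 + 16 * 2 powr q) * t ^ 4 = K / 24 * t ^ 4 + 16 * 2 powr q * t ^ 4"
        by (rule distrib_right)
      moreover have "0 \<le> 16 * 2 powr q * t ^ 4" by simp
      moreover have "(A + B) / 2 \<le> 1 + Y + R"
        if "B \<le> 1 - X + Y - Z + U" "R = U + S" "0 \<le> S" "A \<le> 1 + X + Y + Z + U" for A B X Y Z U S R :: real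
        using that by simp
      ultimately show ?thesis using taylor[OF True] by blast
    next
      case False
      have "(1 + t) powr q \<le> 2 powr q" "(1 - t) powr q \<le> 2 powr q"
        using t q by (auto intro!: powr_mono2)
      moreover have "(1/2) ^ 4 \<le> \<bar>t\<bar> ^ 4" using False by (intro power_mono) auto
      then have "2 powr q * 1 \<le> 2 powr q * (16 * t ^ 4)" by (intro mult_left_mono) (auto simp: power4_eq_xxxx)
      moreover have "0 \<le> q * (q - 1) / 2 * t\<^sup>2" "0 \<le> K / 24 * t ^ 4" using q K0 by auto
      moreover have "(K / 24 + 16 * 2 powr q) * t ^ 4 = K / 24 * t ^ 4 + 2 powr q * (16 * t ^ 4)"
        by (simp add: distrib_right)
      moreover have "(A + B) / 2 \<le> 1 + Y + R"
        if "A \<le> P" "B \<le> P" "P * 1 \<le> P'" "0 \<le> Y" "0 \<le> U" "R = U + P'" for A B P P' Y U R :: real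
        using that by simp
      ultimately show ?thesis by blast
    qed
  qed
qed

text \<open>
  In the application \<open>y\<close> is close to 1 and \<open>\<tau>\<close> is the martingale part of the step, so that \<open>y - 1\<close> and
  \<open>\<tau>\<^sup>2\<close> are of the same order and the remainder is quadratic in that order.
\<close>

lemma symmetric_powr_perturbation:
  fixes q :: real
  assumes q: "1 \<le> q"
  obtains C N where "0 \<le> C" "\<And>y \<tau> a. 1/2 \<le> y \<Longrightarrow> y \<le> a \<Longrightarrow> 1 \<le> a \<Longrightarrow> \<bar>\<tau>\<bar> \<le> y \<Longrightarrow>
    ((y + \<tau>) powr q + (y - \<tau>) powr q) / 2
      \<le> 1 + q * (y - 1) + q * (q - 1) / 2 * \<tau>\<^sup>2 + C * (2 * a) ^ N * ((y - 1)\<^sup>2 + \<bar>y - 1\<bar> * \<tau>\<^sup>2 + \<tau> ^ 4)"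
proof -
  obtain K where K0: "0 \<le> K" and K: "\<And>t. \<bar>t\<bar> \<le> 1 \<Longrightarrow>
    ((1 + t) powr q + (1 - t) powr q) / 2 \<le> 1 + q * (q - 1) / 2 * t\<^sup>2 + K * t ^ 4"
    using symmetric_powr_expansion[OF q] by metis
  obtain N where N: "\<bar>q\<bar> + 4 \<le> real N" using real_arch_simple by blast
  define C where "C = q * (q - 1) + q * (q - 1) / 2 * \<bar>q - 2\<bar> + K"
  have q1: "0 \<le> q * (q - 1)" using q by simp
  show thesis
  proof (rule that[of C N])
    show "0 \<le> C" using q K0 by (simp add: C_def)
    fix y \<tau> a :: real
    assume y: "1/2 \<le> y" "y \<le> a" and a: "1 \<le> a" and \<tau>: "\<bar>\<tau>\<bar> \<le> y"
    define P where "P = (2 * a) ^ N"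
    have P: "0 \<le> P" using a by (simp add: P_def)
    define t where "t = \<tau> / y"
    have t: "\<bar>t\<bar> \<le> 1" "\<tau> = y * t" using y \<tau> by (auto simp: t_def abs_divide)
    have t1: "0 \<le> 1 + t" "0 \<le> 1 - t" using t by auto
    have "(y + \<tau>) powr q = y powr q * (1 + t) powr q" "(y - \<tau>) powr q = y powr q * (1 - t) powr q"
      by (simp_all add: t(2) powr_mult[symmetric] algebra_simps)
    then have "((y + \<tau>) powr q + (y - \<tau>) powr q) / 2 = y powr q * (((1 + t) powr q + (1 - t) powr q) / 2)"
      by (simp add: algebra_simps add_divide_distrib)
    also have "\<dots> \<le> y powr q * (1 + q * (q - 1) / 2 * t\<^sup>2 + K * t ^ 4)"
      by (intro mult_left_mono K t) auto
    also have "\<dots> = y powr q + q * (q - 1) / 2 * (y powr (q - 2) * \<tau>\<^sup>2) + K * (y powr (q - 4) * \<tau> ^ 4)"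
    proof -
      have "y powr q * t\<^sup>2 = y powr (q - 2) * \<tau>\<^sup>2" "y powr q * t ^ 4 = y powr (q - 4) * \<tau> ^ 4"
        using y by (simp_all add: t_def powr_diff power_divide powr_numeral)
      then show ?thesis by (simp add: algebra_simps)
    qed
    finally have main: "((y + \<tau>) powr q + (y - \<tau>) powr q) / 2
      \<le> y powr q + q * (q - 1) / 2 * (y powr (q - 2) * \<tau>\<^sup>2) + K * (y powr (q - 4) * \<tau> ^ 4)" .
    \<comment> \<open>Using the tangent at \<open>y\<close> instead of the one at 1, the second-order term becomes a first-order difference.\<close>
    have "y powr q + q * y powr (q - 1) * (1 - y) \<le> 1 powr q"
      using y q by (intro powr_convex_tangent) auto
    then have "y powr q \<le> 1 + q * (y - 1) + q * ((y powr (q - 1) - 1) * (y - 1))"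
      by (simp add: algebra_simps)
    also have "(y powr (q - 1) - 1) * (y - 1) \<le> \<bar>y powr (q - 1) - 1\<bar> * \<bar>y - 1\<bar>"
      by (metis abs_ge_self abs_mult)
    also have "\<dots> \<le> (\<bar>q - 1\<bar> * P * \<bar>y - 1\<bar>) * \<bar>y - 1\<bar>"
      unfolding P_def using q N by (intro mult_right_mono powr_lipschitz_bound y a) auto
    also have "\<dots> = (q - 1) * P * (y - 1)\<^sup>2" using q by (simp add: power2_eq_square)
    finally have e1: "y powr q \<le> 1 + q * (y - 1) + q * (q - 1) * P * (y - 1)\<^sup>2"
      using q by (simp add: mult.assoc)
    have "\<bar>y powr (q - 2) - 1\<bar> \<le> \<bar>q - 2\<bar> * P * \<bar>y - 1\<bar>"
      unfolding P_def using q N by (intro powr_lipschitz_bound y a) auto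
    then have "y powr (q - 2) \<le> 1 + \<bar>q - 2\<bar> * P * \<bar>y - 1\<bar>" by linarith
    then have "q * (q - 1) / 2 * (y powr (q - 2) * \<tau>\<^sup>2) \<le> q * (q - 1) / 2 * ((1 + \<bar>q - 2\<bar> * P * \<bar>y - 1\<bar>) * \<tau>\<^sup>2)"
      using q1 by (intro mult_left_mono mult_right_mono) auto
    then have e2: "q * (q - 1) / 2 * (y powr (q - 2) * \<tau>\<^sup>2) \<le> q * (q - 1) / 2 * \<tau>\<^sup>2 + (q * (q - 1) / 2 * \<bar>q - 2\<bar>) * P * (\<bar>y - 1\<bar> * \<tau>\<^sup>2)"
      by (simp add: algebra_simps)
    have "y powr (q - 4) \<le> P"
      unfolding P_def using q N by (intro powr_poly_bound y a) auto
    then have e3: "K * (y powr (q - 4) * \<tau> ^ 4) \<le> K * P * \<tau> ^ 4"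
      using K0 by (simp add: mult.assoc mult_left_mono mult_right_mono)
    let ?a1 = "P * (y - 1)\<^sup>2" and ?a2 = "P * (\<bar>y - 1\<bar> * \<tau>\<^sup>2)" and ?a3 = "P * \<tau> ^ 4"
    have nn: "0 \<le> ?a1" "0 \<le> ?a2" "0 \<le> ?a3" using P by auto
    have c: "q * (q - 1) \<le> C" "q * (q - 1) / 2 * \<bar>q - 2\<bar> \<le> C" "K \<le> C"
      using q1 K0 by (auto simp: C_def)
    have "q * (q - 1) * ?a1 + (q * (q - 1) / 2 * \<bar>q - 2\<bar>) * ?a2 + K * ?a3 \<le> C * ?a1 + C * ?a2 + C * ?a3"
      by (intro add_mono mult_right_mono c nn)
    then have "y powr q + q * (q - 1) / 2 * (y powr (q - 2) * \<tau>\<^sup>2) + K * (y powr (q - 4) * \<tau> ^ 4)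
       \<le> 1 + q * (y - 1) + q * (q - 1) / 2 * \<tau>\<^sup>2 + (C * ?a1 + C * ?a2 + C * ?a3)"
      using e1 e2 e3 by (simp only: mult.assoc)
    also have "C * ?a1 + C * ?a2 + C * ?a3 = C * P * ((y - 1)\<^sup>2 + \<bar>y - 1\<bar> * \<tau>\<^sup>2 + \<tau> ^ 4)"
      by (simp add: algebra_simps)
    finally show "((y + \<tau>) powr q + (y - \<tau>) powr q) / 2
      \<le> 1 + q * (y - 1) + q * (q - 1) / 2 * \<tau>\<^sup>2 + C * (2 * a) ^ N * ((y - 1)\<^sup>2 + \<bar>y - 1\<bar> * \<tau>\<^sup>2 + \<tau> ^ 4)"
      using main unfolding P_def by linarith
  qed
qed

lemma norm_matrix_vector_le:
  fixes B :: "real ^ 'm ^ 'd"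
  shows "norm (B *v z) \<le> norm B * norm z"
proof (rule power2_le_imp_le)
  have "(norm (B *v z))\<^sup>2 = (\<Sum>k\<in>UNIV. (B $ k \<bullet> z)\<^sup>2)"
    by (simp add: norm_vec_power2 matrix_vector_mult_def inner_vec_def)
  also have "\<dots> \<le> (\<Sum>k\<in>UNIV. (norm (B $ k))\<^sup>2 * (norm z)\<^sup>2)"
  proof (rule sum_mono)
    fix k
    have "(B $ k \<bullet> z)\<^sup>2 \<le> (norm (B $ k) * norm z)\<^sup>2"
      using Cauchy_Schwarz_ineq2[of "B $ k" z] by (intro abs_le_square_iff[THEN iffD1]) simp
    then show "(B $ k \<bullet> z)\<^sup>2 \<le> (norm (B $ k))\<^sup>2 * (norm z)\<^sup>2" by (simp add: power_mult_distrib)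
  qed
  also have "\<dots> = (norm B * norm z)\<^sup>2"
    by (simp add: norm_vec_power2[of B] power_mult_distrib sum_distrib_right)
  finally show "(norm (B *v z))\<^sup>2 \<le> (norm B * norm z)\<^sup>2" .
qed simp

lemma affine_growth:
  fixes B :: "real ^ 'm ^ 'd"
  shows "1 + (norm (b + B *v z))\<^sup>2 \<le> (1 + 2 * (norm b)\<^sup>2 + 2 * (norm B)\<^sup>2) * (1 + (norm z)\<^sup>2)"
proof -
  have "(norm (b + B *v z))\<^sup>2 \<le> (norm b + norm B * norm z)\<^sup>2"
    using norm_triangle_ineq[of b "B *v z"] norm_matrix_vector_le[of B z] by (intro power_mono) auto
  also have "\<dots> \<le> 2 * (norm b)\<^sup>2 + 2 * (norm B * norm z)\<^sup>2"
    using sum_squares_bound[of "norm b" "norm B * norm z"] by (simp add: power2_sum)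
  finally have *: "1 + (norm (b + B *v z))\<^sup>2 \<le> 1 + 2 * (norm b)\<^sup>2 + 2 * ((norm B)\<^sup>2 * (norm z)\<^sup>2)"
    by (simp add: power_mult_distrib)
  have "0 \<le> (norm z)\<^sup>2 + 2 * ((norm b)\<^sup>2 * (norm z)\<^sup>2) + 2 * (norm B)\<^sup>2" by simp
  moreover have "(1 + 2 * (norm b)\<^sup>2 + 2 * (norm B)\<^sup>2) * (1 + (norm z)\<^sup>2)
      = 1 + 2 * (norm b)\<^sup>2 + 2 * ((norm B)\<^sup>2 * (norm z)\<^sup>2)
        + ((norm z)\<^sup>2 + 2 * ((norm b)\<^sup>2 * (norm z)\<^sup>2) + 2 * (norm B)\<^sup>2)"
    by (simp add: algebra_simps)
  ultimately show ?thesis using * by linarith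
qed

lemma affine_powr_bound:
  fixes B :: "real ^ 'm ^ 'd"
  assumes q: "0 \<le> q" "q \<le> real N" and D: "1 + 2 * (norm b)\<^sup>2 + 2 * (norm B)\<^sup>2 \<le> D"
  shows "(1 + (norm (b + B *v z))\<^sup>2) powr q \<le> D ^ N * (1 + (norm z)\<^sup>2) ^ N"
proof -
  let ?\<zeta> = "1 + (norm z)\<^sup>2"
  have D1: "1 \<le> D" using D by (rule order_trans[rotated]) simp
  have "1 * 1 \<le> D * ?\<zeta>" using D1 by (intro mult_mono) auto
  then have D\<zeta>: "1 \<le> D * ?\<zeta>" by simp
  have "1 + (norm (b + B *v z))\<^sup>2 \<le> D * ?\<zeta>"
    using affine_growth[of b B z] mult_right_mono[OF D, of ?\<zeta>] by simp
  then have "(1 + (norm (b + B *v z))\<^sup>2) powr q \<le> (D * ?\<zeta>) powr q"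
    using q by (intro powr_mono2) (auto simp: add_nonneg_nonneg)
  also have "\<dots> \<le> (D * ?\<zeta>) powr real N" using q D\<zeta> by (intro powr_mono) auto
  also have "\<dots> = D ^ N * ?\<zeta> ^ N" using D\<zeta> by (subst powr_realpow) (auto simp: power_mult_distrib)
  finally show ?thesis .
qed

lemma integrable_affine_powr:
  fixes B :: "real ^ 'm ^ 'd"
  assumes q: "0 \<le> q"
  shows "integrable std_gauss (\<lambda>z. (1 + (norm (b + B *v z))\<^sup>2) powr q)"
proof -
  obtain N where N: "q \<le> real N" using real_arch_simple by blast
  show ?thesis
  proof (rule integrable_std_gauss_bound)
    show "\<bar>(1 + (norm (b + B *v z))\<^sup>2) powr q\<bar> \<le> (1 + 2 * (norm b)\<^sup>2 + 2 * (norm B)\<^sup>2) ^ N * (1 + (norm z)\<^sup>2) ^ N" for z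
      using affine_powr_bound[OF q N order_refl, of b B z] by simp
  qed measurable
qed

text \<open>
  Averaging over \<open>z\<close> and \<open>-z\<close> turns the integrand into the left-hand side of
  \<open>symmetric_powr_perturbation\<close>, with \<open>y - 1\<close> and \<open>\<tau>\<^sup>2\<close> of order \<open>e\<^sup>2\<close> and hence a remainder of order \<open>e\<^sup>4\<close>.
  Here \<open>e\<close> is the cube root of the time step, which makes the growth bounds on \<open>fx\<close> and \<open>G\<close>
  polynomial in \<open>e\<close>.
\<close>

lemma em_moment_expansion:
  fixes q :: real
  assumes q: "1 \<le> q"
  obtains C where "0 \<le> C" "\<And>(x :: real ^ 'd) fx (G :: real ^ 'm ^ 'd) e. 0 < e \<Longrightarrow> 12 * e\<^sup>2 \<le> 1 \<Longrightarrow>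
    norm fx * e ^ 3 \<le> e\<^sup>2 * (1 + norm x) \<Longrightarrow> (norm G)\<^sup>2 * e ^ 3 \<le> e\<^sup>2 * (1 + norm x)\<^sup>2 \<Longrightarrow>
    (\<integral>z. (1 + (norm (x + e ^ 3 *\<^sub>R fx + G *v (sqrt (e ^ 3) *\<^sub>R z)))\<^sup>2) powr q \<partial>std_gauss)
      \<le> (1 + (norm x)\<^sup>2) powr q *
        (1 + 2 * q * e ^ 3 / (1 + (norm x)\<^sup>2) * (x \<bullet> fx + (q - 1/2) * (norm G)\<^sup>2) + C * e ^ 4)"
proof -
  obtain K N where K0: "0 \<le> K" and K: "\<And>y \<tau> a. 1/2 \<le> y \<Longrightarrow> y \<le> a \<Longrightarrow> 1 \<le> a \<Longrightarrow> \<bar>\<tau>\<bar> \<le> y \<Longrightarrow>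
    ((y + \<tau>) powr q + (y - \<tau>) powr q) / 2
      \<le> 1 + q * (y - 1) + q * (q - 1) / 2 * \<tau>\<^sup>2 + K * (2 * a) ^ N * ((y - 1)\<^sup>2 + \<bar>y - 1\<bar> * \<tau>\<^sup>2 + \<tau> ^ 4)"
    using symmetric_powr_perturbation[OF q] by metis
  define m where "m = (\<integral>z. (1 + (norm z)\<^sup>2) ^ (N + 2) \<partial>(std_gauss :: (real ^ 'm) measure))"
  define K' where "K' = 24 * (q * (q - 1)) + K * 14 ^ N * 3648"
  have q1: "0 \<le> q * (q - 1)" using q by simp
  have K'0: "0 \<le> K'" using q1 K0 by (simp add: K'_def)
  have m0: "0 \<le> m" unfolding m_def by (rule integral_nonneg_AE) simp
  show thesis
  proof (rule that[of "2 * q + K' * m"])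
    show "0 \<le> 2 * q + K' * m" using q K'0 m0 by simp
    fix x fx :: "real ^ 'd" and G :: "real ^ 'm ^ 'd" and e :: real
    assume e: "0 < e" "12 * e\<^sup>2 \<le> 1" and F: "norm fx * e ^ 3 \<le> e\<^sup>2 * (1 + norm x)"
      and G: "(norm G)\<^sup>2 * e ^ 3 \<le> e\<^sup>2 * (1 + norm x)\<^sup>2"
    define w where "w = 1 + (norm x)\<^sup>2"
    define b where "b = x + e ^ 3 *\<^sub>R fx"
    define Z where "Z z = G *v (sqrt (e ^ 3) *\<^sub>R z)" for z
    define \<alpha> where "\<alpha> = (2 * (x \<bullet> (e ^ 3 *\<^sub>R fx)) + (norm (e ^ 3 *\<^sub>R fx))\<^sup>2) / w"
    define \<beta> where "\<beta> z = (norm (Z z))\<^sup>2 / w" for z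
    define \<tau> where "\<tau> z = 2 * (b \<bullet> Z z) / w" for z
    have w: "1 \<le> w" by (simp add: w_def)
    have nx: "(1 + norm x)\<^sup>2 \<le> 2 * w" "norm x * (1 + norm x) \<le> 2 * w"
    proof -
      have "0 \<le> (1 - norm x)\<^sup>2" by simp
      then show "(1 + norm x)\<^sup>2 \<le> 2 * w" "norm x * (1 + norm x) \<le> 2 * w"
        by (auto simp: w_def power2_eq_square algebra_simps) (smt (verit) zero_le_square)+
    qed
    have e1: "e\<^sup>2 \<le> 1" using e by simp
    have e4: "e ^ 4 \<le> e\<^sup>2" using mult_left_mono[OF e1, of "e\<^sup>2"] by (simp add: power2_eq_square power4_eq_xxxx mult.assoc)
    have nf: "norm (e ^ 3 *\<^sub>R fx) \<le> e\<^sup>2 * (1 + norm x)" using F e by (simp add: mult.commute)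
    have nf2: "(norm (e ^ 3 *\<^sub>R fx))\<^sup>2 \<le> 2 * e ^ 4 * w"
    proof -
      have "(norm (e ^ 3 *\<^sub>R fx))\<^sup>2 \<le> (e\<^sup>2 * (1 + norm x))\<^sup>2" using nf by (intro power_mono) auto
      also have "\<dots> = e ^ 4 * (1 + norm x)\<^sup>2" by (simp add: power_mult_distrib power_mult[symmetric])
      also have "\<dots> \<le> e ^ 4 * (2 * w)" by (intro mult_left_mono nx) auto
      finally show ?thesis by simp
    qed
    have \<alpha>: "\<bar>\<alpha>\<bar> \<le> 6 * e\<^sup>2"
    proof -
      have "\<bar>x \<bullet> (e ^ 3 *\<^sub>R fx)\<bar> \<le> norm x * norm (e ^ 3 *\<^sub>R fx)" by (rule Cauchy_Schwarz_ineq2)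
      also have "\<dots> \<le> norm x * (e\<^sup>2 * (1 + norm x))" by (intro mult_left_mono nf) auto
      also have "\<dots> = e\<^sup>2 * (norm x * (1 + norm x))" by simp
      also have "\<dots> \<le> e\<^sup>2 * (2 * w)" by (intro mult_left_mono nx) auto
      finally have "\<bar>2 * (x \<bullet> (e ^ 3 *\<^sub>R fx)) + (norm (e ^ 3 *\<^sub>R fx))\<^sup>2\<bar> \<le> 4 * e\<^sup>2 * w + 2 * e ^ 4 * w"
        using nf2 zero_le_power2[of "norm (e ^ 3 *\<^sub>R fx)"] by linarith
      also have "\<dots> \<le> 6 * e\<^sup>2 * w" using mult_right_mono[OF e4, of w] w by simp
      finally show ?thesis using w by (simp add: \<alpha>_def abs_divide pos_divide_le_eq)
    qed
    have b2: "1 + (norm b)\<^sup>2 = w * (1 + \<alpha>)"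
    proof -
      have "w * (1 + \<alpha>) = w + (2 * (x \<bullet> (e ^ 3 *\<^sub>R fx)) + (norm (e ^ 3 *\<^sub>R fx))\<^sup>2)"
      proof -
        have "w * (1 + n / w) = w + n" for n using w by (simp add: field_simps)
        then show ?thesis unfolding \<alpha>_def .
      qed
      then show ?thesis
        unfolding b_def w_def power2_norm_eq_inner
        by (simp add: inner_add_left inner_add_right inner_commute)
    qed
    have \<beta>0: "0 \<le> \<beta> z" for z using w by (simp add: \<beta>_def)
    have \<beta>: "\<beta> z \<le> 2 * e\<^sup>2 * (1 + (norm z)\<^sup>2)" for z
    proof -
      have "(norm (Z z))\<^sup>2 \<le> (norm G * norm (sqrt (e ^ 3) *\<^sub>R z))\<^sup>2"
        unfolding Z_def by (intro power_mono norm_matrix_vector_le) auto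
      also have "\<dots> = ((norm G)\<^sup>2 * e ^ 3) * (norm z)\<^sup>2" using e by (simp add: power_mult_distrib)
      also have "\<dots> \<le> (e\<^sup>2 * (2 * w)) * (1 + (norm z)\<^sup>2)"
      proof (rule mult_mono)
        show "(norm G)\<^sup>2 * e ^ 3 \<le> e\<^sup>2 * (2 * w)"
          by (rule order_trans[OF G]) (intro mult_left_mono nx, simp)
      qed (use w in auto)
      finally show ?thesis using w by (simp add: \<beta>_def pos_divide_le_eq mult_ac)
    qed
    have \<tau>2: "(\<tau> z)\<^sup>2 \<le> 4 * (1 + 6 * e\<^sup>2) * \<beta> z" for z
    proof -
      have "(b \<bullet> Z z)\<^sup>2 \<le> (norm b)\<^sup>2 * (norm (Z z))\<^sup>2"
        by (metis Cauchy_Schwarz_ineq power2_norm_eq_inner)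
      also have "\<dots> \<le> (w * (1 + 6 * e\<^sup>2)) * (norm (Z z))\<^sup>2"
      proof (rule mult_right_mono)
        have "w * (1 + \<alpha>) \<le> w * (1 + 6 * e\<^sup>2)" using \<alpha> w by (intro mult_left_mono) auto
        then show "(norm b)\<^sup>2 \<le> w * (1 + 6 * e\<^sup>2)" using b2 by linarith
      qed simp
      finally have "(b \<bullet> Z z)\<^sup>2 / w\<^sup>2 \<le> (w * (1 + 6 * e\<^sup>2)) * (norm (Z z))\<^sup>2 / w\<^sup>2" by (rule divide_right_mono) simp
      also have "\<dots> = (1 + 6 * e\<^sup>2) * \<beta> z" using w by (simp add: \<beta>_def power2_eq_square)
      finally have "4 * ((b \<bullet> Z z)\<^sup>2 / w\<^sup>2) \<le> 4 * ((1 + 6 * e\<^sup>2) * \<beta> z)" by (rule mult_left_mono) simp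
      moreover have "(\<tau> z)\<^sup>2 = 4 * ((b \<bullet> Z z)\<^sup>2 / w\<^sup>2)"
        by (simp add: \<tau>_def power_divide power_mult_distrib)
      ultimately show ?thesis by (simp only: mult.assoc)
    qed
    let ?y = "\<lambda>z. 1 + \<alpha> + \<beta> z"
    have dec: "1 + (norm (b + Z z))\<^sup>2 = w * (?y z + \<tau> z)" "1 + (norm (b - Z z))\<^sup>2 = w * (?y z - \<tau> z)" for z
    proof -
      have "w * (?y z + \<tau> z) = w * (1 + \<alpha>) + w * \<beta> z + w * \<tau> z" "w * (?y z - \<tau> z) = w * (1 + \<alpha>) + w * \<beta> z - w * \<tau> z"
        by (simp_all add: algebra_simps)
      moreover have "w * \<beta> z = (norm (Z z))\<^sup>2" "w * \<tau> z = 2 * (b \<bullet> Z z)" using w by (simp_all add: \<beta>_def \<tau>_def)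
      ultimately show "1 + (norm (b + Z z))\<^sup>2 = w * (?y z + \<tau> z)" "1 + (norm (b - Z z))\<^sup>2 = w * (?y z - \<tau> z)"
        unfolding b2[symmetric]
        by (simp_all add: power2_norm_eq_inner inner_add_left inner_add_right inner_diff_left inner_diff_right inner_commute)
    qed
    let ?V = "\<lambda>v. (1 + (norm v)\<^sup>2) powr q"
    have pt: "(?V (b + Z z) + ?V (b + Z (- z))) / 2
        \<le> w powr q * (1 + q * \<alpha> + (q + 2 * q * (q - 1)) * \<beta> z + K' * e ^ 4 * (1 + (norm z)\<^sup>2) ^ (N + 2))" for z
    proof -
      define \<zeta> where "\<zeta> = 1 + (norm z)\<^sup>2"
      have \<zeta>: "1 \<le> \<zeta>" by (simp add: \<zeta>_def)
      have "Z (- z) = - Z z" by (simp add: Z_def matrix_vector_mult_def vec_eq_iff sum_negf)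
      then have "b + Z (- z) = b - Z z" by simp
      then have "(?V (b + Z z) + ?V (b + Z (- z))) / 2 = (w powr q * (?y z + \<tau> z) powr q + w powr q * (?y z - \<tau> z) powr q) / 2"
        by (simp only: dec powr_mult)
      also have "\<dots> = w powr q * (((?y z + \<tau> z) powr q + (?y z - \<tau> z) powr q) / 2)"
        by (simp only: distrib_left[symmetric] times_divide_eq_right)
      also have "\<dots> \<le> w powr q * (1 + q * (?y z - 1) + q * (q - 1) / 2 * (\<tau> z)\<^sup>2
          + K * (2 * (7 * \<zeta>)) ^ N * ((?y z - 1)\<^sup>2 + \<bar>?y z - 1\<bar> * (\<tau> z)\<^sup>2 + (\<tau> z) ^ 4))"
      proof (intro mult_left_mono K)
        show "1/2 \<le> ?y z" using \<alpha> \<beta>0[of z] e by (simp add: abs_le_iff)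
        have "(12 * e\<^sup>2) * \<zeta> \<le> 1 * \<zeta>" using e(2) \<zeta> by (intro mult_right_mono) auto
        then have "6 * e\<^sup>2 + 2 * e\<^sup>2 * \<zeta> \<le> 1/2 + 1/6 * \<zeta>" using e(2) by linarith
        then show "?y z \<le> 7 * \<zeta>" using \<alpha> \<beta>[of z] \<zeta> by (simp add: \<zeta>_def[symmetric] abs_le_iff) 
        show "1 \<le> 7 * \<zeta>" using \<zeta> by simp
        have "0 \<le> w * (?y z + \<tau> z)" "0 \<le> w * (?y z - \<tau> z)" unfolding dec[symmetric] by auto
        then show "\<bar>\<tau> z\<bar> \<le> ?y z" using w by (simp add: zero_le_mult_iff abs_le_iff)
      qed simp
      also have "\<dots> \<le> w powr q * (1 + q * \<alpha> + (q + 2 * q * (q - 1)) * \<beta> z + K' * e ^ 4 * \<zeta> ^ (N + 2))"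
      proof (rule mult_left_mono)
        have bz: "\<beta> z \<le> 2 * e\<^sup>2 * \<zeta>" using \<beta>[of z] by (simp add: \<zeta>_def)
        have e2: "0 \<le> e\<^sup>2" by simp
        have e2z: "e\<^sup>2 \<le> e\<^sup>2 * \<zeta>" using mult_left_mono[OF \<zeta> e2] by simp
        have yb: "\<bar>?y z - 1\<bar> \<le> 8 * e\<^sup>2 * \<zeta>"
          using \<alpha> bz \<beta>0[of z] e2z by (simp add: abs_le_iff)
        have "4 * (1 + 6 * e\<^sup>2) * \<beta> z \<le> 28 * (2 * e\<^sup>2 * \<zeta>)"
          using e1 \<beta>0[of z] by (intro mult_mono bz) auto
        then have tb: "(\<tau> z)\<^sup>2 \<le> 56 * (e\<^sup>2 * \<zeta>)" using \<tau>2[of z] by simp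
        have "\<beta> z * e\<^sup>2 \<le> (2 * e\<^sup>2 * \<zeta>) * e\<^sup>2" by (intro mult_right_mono bz) auto
        also have "\<dots> = 2 * (e ^ 4 * \<zeta>)" by (simp add: power4_eq_xxxx power2_eq_square)
        also have "\<dots> \<le> 2 * (e ^ 4 * \<zeta> ^ (N + 2))"
          using self_le_power[OF \<zeta>, of "N + 2"] by (intro mult_left_mono) auto
        finally have be: "\<beta> z * e\<^sup>2 \<le> 2 * (e ^ 4 * \<zeta> ^ (N + 2))" .
        have "q * (q - 1) / 2 * (\<tau> z)\<^sup>2 \<le> q * (q - 1) / 2 * (4 * (1 + 6 * e\<^sup>2) * \<beta> z)"
          using q1 by (intro mult_left_mono \<tau>2) auto
        also have "\<dots> = 2 * q * (q - 1) * \<beta> z + 12 * (q * (q - 1)) * (\<beta> z * e\<^sup>2)"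
        proof -
          have "a / 2 * (4 * (1 + 6 * c) * b) = 2 * a * b + 12 * a * (b * c)" for a b c :: real
            by (simp add: algebra_simps)
          then show ?thesis by (metis mult.assoc)
        qed
        also have "12 * (q * (q - 1)) * (\<beta> z * e\<^sup>2) \<le> 12 * (q * (q - 1)) * (2 * (e ^ 4 * \<zeta> ^ (N + 2)))"
          using q1 by (intro mult_left_mono be) auto
        finally have A: "q * (q - 1) / 2 * (\<tau> z)\<^sup>2 \<le> 2 * q * (q - 1) * \<beta> z + 24 * (q * (q - 1)) * (e ^ 4 * \<zeta> ^ (N + 2))"
          by simp
        have "(?y z - 1)\<^sup>2 \<le> (8 * e\<^sup>2 * \<zeta>)\<^sup>2" using yb e \<zeta> by (intro abs_le_square_iff[THEN iffD1]) auto
        moreover have "\<bar>?y z - 1\<bar> * (\<tau> z)\<^sup>2 \<le> (8 * e\<^sup>2 * \<zeta>) * (56 * (e\<^sup>2 * \<zeta>))" using yb tb \<zeta> by (intro mult_mono) auto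
        moreover have "((\<tau> z)\<^sup>2)\<^sup>2 \<le> (56 * (e\<^sup>2 * \<zeta>))\<^sup>2" using tb by (intro power_mono) auto
        moreover have "((\<tau> z)\<^sup>2)\<^sup>2 = (\<tau> z) ^ 4" by simp
        ultimately have "(?y z - 1)\<^sup>2 + \<bar>?y z - 1\<bar> * (\<tau> z)\<^sup>2 + (\<tau> z) ^ 4 \<le> (8 * e\<^sup>2 * \<zeta>)\<^sup>2 + (8 * e\<^sup>2 * \<zeta>) * (56 * (e\<^sup>2 * \<zeta>)) + (56 * (e\<^sup>2 * \<zeta>))\<^sup>2"
          by linarith
        also have "\<dots> = 3648 * (e ^ 4 * \<zeta>\<^sup>2)" by (simp add: power2_eq_square power4_eq_xxxx)
        finally have "K * (2 * (7 * \<zeta>)) ^ N * ((?y z - 1)\<^sup>2 + \<bar>?y z - 1\<bar> * (\<tau> z)\<^sup>2 + (\<tau> z) ^ 4)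
            \<le> K * (2 * (7 * \<zeta>)) ^ N * (3648 * (e ^ 4 * \<zeta>\<^sup>2))"
          using K0 \<zeta> by (intro mult_left_mono) auto
        also have "\<dots> = K * 14 ^ N * 3648 * (e ^ 4 * \<zeta> ^ (N + 2))"
          by (simp add: power_mult_distrib power_add power2_eq_square)
        finally have B: "K * (2 * (7 * \<zeta>)) ^ N * ((?y z - 1)\<^sup>2 + \<bar>?y z - 1\<bar> * (\<tau> z)\<^sup>2 + (\<tau> z) ^ 4)
            \<le> K * 14 ^ N * 3648 * (e ^ 4 * \<zeta> ^ (N + 2))" .
        have "K' * e ^ 4 * \<zeta> ^ (N + 2) = 24 * (q * (q - 1)) * (e ^ 4 * \<zeta> ^ (N + 2)) + K * 14 ^ N * 3648 * (e ^ 4 * \<zeta> ^ (N + 2))"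
          by (simp only: K'_def distrib_right mult.assoc)
        moreover have "q * (?y z - 1) = q * \<alpha> + q * \<beta> z" "(q + 2 * q * (q - 1)) * \<beta> z = q * \<beta> z + 2 * q * (q - 1) * \<beta> z"
          by (simp_all only: distrib_right) (simp add: algebra_simps)
        ultimately show "1 + q * (?y z - 1) + q * (q - 1) / 2 * (\<tau> z)\<^sup>2
          + K * (2 * (7 * \<zeta>)) ^ N * ((?y z - 1)\<^sup>2 + \<bar>?y z - 1\<bar> * (\<tau> z)\<^sup>2 + (\<tau> z) ^ 4)
          \<le> 1 + q * \<alpha> + (q + 2 * q * (q - 1)) * \<beta> z + K' * e ^ 4 * \<zeta> ^ (N + 2)"
          using A B by linarith
      qed simp
      finally show ?thesis by (simp only: \<zeta>_def)
    qed
    have Zeq: "Z z = (sqrt (e ^ 3) *\<^sub>R G) *v z" for z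
      by (simp add: Z_def matrix_vector_mult_scaleR scaleR_matrix_vector_assoc)
    have int1: "integrable std_gauss (\<lambda>z. ?V (b + Z z))"
      unfolding Zeq using q by (intro integrable_affine_powr) simp
    have m1: "(\<lambda>z. ?V (b + Z z)) \<in> borel_measurable borel" unfolding Zeq by measurable
    have int2: "integrable std_gauss (\<lambda>z. ?V (b + Z (- z)))"
    proof -
      have "(\<lambda>z. ?V (b + Z (- z))) = (\<lambda>z. ?V (b + (- (sqrt (e ^ 3) *\<^sub>R G)) *v z))"
        by (simp add: Zeq matrix_vector_mult_def sum_negf vec_eq_iff fun_eq_iff)
      then show ?thesis using q by (simp add: integrable_affine_powr)
    qed
    have \<beta>i: "integrable std_gauss \<beta>" "(\<integral>z. \<beta> z \<partial>std_gauss) = e ^ 3 * (norm G)\<^sup>2 / w"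
    proof -
      have "\<beta> = (\<lambda>z. (norm ((sqrt (e ^ 3) *\<^sub>R G) *v z))\<^sup>2 / w)" by (simp add: \<beta>_def Zeq fun_eq_iff)
      moreover have "(norm (sqrt (e ^ 3) *\<^sub>R G))\<^sup>2 = e ^ 3 * (norm G)\<^sup>2" using e by (simp add: power_mult_distrib)
      ultimately show "integrable std_gauss \<beta>" "(\<integral>z. \<beta> z \<partial>std_gauss) = e ^ 3 * (norm G)\<^sup>2 / w"
        using integral_std_gauss_quadratic[of "sqrt (e ^ 3) *\<^sub>R G"] by simp_all
    qed
    have pi: "integrable std_gauss (\<lambda>z::real ^ 'm. (1 + (norm z)\<^sup>2) ^ (N + 2))" by (rule integrable_std_gauss_poly)
    have prob_UNIV: "measure (std_gauss :: (real ^ 'm) measure) UNIV = 1"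
      by (metis prob_space.prob_space prob_space_std_gauss space_std_gauss)
    have "(\<integral>z. ?V (b + Z z) \<partial>std_gauss) = (\<integral>z. (?V (b + Z z) + ?V (b + Z (- z))) / 2 \<partial>std_gauss)"
      using int1 int2 integral_std_gauss_uminus[OF m1] by simp
    also have "\<dots> \<le> (\<integral>z. w powr q * (1 + q * \<alpha> + (q + 2 * q * (q - 1)) * \<beta> z + K' * e ^ 4 * (1 + (norm z)\<^sup>2) ^ (N + 2)) \<partial>std_gauss)"
      using int1 int2 \<beta>i pi by (intro integral_mono pt) auto
    also have "\<dots> = w powr q * (1 + q * \<alpha> + (q + 2 * q * (q - 1)) * (e ^ 3 * (norm G)\<^sup>2 / w) + K' * e ^ 4 * m)"
      using \<beta>i pi prob_UNIV by (simp add: m_def)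
    also have "\<dots> \<le> w powr q * (1 + 2 * q * e ^ 3 / w * (x \<bullet> fx + (q - 1/2) * (norm G)\<^sup>2) + (2 * q + K' * m) * e ^ 4)"
    proof (rule mult_left_mono)
      have "(norm (e ^ 3 *\<^sub>R fx))\<^sup>2 / w \<le> 2 * e ^ 4" using nf2 w by (simp add: pos_divide_le_eq)
      then have "q * ((norm (e ^ 3 *\<^sub>R fx))\<^sup>2 / w) \<le> q * (2 * e ^ 4)" using q by (intro mult_left_mono) auto
      moreover have "q * \<alpha> = 2 * q * e ^ 3 / w * (x \<bullet> fx) + q * ((norm (e ^ 3 *\<^sub>R fx))\<^sup>2 / w)"
        by (simp add: \<alpha>_def add_divide_distrib distrib_left)
      moreover have "(q + 2 * q * (q - 1)) * (e ^ 3 * (norm G)\<^sup>2 / w) = 2 * q * e ^ 3 / w * ((q - 1/2) * (norm G)\<^sup>2)"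
      proof -
        have A: "q + 2 * q * (q - 1) = 2 * q * (q - 1/2)" by (simp add: algebra_simps)
        show ?thesis unfolding A by simp
      qed
      moreover have "(2 * q + K' * m) * e ^ 4 = q * (2 * e ^ 4) + K' * e ^ 4 * m"
        by (simp add: algebra_simps)
      moreover have "2 * q * e ^ 3 / w * (x \<bullet> fx + (q - 1/2) * (norm G)\<^sup>2) = 2 * q * e ^ 3 / w * (x \<bullet> fx) + 2 * q * e ^ 3 / w * ((q - 1/2) * (norm G)\<^sup>2)"
        by (rule distrib_left)
      ultimately show "1 + q * \<alpha> + (q + 2 * q * (q - 1)) * (e ^ 3 * (norm G)\<^sup>2 / w) + K' * e ^ 4 * m
         \<le> 1 + 2 * q * e ^ 3 / w * (x \<bullet> fx + (q - 1/2) * (norm G)\<^sup>2) + (2 * q + K' * m) * e ^ 4"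
        by linarith
    qed simp
    finally show "(\<integral>z. (1 + (norm (x + e ^ 3 *\<^sub>R fx + G *v (sqrt (e ^ 3) *\<^sub>R z)))\<^sup>2) powr q \<partial>std_gauss)
      \<le> (1 + (norm x)\<^sup>2) powr q *
        (1 + 2 * q * e ^ 3 / (1 + (norm x)\<^sup>2) * (x \<bullet> fx + (q - 1/2) * (norm G)\<^sup>2) + (2 * q + K' * m) * e ^ 4)"
      by (simp only: b_def Z_def w_def)
  qed
qed

text \<open>
  Far out, the time step is so small that the remainder \<open>C e\<^sup>4 = C e \<delta>(x)\<close> of \<open>em_moment_expansion\<close> is at
  most a quarter of the first-order term \<open>p K6 \<delta>(x)\<close>, and the constant \<open>K7\<close> costs another quarter; on
  the remaining ball everything is bounded.
\<close>

lemma em_drift: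
  fixes f :: "real ^ 'd \<Rightarrow> real ^ 'd" and g :: "real ^ 'd \<Rightarrow> real ^ 'm ^ 'd" and \<delta> :: "real ^ 'd \<Rightarrow> real"
  assumes f_cont: "continuous_on UNIV f" and g_cont: "continuous_on UNIV g" and \<delta>_cont: "continuous_on UNIV \<delta>"
    and p: "2 \<le> p" and K6: "0 < K6" and K7: "0 \<le> K7"
    and dissipative: "\<And>x. x \<bullet> f x + (p - 1) / 2 * (norm (g x))\<^sup>2 \<le> - K6 * (norm x)\<^sup>2 + K7"
    and \<delta>_pos: "\<And>x. 0 < \<delta> x" and \<delta>_lim: "(\<delta> \<longlongrightarrow> 0) at_infinity"
    and \<gamma>: "\<gamma> \<le> 1 / 3"
    and f_\<delta>: "\<And>x. norm (f x) * \<delta> x powr \<gamma> \<le> 1 + norm x"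
    and g_\<delta>: "\<And>x. (norm (g x))\<^sup>2 * \<delta> x powr \<gamma> \<le> (1 + norm x)\<^sup>2"
    and l: "0 < l" and \<theta>: "0 < \<theta>" "\<theta> < 1"
    and \<delta>_lower: "\<And>x. \<delta> x \<ge> l * (1 + (norm x)\<^sup>2) powr (- (p * \<theta> / 2))"
  defines "V \<equiv> \<lambda>x :: real ^ 'd. (1 + (norm x)\<^sup>2) powr (p / 2)"
  obtains R c b where "0 < c" "0 \<le> b" "\<And>x. (\<integral>y. V y \<partial>em_transition f g \<delta> x) + c * V x powr (1 - \<theta>) \<le> V x + b * indicator (cball 0 R) x"
proof -
  define I where "I x = (\<integral>z. V (x + \<delta> x *\<^sub>R f x + g x *v (sqrt (\<delta> x) *\<^sub>R z)) \<partial>std_gauss)" for x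
  have I: "(\<integral>y. V y \<partial>em_transition f g \<delta> x) = I x" for x
    unfolding em_transition_def I_def V_def by (rule integral_distr) measurable
  have q: "1 \<le> p / 2" using p by simp
  from em_moment_expansion[OF q]
  obtain C where C0: "0 \<le> C" and C: "\<And>(x :: real ^ 'd) fx (G :: real ^ 'm ^ 'd) e. 0 < e \<Longrightarrow> 12 * e\<^sup>2 \<le> 1 \<Longrightarrow>
    norm fx * e ^ 3 \<le> e\<^sup>2 * (1 + norm x) \<Longrightarrow> (norm G)\<^sup>2 * e ^ 3 \<le> e\<^sup>2 * (1 + norm x)\<^sup>2 \<Longrightarrow>
    (\<integral>z. (1 + (norm (x + e ^ 3 *\<^sub>R fx + G *v (sqrt (e ^ 3) *\<^sub>R z)))\<^sup>2) powr (p / 2) \<partial>std_gauss)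
      \<le> (1 + (norm x)\<^sup>2) powr (p / 2) *
        (1 + 2 * (p / 2) * e ^ 3 / (1 + (norm x)\<^sup>2) * (x \<bullet> fx + (p / 2 - 1/2) * (norm G)\<^sup>2) + C * e ^ 4)"
    by blast
  \<comment> \<open>The bound \<open>1/4\<close> ensures \<open>12 e\<^sup>2 \<le> 1\<close>, the other one that \<open>C e \<le> p K6 / 4\<close>.\<close>
  define e0 where "e0 = min (1/4) (p * K6 / (4 * (C + 1)))"
  have e0: "0 < e0" "e0 \<le> 1/4" "C * e0 \<le> p * K6 / 4"
  proof -
    show "0 < e0" using p K6 C0 by (auto simp: e0_def)
    show "e0 \<le> 1/4" unfolding e0_def by (rule min.cobounded1)
    have "C * e0 \<le> (C + 1) * (p * K6 / (4 * (C + 1)))"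
      using C0 \<open>0 < e0\<close> by (intro mult_mono) (auto simp: e0_def)
    also have "\<dots> = p * K6 / 4"
    proof -
      have cancel: "a * (k / (4 * a)) = k / 4" if "0 < a" for a k :: real using that by simp
      show ?thesis by (rule cancel) (use C0 in simp)
    qed
    finally show "C * e0 \<le> p * K6 / 4" .
  qed
  have "\<forall>\<^sub>F x in at_infinity. \<delta> x < e0 ^ 3"
    by (rule order_tendstoD(2)[OF \<delta>_lim]) (use e0 in simp)
  then obtain R1 where R1: "\<And>x. R1 \<le> norm x \<Longrightarrow> \<delta> x < e0 ^ 3"
    unfolding eventually_at_infinity by blast
  define R where "R = max R1 (sqrt (4 * (K6 + K7) / K6))"
  define c where "c = p * K6 / 2 * l"
  have c: "0 < c" using p K6 l by (simp add: c_def)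
  have far: "I x + c * V x powr (1 - \<theta>) \<le> V x" if x: "R < norm x" for x
  proof -
    define e where "e = \<delta> x powr (1/3)"
    have e: "0 < e" using \<delta>_pos[of x] by (simp add: e_def)
    have e3: "e ^ 3 = \<delta> x" "e\<^sup>2 = \<delta> x powr (2/3)"
    proof -
      have "e ^ 3 = e powr 3" "e\<^sup>2 = e powr 2" using e by simp_all
      then show "e ^ 3 = \<delta> x" "e\<^sup>2 = \<delta> x powr (2/3)"
        unfolding e_def powr_powr using \<delta>_pos[of x] by simp_all
    qed
    have "e ^ 3 < e0 ^ 3" using R1[of x] x by (simp add: e3(1) R_def)
    then have ee0: "e < e0" by (rule power_less_imp_less_base) (use e0 in simp)
    then have e14: "e \<le> 1/4" using e0 by simp
    have \<delta>1: "\<delta> x \<le> 1" unfolding e3(1)[symmetric] using e e14 by (intro power_le_one) auto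
    have pw: "\<delta> x powr (1 - \<gamma>) \<le> e\<^sup>2"
    proof -
      have "\<delta> x powr (1 - \<gamma>) \<le> \<delta> x powr (2/3)" using \<delta>1 \<delta>_pos[of x] \<gamma> by (intro powr_mono') auto
      also have "\<dots> = e\<^sup>2" by (simp add: e3(2))
      finally show ?thesis .
    qed
    have split: "\<delta> x = \<delta> x powr \<gamma> * \<delta> x powr (1 - \<gamma>)" using \<delta>_pos[of x] by (simp add: powr_add[symmetric])
    have F: "norm (f x) * e ^ 3 \<le> e\<^sup>2 * (1 + norm x)"
    proof -
      have "norm (f x) * e ^ 3 = (norm (f x) * \<delta> x powr \<gamma>) * \<delta> x powr (1 - \<gamma>)" using split by (simp add: e3(1))
      also have "\<dots> \<le> (1 + norm x) * e\<^sup>2" by (intro mult_mono f_\<delta> pw) auto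
      finally show ?thesis by (simp add: mult.commute)
    qed
    have G: "(norm (g x))\<^sup>2 * e ^ 3 \<le> e\<^sup>2 * (1 + norm x)\<^sup>2"
    proof -
      have "(norm (g x))\<^sup>2 * e ^ 3 = ((norm (g x))\<^sup>2 * \<delta> x powr \<gamma>) * \<delta> x powr (1 - \<gamma>)" using split by (simp add: e3(1))
      also have "\<dots> \<le> (1 + norm x)\<^sup>2 * e\<^sup>2" by (intro mult_mono g_\<delta> pw) auto
      finally show ?thesis by (simp add: mult.commute)
    qed
    have "12 * e\<^sup>2 \<le> 12 * (1/4)\<^sup>2" using e e14 by (intro mult_left_mono power_mono) auto
    then have e12: "12 * e\<^sup>2 \<le> 1" by (simp add: power2_eq_square)
    let ?w = "1 + (norm x)\<^sup>2"
    have w: "1 \<le> ?w" by simp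
    have D: "2 * (p / 2) * \<delta> x / ?w * (x \<bullet> f x + (p / 2 - 1/2) * (norm (g x))\<^sup>2) + C * e ^ 4 \<le> - (p * K6 / 2) * \<delta> x"
    proof -
      have "4 * (K6 + K7) / K6 = (sqrt (4 * (K6 + K7) / K6))\<^sup>2" using K6 K7 by simp
      also have "\<dots> \<le> (norm x)\<^sup>2" using x K6 K7 by (intro power_mono) (auto simp: R_def)
      finally have "4 * (K6 + K7) \<le> K6 * ?w" using K6 by (simp add: field_simps)
      moreover have "K6 * ?w = K6 + K6 * (norm x)\<^sup>2" "- (3 / 4 * K6) * ?w = - (3 / 4 * K6) - 3 / 4 * (K6 * (norm x)\<^sup>2)"
        by (simp_all add: algebra_simps)
      ultimately have "- K6 * (norm x)\<^sup>2 + K7 \<le> - (3 / 4 * K6) * ?w" by simp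
      then have "x \<bullet> f x + (p / 2 - 1/2) * (norm (g x))\<^sup>2 \<le> - (3 / 4 * K6) * ?w"
        using dissipative[of x] by (simp add: diff_divide_distrib)
      then have "2 * (p / 2) * \<delta> x / ?w * (x \<bullet> f x + (p / 2 - 1/2) * (norm (g x))\<^sup>2) \<le> 2 * (p / 2) * \<delta> x / ?w * (- (3 / 4 * K6) * ?w)"
        using p \<delta>_pos[of x] w by (intro mult_left_mono divide_nonneg_pos add_pos_nonneg) auto
      also have "\<dots> = - (3 / 4 * (p * K6)) * \<delta> x"
      proof -
        have "?w \<noteq> 0" using w by linarith
        then show ?thesis by simp
      qed
      finally have 1: "2 * (p / 2) * \<delta> x / ?w * (x \<bullet> f x + (p / 2 - 1/2) * (norm (g x))\<^sup>2) \<le> - (3 / 4 * (p * K6)) * \<delta> x" .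
      have "C * e \<le> p * K6 / 4" using mult_left_mono[OF less_imp_le[OF ee0] C0] e0(3) by simp
      then have "(C * e) * \<delta> x \<le> (p * K6 / 4) * \<delta> x" using \<delta>_pos[of x] by (intro mult_right_mono) auto
      moreover have "C * e ^ 4 = (C * e) * \<delta> x" by (simp add: e3(1)[symmetric] eval_nat_numeral)
      moreover have "X + Z \<le> - (k / 2) * d"
        if "Y \<le> (k / 4) * d" "Z = Y" "X \<le> - (3 / 4 * k) * d" for X Y Z k d :: real
        using that by (simp add: field_simps)
      ultimately show ?thesis using 1 by blast
    qed
    have "I x \<le> V x * (1 + 2 * (p / 2) * \<delta> x / ?w * (x \<bullet> f x + (p / 2 - 1/2) * (norm (g x))\<^sup>2) + C * e ^ 4)"
      using C[OF e e12 F G] unfolding I_def V_def e3(1) by simp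
    also have "\<dots> \<le> V x * (1 - (p * K6 / 2) * \<delta> x)"
      using D by (intro mult_left_mono) (auto simp: V_def)
    finally have "I x + p * K6 / 2 * (\<delta> x * V x) \<le> V x" by (simp add: algebra_simps)
    moreover have "c * V x powr (1 - \<theta>) \<le> p * K6 / 2 * (\<delta> x * V x)"
    proof -
      have "V x powr (1 - \<theta>) = ?w powr (- (p * \<theta> / 2)) * V x"
        using w by (simp add: V_def powr_powr powr_add[symmetric] algebra_simps diff_divide_distrib)
      then have "l * V x powr (1 - \<theta>) \<le> \<delta> x * V x"
        using mult_right_mono[OF \<delta>_lower[of x], of "V x"] by (simp add: V_def mult.assoc)
      then have "p * K6 / 2 * (l * V x powr (1 - \<theta>)) \<le> p * K6 / 2 * (\<delta> x * V x)"
        using p K6 by (intro mult_left_mono) auto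
      then show ?thesis by (simp add: c_def mult.assoc)
    qed
    ultimately show ?thesis by linarith
  qed
  obtain N where N: "p / 2 \<le> real N" using real_arch_simple by blast
  define m where "m = (\<integral>z. (1 + (norm z)\<^sup>2) ^ N \<partial>(std_gauss :: (real ^ 'm) measure))"
  have m0: "0 \<le> m" unfolding m_def by (rule integral_nonneg_AE) simp
  let ?D = "\<lambda>x. 1 + 2 * (norm (x + \<delta> x *\<^sub>R f x))\<^sup>2 + 2 * (norm (sqrt (\<delta> x) *\<^sub>R g x))\<^sup>2"
  have cont: "continuous_on (cball 0 R) f" "continuous_on (cball 0 R) g" "continuous_on (cball 0 R) \<delta>"
    using f_cont g_cont \<delta>_cont continuous_on_subset by blast+
  have "bounded (?D ` cball 0 R)"
    by (intro compact_imp_bounded compact_continuous_image continuous_intros cont) simp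
  then obtain D where "\<forall>v\<in>?D ` cball 0 R. norm v \<le> D" unfolding bounded_iff by blast
  then have D: "norm (?D x) \<le> D" if "x \<in> cball 0 R" for x using that by blast
  define b where "b = \<bar>D\<bar> ^ N * m + c * (1 + R\<^sup>2) powr (p / 2)"
  have near: "I x + c * V x powr (1 - \<theta>) \<le> V x + b" if x: "x \<in> cball 0 R" for x
  proof -
    have Zeq: "g x *v (sqrt (\<delta> x) *\<^sub>R z) = (sqrt (\<delta> x) *\<^sub>R g x) *v z" for z
      by (simp add: matrix_vector_mult_scaleR scaleR_matrix_vector_assoc)
    have "?D x \<le> \<bar>D\<bar>" using D[OF x] by (simp add: abs_le_iff)
    then have bound: "V (x + \<delta> x *\<^sub>R f x + (sqrt (\<delta> x) *\<^sub>R g x) *v z) \<le> \<bar>D\<bar> ^ N * (1 + (norm z)\<^sup>2) ^ N" for z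
      unfolding V_def using p N by (intro affine_powr_bound) auto
    have "I x \<le> (\<integral>z. \<bar>D\<bar> ^ N * (1 + (norm z)\<^sup>2) ^ N \<partial>(std_gauss :: (real ^ 'm) measure))"
      unfolding I_def Zeq using p integrable_std_gauss_poly[of N]
      by (intro integral_mono bound) (auto simp: V_def intro!: integrable_affine_powr)
    then have "I x \<le> \<bar>D\<bar> ^ N * m" using integrable_std_gauss_poly[of N] by (simp add: m_def)
    moreover have "V x powr (1 - \<theta>) \<le> (1 + R\<^sup>2) powr (p / 2)"
    proof -
      have "1 \<le> V x" using p by (simp add: V_def ge_one_powr_ge_zero)
      then have "V x powr (1 - \<theta>) \<le> V x powr 1" using \<theta> by (intro powr_mono) auto
      also have "\<dots> = V x" using \<open>1 \<le> V x\<close> by simp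
      also have "\<dots> \<le> (1 + R\<^sup>2) powr (p / 2)"
        unfolding V_def using x p by (intro powr_mono2 add_mono power_mono) auto
      finally show ?thesis .
    qed
    then have "c * V x powr (1 - \<theta>) \<le> c * (1 + R\<^sup>2) powr (p / 2)" using c by (intro mult_left_mono) auto
    moreover have "0 \<le> V x" by (simp add: V_def)
    ultimately show ?thesis by (simp add: b_def)
  qed
  show thesis
  proof (rule that[OF c])
    show "0 \<le> b" using m0 c by (simp add: b_def)
    show "(\<integral>y. V y \<partial>em_transition f g \<delta> x) + c * V x powr (1 - \<theta>) \<le> V x + b * indicator (cball 0 R) x" for x
      using near[of x] far[of x] by (cases "norm x \<le> R") (auto simp: I)
  qed
qed

section \<open>Brownian motion at random times\<close>

text \<open>
  Random times are approximated from above by points of the grid of mesh \<open>1 / (k + 1)\<close>, strictly from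
  above so that the value of the approximation is known before the time at which it is attained.
\<close>

definition grid_index :: "nat \<Rightarrow> real \<Rightarrow> nat" where
  "grid_index k x = nat \<lfloor>real (Suc k) * x\<rfloor>"

definition grid_point :: "nat \<Rightarrow> nat \<Rightarrow> real" where
  "grid_point k i = (real i + 1) / real (Suc k)"

lemma measurable_grid_index [measurable]: "grid_index k \<in> borel \<rightarrow>\<^sub>M count_space UNIV"
proof -
  have "(\<lambda>x::real. \<lfloor>real (Suc k) * x\<rfloor>) \<in> borel \<rightarrow>\<^sub>M count_space UNIV" by measurable
  then have "nat \<circ> (\<lambda>x::real. \<lfloor>real (Suc k) * x\<rfloor>) \<in> borel \<rightarrow>\<^sub>M count_space UNIV"
    by (rule measurable_comp) simp
  then show ?thesis by (simp add: grid_index_def[abs_def] comp_def)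
qed

lemma grid_bounds:
  assumes "0 \<le> x"
  shows "x < grid_point k (grid_index k x)" "grid_point k (grid_index k x) \<le> x + 1 / real (Suc k)"
proof -
  have i: "real (grid_index k x) = of_int \<lfloor>real (Suc k) * x\<rfloor>"
    unfolding grid_index_def using assms by (intro of_nat_nat) simp
  have "real (Suc k) * x < real (grid_index k x) + 1" unfolding i by linarith
  then show "x < grid_point k (grid_index k x)"
    by (simp only: grid_point_def) (simp add: pos_less_divide_eq mult.commute)
  have "real (grid_index k x) + 1 \<le> real (Suc k) * x + 1" unfolding i by linarith
  then have "grid_point k (grid_index k x) \<le> (real (Suc k) * x + 1) / real (Suc k)"
    unfolding grid_point_def by (intro divide_right_mono) auto
  then show "grid_point k (grid_index k x) \<le> x + 1 / real (Suc k)"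
    by (simp add: add_divide_distrib)
qed

lemma grid_tendsto:
  assumes "0 \<le> x" shows "(\<lambda>k. grid_point k (grid_index k x)) \<longlonglongrightarrow> x"
proof (rule tendsto_sandwich)
  show "\<forall>\<^sub>F k in sequentially. x \<le> grid_point k (grid_index k x)"
    by (intro always_eventually allI less_imp_le grid_bounds assms)
  show "\<forall>\<^sub>F k in sequentially. grid_point k (grid_index k x) \<le> x + 1 / real (Suc k)"
    by (intro always_eventually allI grid_bounds assms)
  have "(\<lambda>k. x + 1 / real (Suc k)) \<longlonglongrightarrow> x + 0"
    by (intro tendsto_add tendsto_const LIMSEQ_Suc lim_1_over_n)
  then show "(\<lambda>k. x + 1 / real (Suc k)) \<longlonglongrightarrow> x" by simp
qed auto

lemma grid_point_pos: "0 < grid_point k i"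
  by (simp add: grid_point_def add_nonneg_pos)

lemma nn_integral_countable_split:
  fixes X :: "'a \<Rightarrow> 'i::countable"
  assumes X: "X \<in> M \<rightarrow>\<^sub>M count_space UNIV" and h: "h \<in> borel_measurable M"
  shows "(\<integral>\<^sup>+x. h x \<partial>M) = (\<Sum>n. \<integral>\<^sup>+x. (if to_nat (X x) = n then h x else 0) \<partial>M)"
proof -
  have "(\<Sum>n. if to_nat (X x) = n then h x else 0) = h x" for x
    by (subst suminf_finite[of "{to_nat (X x)}"]) auto
  moreover have "(\<lambda>x. if to_nat (X x) = n then h x else 0) \<in> borel_measurable M" for n
    using X h by measurable
  ultimately show ?thesis by (subst nn_integral_suminf[symmetric]) auto
qed

lemma nn_integral_eq_by_cells:
  fixes X :: "'a \<Rightarrow> 'i::countable"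
  assumes X: "X \<in> M \<rightarrow>\<^sub>M count_space UNIV" and h: "h \<in> borel_measurable M" "h' \<in> borel_measurable M"
    and cell: "\<And>c. (\<integral>\<^sup>+x. h x * indicator {x. X x = c} x \<partial>M) = (\<integral>\<^sup>+x. h' x * indicator {x. X x = c} x \<partial>M)"
  shows "(\<integral>\<^sup>+x. h x \<partial>M) = (\<integral>\<^sup>+x. h' x \<partial>M)"
proof -
  have "(\<integral>\<^sup>+x. (if to_nat (X x) = n then h x else 0) \<partial>M) = (\<integral>\<^sup>+x. (if to_nat (X x) = n then h' x else 0) \<partial>M)" for n
  proof (cases "n \<in> range (to_nat :: 'i \<Rightarrow> nat)")
    case True
    then obtain c :: 'i where "n = to_nat c" by auto
    then have "(if to_nat (X x) = n then k x else 0) = k x * indicator {x. X x = c} x" for k :: "'a \<Rightarrow> ennreal" and x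
      by auto
    then show ?thesis using cell[of c] by simp
  next
    case False
    then have "to_nat (X x) \<noteq> n" for x by auto
    then show ?thesis by simp
  qed
  then show ?thesis using nn_integral_countable_split[OF X] h by simp
qed

text \<open>
  The indicator of a closed set is the decreasing limit of the functions \<open>max 0 (1 - k d(x, A))\<close>.
\<close>

lemma finite_measure_eqI_continuous:
  fixes \<mu> \<nu> :: "'a::metric_space measure"
  assumes sets: "sets \<mu> = sets borel" "sets \<nu> = sets borel" and fin: "finite_measure \<mu>" "finite_measure \<nu>"
    and eq: "\<And>h. continuous_on UNIV h \<Longrightarrow> (\<And>x. 0 \<le> h x \<and> h x \<le> 1) \<Longrightarrow> (\<integral>\<^sup>+x. ennreal (h x) \<partial>\<mu>) = (\<integral>\<^sup>+x. ennreal (h x) \<partial>\<nu>)"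
  shows "\<mu> = \<nu>"
proof -
  have closed_eq: "emeasure \<mu> A = emeasure \<nu> A" if A: "closed A" for A
  proof (cases "A = {}")
    case False
    define h where "h k x = max 0 (1 - real k * infdist x A)" for k :: nat and x
    have h: "continuous_on UNIV (h k)" "0 \<le> h k x \<and> h k x \<le> 1" for k x
      by (auto simp: h_def[abs_def] infdist_nonneg intro!: continuous_intros)
    have lim: "(\<lambda>k. ennreal (h k x)) \<longlonglongrightarrow> indicator A x" for x
    proof (cases "x \<in> A")
      case True
      then show ?thesis by (simp add: h_def)
    next
      case xA: False
      then have pos: "0 < infdist x A" using in_closed_iff_infdist_zero[OF A False] infdist_nonneg[of x A] by auto
      obtain n where n: "1 / infdist x A < real n" using reals_Archimedean2 by blast
      have "h k x = 0" if "n \<le> k" for k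
      proof -
        have "1 / infdist x A < real k" using n that by (meson less_le_trans of_nat_le_iff)
        then have "1 < real k * infdist x A" using pos by (simp add: pos_divide_less_eq)
        then show ?thesis by (simp add: h_def)
      qed
      then have "\<forall>\<^sub>F k in sequentially. ennreal (h k x) = 0"
        unfolding eventually_sequentially by (intro exI[of _ n]) auto
      then show ?thesis using xA by (simp add: tendsto_eventually)
    qed
    have conv: "(\<lambda>k. \<integral>\<^sup>+x. ennreal (h k x) \<partial>\<kappa>) \<longlonglongrightarrow> emeasure \<kappa> A"
      if "sets \<kappa> = sets borel" "finite_measure \<kappa>" for \<kappa> :: "'a measure"
    proof -
      have "(\<lambda>k. \<integral>\<^sup>+x. ennreal (h k x) \<partial>\<kappa>) \<longlonglongrightarrow> (\<integral>\<^sup>+x. indicator A x \<partial>\<kappa>)"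
      proof (rule nn_integral_dominated_convergence[where w = "\<lambda>_. 1"])
        show "(\<lambda>x. ennreal (h k x)) \<in> borel_measurable \<kappa>" for k
          using borel_measurable_continuous_onI[OF h(1)[of k]] that(1) by (simp cong: measurable_cong_sets)
        show "(\<lambda>x. indicator A x) \<in> borel_measurable \<kappa>"
          using A that(1) by (intro borel_measurable_indicator) simp
        show "(\<integral>\<^sup>+x. 1 \<partial>\<kappa>) < \<infinity>"
          using finite_measure.finite_emeasure_space[OF that(2)] by (simp add: less_top)
      qed (use h lim in \<open>auto simp: ennreal_le_1\<close>)
      then show ?thesis using A that(1) by simp
    qed
    show ?thesis
      using LIMSEQ_unique[OF conv[OF sets(1) fin(1)]] conv[OF sets(2) fin(2)] eq[OF h] by simp
  qed simp
  show ?thesis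
  proof (rule measure_eqI_generator_eq[where E = "Collect closed" and A = "\<lambda>_. UNIV" and \<Omega> = UNIV])
    show "Int_stable (Collect (closed :: 'a set \<Rightarrow> bool))" by (auto simp: Int_stable_def)
    have "sets (borel :: 'a measure) = sigma_sets UNIV (Collect closed)" by (subst borel_eq_closed) simp
    then show "sets \<mu> = sigma_sets UNIV (Collect closed)" "sets \<nu> = sigma_sets UNIV (Collect closed)" using sets by auto
    show "emeasure \<mu> UNIV \<noteq> \<infinity>" for i :: nat
      using finite_measure.finite_emeasure_space[OF fin(1)] sets_eq_imp_space_eq[OF sets(1)] by simp
  qed (auto intro: closed_eq)
qed

context brownian_motion
begin

lemma space_Ft: "0 \<le> t \<Longrightarrow> space (F t) = space M"
  using space_F[of t] by simp

lemma sets_Ft_mono: "0 \<le> s \<Longrightarrow> s \<le> t \<Longrightarrow> sets (F s) \<subseteq> sets (F t)"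
  using sets_F_mono[of s t] by simp

lemma sets_Ft_M: "0 \<le> t \<Longrightarrow> sets (F t) \<subseteq> sets M"
  using subalgebra_F[of t] by (simp add: subalgebra_def)

lemma null_sets_Ft: "A \<in> null_sets M \<Longrightarrow> 0 \<le> t \<Longrightarrow> A \<in> sets (F t)"
  using null_sets_F sets_Ft_mono[of 0 t] by auto

lemma measurable_Ft_M: "0 \<le> t \<Longrightarrow> h \<in> F t \<rightarrow>\<^sub>M N \<Longrightarrow> h \<in> M \<rightarrow>\<^sub>M N"
  using sets_Ft_M[of t] space_Ft[of t] by (auto simp: measurable_def)

lemma measurable_Ft_mono: "0 \<le> s \<Longrightarrow> s \<le> t \<Longrightarrow> h \<in> F s \<rightarrow>\<^sub>M N \<Longrightarrow> h \<in> F t \<rightarrow>\<^sub>M N"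
  using sets_Ft_mono[of s t] space_Ft[of s] space_Ft[of t] by (auto simp: measurable_def)

text \<open>
  The filtration contains all null sets and their subsets.
\<close>

lemma measurable_Ft_modification:
  assumes t: "0 \<le> t" and h': "h' \<in> F t \<rightarrow>\<^sub>M N" and Z: "Z \<in> null_sets M"
    and eq: "\<And>\<omega>. \<omega> \<in> space M \<Longrightarrow> \<omega> \<notin> Z \<Longrightarrow> h \<omega> = h' \<omega>" and sp: "\<And>\<omega>. \<omega> \<in> space M \<Longrightarrow> h \<omega> \<in> space N"
  shows "h \<in> F t \<rightarrow>\<^sub>M N"
proof (rule measurableI)
  show "h \<omega> \<in> space N" if "\<omega> \<in> space (F t)" for \<omega> using sp that by (simp add: space_Ft[OF t])
  fix A assume A: "A \<in> sets N"
  have "h -` A \<inter> Z \<in> null_sets M" by (rule complete2[OF _ Z]) simp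
  then have "h -` A \<inter> Z \<inter> space M \<in> null_sets M" by (intro complete2[of "h -` A \<inter> Z \<inter> space M" "h -` A \<inter> Z"]) auto
  moreover have "h' -` A \<inter> space (F t) - Z \<in> sets (F t)"
    using measurable_sets[OF h' A] null_sets_Ft[OF Z t] by auto
  moreover have "h -` A \<inter> space (F t) = (h' -` A \<inter> space (F t) - Z) \<union> (h -` A \<inter> Z \<inter> space M)"
    using eq by (auto simp: space_Ft[OF t])
  ultimately show "h -` A \<inter> space (F t) \<in> sets (F t)" using null_sets_Ft[OF _ t] by auto
qed

text \<open>
  Almost sure continuity is used through one fixed null set, so that all modifications of random
  variables are made on the same set.
\<close>

definition bad :: "'w set" where
  "bad = (SOME Z. Z \<in> null_sets M \<and> (\<forall>\<omega>\<in>space M - Z. continuous_on {0..} (\<lambda>t. W t \<omega>)))"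

lemma bad: "bad \<in> null_sets M" "\<And>\<omega>. \<omega> \<in> space M \<Longrightarrow> \<omega> \<notin> bad \<Longrightarrow> continuous_on {0..} (\<lambda>t. W t \<omega>)"
proof -
  obtain Z where "{\<omega> \<in> space M. \<not> continuous_on {0..} (\<lambda>t. W t \<omega>)} \<subseteq> Z" "emeasure M Z = 0" "Z \<in> sets M"
    using AE_E[OF continuous_paths] by metis
  then have "\<exists>Z. Z \<in> null_sets M \<and> (\<forall>\<omega>\<in>space M - Z. continuous_on {0..} (\<lambda>t. W t \<omega>))"
    by (intro exI[of _ Z]) (auto intro: null_setsI)
  from someI_ex[OF this]
  show "bad \<in> null_sets M" "\<And>\<omega>. \<omega> \<in> space M \<Longrightarrow> \<omega> \<notin> bad \<Longrightarrow> continuous_on {0..} (\<lambda>t. W t \<omega>)"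
    by (auto simp: bad_def)
qed

lemma path_tendsto:
  assumes "\<omega> \<in> space M" "\<omega> \<notin> bad" "r \<longlonglongrightarrow> s" "\<And>k. 0 \<le> r k" "0 \<le> s"
  shows "(\<lambda>k. W (r k) \<omega>) \<longlonglongrightarrow> W s \<omega>"
  using continuous_on_tendsto_compose[OF bad(2)[OF assms(1,2)] assms(3)] assms(4,5) by simp

text \<open>
  Progressive measurability: \<open>W\<close> is evaluated at grid points, whose values are countably many
  adapted variables, and the paths are continuous outside a null set.
\<close>

lemma W_at_random_time:
  assumes t: "0 \<le> t" and R: "R \<in> borel_measurable (F t)" and Rt: "\<And>\<omega>. \<omega> \<in> space M \<Longrightarrow> 0 \<le> R \<omega> \<and> R \<omega> \<le> t"
  shows "(\<lambda>\<omega>. W (R \<omega>) \<omega>) \<in> borel_measurable (F t)"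
proof (rule measurable_Ft_modification[OF t _ bad(1)])
  let ?r = "\<lambda>k \<omega>. min t (grid_point k (grid_index k (R \<omega>)))"
  show "(\<lambda>\<omega>. if \<omega> \<in> bad then 0 else W (R \<omega>) \<omega>) \<in> borel_measurable (F t)"
  proof (rule borel_measurable_LIMSEQ_metric)
    fix k
    have "(\<lambda>\<omega>. W (min t (grid_point k i)) \<omega>) \<in> borel_measurable (F t)" for i
      using adapted[of "min t (grid_point k i)"] t grid_point_pos[of k i]
      by (intro measurable_Ft_mono[of "min t (grid_point k i)" t]) auto
    then have "(\<lambda>\<omega>. W (?r k \<omega>) \<omega>) \<in> borel_measurable (F t)"
      by (rule measurable_compose_countable) (use R in measurable)
    moreover have "bad \<in> sets (F t)" using null_sets_Ft[OF bad(1) t] .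
    ultimately show "(\<lambda>\<omega>. if \<omega> \<in> bad then 0 else W (?r k \<omega>) \<omega>) \<in> borel_measurable (F t)" by measurable
  next
    fix \<omega> assume "\<omega> \<in> space (F t)"
    then have \<omega>: "\<omega> \<in> space M" by (simp add: space_Ft[OF t])
    show "(\<lambda>k. if \<omega> \<in> bad then 0 else W (?r k \<omega>) \<omega>) \<longlonglongrightarrow> (if \<omega> \<in> bad then 0 else W (R \<omega>) \<omega>)"
    proof (cases "\<omega> \<in> bad")
      case False
      have "(\<lambda>k. ?r k \<omega>) \<longlonglongrightarrow> min t (R \<omega>)" using Rt[OF \<omega>] by (intro tendsto_min tendsto_const grid_tendsto) auto
      then have "(\<lambda>k. ?r k \<omega>) \<longlonglongrightarrow> R \<omega>" using Rt[OF \<omega>] by (simp add: min_absorb2)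
      then have "(\<lambda>k. W (?r k \<omega>) \<omega>) \<longlonglongrightarrow> W (R \<omega>) \<omega>"
        using Rt[OF \<omega>] t grid_point_pos by (intro path_tendsto[OF \<omega> False]) (auto intro: less_imp_le)
      then show ?thesis using False by simp
    qed simp
  qed
qed auto

text \<open>
  Independence of the increment from the whole past, in the form that is needed for functions depending
  on both: the pair of the past and the increment has a product law.
\<close>

lemma increment_law:
  assumes st: "0 \<le> s" "s < t" and h: "h \<in> borel_measurable (F s \<Otimes>\<^sub>M borel)"
  shows "(\<integral>\<^sup>+\<omega>. h (\<omega>, W t \<omega> - W s \<omega>) \<partial>M) = (\<integral>\<^sup>+\<omega>. \<integral>\<^sup>+z. h (\<omega>, sqrt (t - s) *\<^sub>R z) \<partial>std_gauss \<partial>M)"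
proof -
  let ?X = "\<lambda>\<omega>. W t \<omega> - W s \<omega>"
  have t0: "0 \<le> t" using st by simp
  have X: "?X \<in> borel_measurable M"
    using measurable_Ft_M[OF st(1) adapted[OF st(1)]] measurable_Ft_M[OF t0 adapted[OF t0]] by measurable
  have id: "(\<lambda>\<omega>. \<omega>) \<in> M \<rightarrow>\<^sub>M F s" by (rule measurable_Ft_M[OF st(1)]) simp
  have prod: "distr M (F s) (\<lambda>\<omega>. \<omega>) \<Otimes>\<^sub>M distr M borel ?X = distr M (F s \<Otimes>\<^sub>M borel) (\<lambda>\<omega>. (\<omega>, ?X \<omega>))"
  proof (rule pair_measure_eqI)
    show "sigma_finite_measure (distr M (F s) (\<lambda>\<omega>. \<omega>))" "sigma_finite_measure (distr M borel ?X)"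
      using prob_space_distr[OF id] prob_space_distr[OF X] prob_space_imp_sigma_finite by blast+
    show "sets (distr M (F s) (\<lambda>\<omega>. \<omega>) \<Otimes>\<^sub>M distr M borel ?X) = sets (distr M (F s \<Otimes>\<^sub>M borel) (\<lambda>\<omega>. (\<omega>, ?X \<omega>)))"
      by (simp add: sets_pair_measure_cong[OF sets_distr sets_distr])
    fix A B assume "A \<in> sets (distr M (F s) (\<lambda>\<omega>. \<omega>))" "B \<in> sets (distr M borel ?X)"
    then have A: "A \<in> sets (F s)" and B: "B \<in> sets borel" by auto
    have "?X -` B \<inter> space M \<in> sets (vimage_algebra (space M) ?X borel)" using B by (rule in_vimage_algebra)
    then have "prob (A \<inter> (?X -` B \<inter> space M)) = prob A * prob (?X -` B \<inter> space M)"
      by (rule indep_setD[OF indep_increments[OF st] A])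
    moreover have "A \<subseteq> space M" using sets.sets_into_space[OF A] by (simp add: space_Ft[OF st(1)])
    then have "(\<lambda>\<omega>. (\<omega>, ?X \<omega>)) -` (A \<times> B) \<inter> space M = A \<inter> (?X -` B \<inter> space M)" "(\<lambda>\<omega>. \<omega>) -` A \<inter> space M = A"
      by auto
    ultimately show "emeasure (distr M (F s) (\<lambda>\<omega>. \<omega>)) A * emeasure (distr M borel ?X) B
        = emeasure (distr M (F s \<Otimes>\<^sub>M borel) (\<lambda>\<omega>. (\<omega>, ?X \<omega>))) (A \<times> B)"
      using A B X id by (simp add: emeasure_distr emeasure_eq_measure ennreal_mult)
  qed
  have "distr M borel ?X = distr M lborel ?X" by (intro distr_cong) auto
  also have "\<dots> = distr std_gauss borel (\<lambda>z. sqrt (t - s) *\<^sub>R z)"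
    using normal_increments[OF st] st by (simp add: distr_std_gauss_scale distributed_def)
  finally have X_law: "distr M borel ?X = distr std_gauss borel (\<lambda>z. sqrt (t - s) *\<^sub>R z)" .
  interpret X: prob_space "distr M borel ?X" by (rule prob_space_distr[OF X])
  have h': "h \<in> borel_measurable (distr M (F s) (\<lambda>\<omega>. \<omega>) \<Otimes>\<^sub>M distr M borel ?X)"
    using h by (simp cong: measurable_cong_sets add: sets_pair_measure_cong[OF sets_distr sets_distr])
  have inner: "(\<lambda>\<omega>. \<integral>\<^sup>+y. h (\<omega>, y) \<partial>distr M borel ?X) \<in> borel_measurable (F s)"
    using X.borel_measurable_nn_integral_fst[of h "F s"] h by (simp cong: measurable_cong_sets sets_pair_measure_cong)
  have "(\<integral>\<^sup>+\<omega>. h (\<omega>, ?X \<omega>) \<partial>M) = (\<integral>\<^sup>+p. h p \<partial>distr M (F s \<Otimes>\<^sub>M borel) (\<lambda>\<omega>. (\<omega>, ?X \<omega>)))"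
    using h X id by (subst nn_integral_distr) auto
  also have "\<dots> = (\<integral>\<^sup>+\<omega>. \<integral>\<^sup>+y. h (\<omega>, y) \<partial>distr M borel ?X \<partial>distr M (F s) (\<lambda>\<omega>. \<omega>))"
    unfolding prod[symmetric] by (rule X.nn_integral_fst[OF h', symmetric])
  also have "\<dots> = (\<integral>\<^sup>+\<omega>. \<integral>\<^sup>+y. h (\<omega>, y) \<partial>distr M borel ?X \<partial>M)"
    using inner id by (subst nn_integral_distr) auto
  also have "\<dots> = (\<integral>\<^sup>+\<omega>. \<integral>\<^sup>+z. h (\<omega>, sqrt (t - s) *\<^sub>R z) \<partial>std_gauss \<partial>M)"
  proof (rule nn_integral_cong)
    fix \<omega> assume "\<omega> \<in> space M"
    then have "(\<lambda>y. h (\<omega>, y)) \<in> borel_measurable borel"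
      using measurable_Pair2[OF h] by (simp add: space_Ft[OF st(1)])
    then show "(\<integral>\<^sup>+y. h (\<omega>, y) \<partial>distr M borel ?X) = (\<integral>\<^sup>+z. h (\<omega>, sqrt (t - s) *\<^sub>R z) \<partial>std_gauss)"
      unfolding X_law by (subst nn_integral_distr) auto
  qed
  finally show ?thesis .
qed

text \<open>
  The events of the \<open>\<sigma>\<close>-algebra of the past up to the random time \<open>T\<close>.
\<close>

definition settled :: "('w \<Rightarrow> real) \<Rightarrow> 'w set set" where
  "settled T = {G. G \<subseteq> space M \<and> (\<forall>t\<ge>0. {\<omega>\<in>G. T \<omega> \<le> t} \<in> sets (F t))}"

text \<open>
  \<open>T\<close> is a stopping time and \<open>Y\<close> is known at time \<open>T\<close>.  The variables are cut off on \<open>{T > t}\<close>, where \<open>F t\<close>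
  does not determine them.
\<close>

definition adapted_state :: "('w \<Rightarrow> real) \<Rightarrow> ('w \<Rightarrow> real ^ 'd) \<Rightarrow> bool" where
  "adapted_state T Y \<longleftrightarrow> (\<forall>\<omega>\<in>space M. 0 \<le> T \<omega>) \<and>
     (\<forall>t\<ge>0. {\<omega>\<in>space M. T \<omega> \<le> t} \<in> sets (F t) \<and>
       (\<lambda>\<omega>. if T \<omega> \<le> t then T \<omega> else 0) \<in> borel_measurable (F t) \<and>
       (\<lambda>\<omega>. if T \<omega> \<le> t then Y \<omega> else 0) \<in> borel_measurable (F t))"

lemma adapted_stateD:
  assumes "adapted_state T Y"
  shows "\<omega> \<in> space M \<Longrightarrow> 0 \<le> T \<omega>"
    and "0 \<le> t \<Longrightarrow> {\<omega>\<in>space M. T \<omega> \<le> t} \<in> sets (F t)"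
    and "0 \<le> t \<Longrightarrow> (\<lambda>\<omega>. if T \<omega> \<le> t then T \<omega> else 0) \<in> borel_measurable (F t)"
    and "0 \<le> t \<Longrightarrow> (\<lambda>\<omega>. if T \<omega> \<le> t then Y \<omega> else 0) \<in> borel_measurable (F t)"
  using assms by (auto simp: adapted_state_def)

lemma stopped_limit_measurable:
  fixes Z :: "'w \<Rightarrow> 'b::real_normed_vector"
  assumes "\<And>t. 0 \<le> t \<Longrightarrow> (\<lambda>\<omega>. if T \<omega> \<le> t then Z \<omega> else 0) \<in> borel_measurable (F t)"
  shows "Z \<in> borel_measurable M"
proof (rule borel_measurable_LIMSEQ_metric)
  show "(\<lambda>\<omega>. if T \<omega> \<le> real k then Z \<omega> else 0) \<in> borel_measurable M" for k
    by (rule measurable_Ft_M[OF _ assms]) auto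
  fix \<omega>
  obtain n where n: "T \<omega> \<le> real n" using real_arch_simple by blast
  have "\<forall>\<^sub>F k in sequentially. (if T \<omega> \<le> real k then Z \<omega> else 0) = Z \<omega>"
    unfolding eventually_sequentially using n by (intro exI[of _ n]) auto
  then show "(\<lambda>k. if T \<omega> \<le> real k then Z \<omega> else 0) \<longlonglongrightarrow> Z \<omega>" by (rule tendsto_eventually)
qed

lemma adapted_state_measurable:
  assumes "adapted_state T Y"
  shows "T \<in> borel_measurable M" "Y \<in> borel_measurable M"
  using adapted_stateD(3,4)[OF assms] by (auto intro: stopped_limit_measurable)

lemma settled_events:
  assumes T: "adapted_state T Y" and G: "G \<in> settled T"
  shows "G \<in> sets M"
proof -
  have "\<exists>n. T \<omega> \<le> real n" for \<omega> by (rule real_arch_simple)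
  then have "(\<Union>n. {\<omega>\<in>G. T \<omega> \<le> real n}) = G" by auto
  moreover have "{\<omega>\<in>G. T \<omega> \<le> real n} \<in> sets M" for n
    using G sets_Ft_M[of "real n"] by (auto simp: settled_def)
  then have "(\<Union>n. {\<omega>\<in>G. T \<omega> \<le> real n}) \<in> sets M" by (intro sets.countable_UN) auto
  ultimately show ?thesis by simp
qed

lemma settled_mono:
  assumes S: "adapted_state S Z" and le: "\<And>\<omega>. \<omega> \<in> space M \<Longrightarrow> T \<omega> \<le> S \<omega>" and G: "G \<in> settled T"
  shows "G \<in> settled S"
proof -
  have "{\<omega>\<in>G. S \<omega> \<le> t} = {\<omega>\<in>G. T \<omega> \<le> t} \<inter> {\<omega>\<in>space M. S \<omega> \<le> t}" for t
    using G order_trans[OF le] by (auto simp: settled_def subset_iff)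
  then show ?thesis using G adapted_stateD(2)[OF S] by (auto simp: settled_def)
qed

lemma settled_state_event:
  assumes T: "adapted_state T Y" and A: "A \<in> sets borel"
  shows "Y -` A \<inter> space M \<in> settled T"
proof -
  have "{\<omega>\<in>Y -` A \<inter> space M. T \<omega> \<le> t} = ((\<lambda>\<omega>. if T \<omega> \<le> t then Y \<omega> else 0) -` A \<inter> space (F t)) \<inter> {\<omega>\<in>space M. T \<omega> \<le> t}"
    if "0 \<le> t" for t using space_Ft[OF that] by auto
  then show ?thesis
    using measurable_sets[OF adapted_stateD(4)[OF T] A] adapted_stateD(2)[OF T] by (auto simp: settled_def)
qed

lemma settled_space: "adapted_state T Y \<Longrightarrow> space M \<in> settled T"
  using adapted_stateD(2) by (auto simp: settled_def)

lemma settled_Diff: "adapted_state T Y \<Longrightarrow> G \<in> settled T \<Longrightarrow> space M - G \<in> settled T"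
proof -
  assume T: "adapted_state T Y" and G: "G \<in> settled T"
  have "{\<omega>\<in>space M - G. T \<omega> \<le> t} = {\<omega>\<in>space M. T \<omega> \<le> t} - {\<omega>\<in>G. T \<omega> \<le> t}" for t by auto
  then show ?thesis using G adapted_stateD(2)[OF T] by (auto simp: settled_def)
qed

lemma settled_UN: "(\<And>i::nat. G i \<in> settled T) \<Longrightarrow> (\<Union>i. G i) \<in> settled T"
proof -
  assume G: "\<And>i::nat. G i \<in> settled T"
  have "{\<omega>\<in>\<Union>i. G i. T \<omega> \<le> t} = (\<Union>i. {\<omega>\<in>G i. T \<omega> \<le> t})" for t by auto
  then show ?thesis using G by (auto simp: settled_def)
qed

text \<open>
  The new time exceeds the old one, so that on \<open>{T + \<delta>(Y) \<le> t}\<close> both increments of \<open>W\<close> are taken before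
  \<open>t\<close>; the minimum with \<open>t\<close> makes the evaluation time bounded everywhere.
\<close>

lemma adapted_state_step:
  fixes Y :: "'w \<Rightarrow> real ^ 'd" and G :: "real ^ 'd \<Rightarrow> real ^ 'm ^ 'd"
  assumes T: "adapted_state T Y" and \<delta>[measurable]: "\<delta> \<in> borel_measurable borel" and \<delta>_pos: "\<And>y. 0 < \<delta> y"
    and b[measurable]: "b \<in> borel_measurable borel" and G[measurable]: "G \<in> borel_measurable borel"
  shows "adapted_state (\<lambda>\<omega>. T \<omega> + \<delta> (Y \<omega>)) (\<lambda>\<omega>. b (Y \<omega>) + G (Y \<omega>) *v (W (T \<omega> + \<delta> (Y \<omega>)) \<omega> - W (T \<omega>) \<omega>))"
proof -
  let ?T = "\<lambda>\<omega>. T \<omega> + \<delta> (Y \<omega>)"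
  let ?Y = "\<lambda>\<omega>. b (Y \<omega>) + G (Y \<omega>) *v (W (?T \<omega>) \<omega> - W (T \<omega>) \<omega>)"
  have T0: "0 \<le> T \<omega>" if "\<omega> \<in> space M" for \<omega> using adapted_stateD(1)[OF T that] .
  have "{\<omega>\<in>space M. ?T \<omega> \<le> t} \<in> sets (F t) \<and>
       (\<lambda>\<omega>. if ?T \<omega> \<le> t then ?T \<omega> else 0) \<in> borel_measurable (F t) \<and>
       (\<lambda>\<omega>. if ?T \<omega> \<le> t then ?Y \<omega> else 0) \<in> borel_measurable (F t)" if t: "0 \<le> t" for t
  proof -
    define T1 where "T1 = (\<lambda>\<omega>. if T \<omega> \<le> t then T \<omega> else 0)"
    define Y1 where "Y1 = (\<lambda>\<omega>. if T \<omega> \<le> t then Y \<omega> else 0)"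
    have m1[measurable]: "T1 \<in> borel_measurable (F t)" "Y1 \<in> borel_measurable (F t)"
      using adapted_stateD(3,4)[OF T t] by (auto simp: T1_def Y1_def)
    have le: "T \<omega> \<le> t" if "?T \<omega> \<le> t" for \<omega> using that \<delta>_pos[of "Y \<omega>"] by linarith
    have set: "{\<omega>\<in>space M. ?T \<omega> \<le> t} = {\<omega>\<in>space M. T \<omega> \<le> t} \<inter> {\<omega>\<in>space (F t). T1 \<omega> + \<delta> (Y1 \<omega>) \<le> t}"
      using le by (auto simp: T1_def Y1_def space_Ft[OF t])
    have A: "{\<omega>\<in>space M. ?T \<omega> \<le> t} \<in> sets (F t)"
      unfolding set by (intro sets.Int adapted_stateD(2)[OF T t]) measurable
    then have [measurable]: "Measurable.pred (F t) (\<lambda>\<omega>. ?T \<omega> \<le> t)"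
      by (simp add: pred_def space_Ft[OF t])
    \<comment> \<open>\<open>T1\<close> and \<open>Y1\<close> are \<open>T\<close> and \<open>Y\<close> as far as they are known at time \<open>t\<close>.\<close>
    have W1: "(\<lambda>\<omega>. W (T1 \<omega>) \<omega>) \<in> borel_measurable (F t)"
      by (rule W_at_random_time[OF t m1(1)]) (auto simp: T1_def t T0)
    have W2: "(\<lambda>\<omega>. W (min t (T1 \<omega> + \<delta> (Y1 \<omega>))) \<omega>) \<in> borel_measurable (F t)"
    proof (rule W_at_random_time[OF t])
      show "(\<lambda>\<omega>. min t (T1 \<omega> + \<delta> (Y1 \<omega>))) \<in> borel_measurable (F t)" by measurable
      show "0 \<le> min t (T1 \<omega> + \<delta> (Y1 \<omega>)) \<and> min t (T1 \<omega> + \<delta> (Y1 \<omega>)) \<le> t" if "\<omega> \<in> space M" for \<omega>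
        using T0[OF that] \<delta>_pos[of "Y1 \<omega>"] t by (auto simp: T1_def)
    qed
    have "(\<lambda>\<omega>. if ?T \<omega> \<le> t then T1 \<omega> + \<delta> (Y1 \<omega>) else 0) \<in> borel_measurable (F t)" by measurable
    moreover have "(\<lambda>\<omega>. if ?T \<omega> \<le> t then T1 \<omega> + \<delta> (Y1 \<omega>) else 0) = (\<lambda>\<omega>. if ?T \<omega> \<le> t then ?T \<omega> else 0)"
      using le by (auto simp: T1_def Y1_def)
    moreover have "(\<lambda>\<omega>. if ?T \<omega> \<le> t then b (Y1 \<omega>) + G (Y1 \<omega>) *v (W (min t (T1 \<omega> + \<delta> (Y1 \<omega>))) \<omega> - W (T1 \<omega>) \<omega>) else 0) \<in> borel_measurable (F t)"
      using W1 W2 by measurable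
    moreover have "(\<lambda>\<omega>. if ?T \<omega> \<le> t then b (Y1 \<omega>) + G (Y1 \<omega>) *v (W (min t (T1 \<omega> + \<delta> (Y1 \<omega>))) \<omega> - W (T1 \<omega>) \<omega>) else 0)
        = (\<lambda>\<omega>. if ?T \<omega> \<le> t then ?Y \<omega> else 0)"
      using le by (auto simp: T1_def Y1_def min_absorb2 fun_eq_iff)
    ultimately show ?thesis using A by simp
  qed
  moreover have "0 \<le> ?T \<omega>" if "\<omega> \<in> space M" for \<omega>
    using T0[OF that] \<delta>_pos[of "Y \<omega>"] by linarith
  ultimately show ?thesis by (auto simp: adapted_state_def)
qed

text \<open>
  Both \<open>T\<close> and the length \<open>\<delta>(Y)\<close> of the interval are replaced by their grid approximations.  On each of
  the countably many cells where these are constant, the law of the increment is known conditionally on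
  the past, because the cell belongs to the past of the grid point following \<open>T\<close>.  The mesh then tends
  to 0, which requires a continuous test function.
\<close>

lemma strong_markov_continuous:
  fixes Y :: "'w \<Rightarrow> real ^ 'd" and G :: "real ^ 'd \<Rightarrow> real ^ 'm ^ 'd" and h :: "real ^ 'd \<Rightarrow> real"
  assumes T: "adapted_state T Y" and \<delta>[measurable]: "\<delta> \<in> borel_measurable borel" and \<delta>_pos: "\<And>y. 0 < \<delta> y"
    and b[measurable]: "b \<in> borel_measurable borel" and G[measurable]: "G \<in> borel_measurable borel"
    and E: "E \<in> settled T"
    and h: "continuous_on UNIV h" "\<And>x. 0 \<le> h x \<and> h x \<le> 1"
  shows "(\<integral>\<^sup>+\<omega>. indicator E \<omega> * ennreal (h (b (Y \<omega>) + G (Y \<omega>) *v (W (T \<omega> + \<delta> (Y \<omega>)) \<omega> - W (T \<omega>) \<omega>))) \<partial>M)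
    = (\<integral>\<^sup>+\<omega>. indicator E \<omega> * (\<integral>\<^sup>+z. ennreal (h (b (Y \<omega>) + G (Y \<omega>) *v (sqrt (\<delta> (Y \<omega>)) *\<^sub>R z))) \<partial>std_gauss) \<partial>M)"
proof -
  have hm[measurable]: "h \<in> borel_measurable borel" using h(1) by (rule borel_measurable_continuous_onI)
  have [measurable]: "T \<in> borel_measurable M" "Y \<in> borel_measurable M" using adapted_state_measurable[OF T] by auto
  have E_M[measurable]: "E \<in> sets M" by (rule settled_events[OF T E])
  define H where "H y u = ennreal (h (b y + G y *v u))" for y u
  have H_m[measurable (raw)]: "(\<lambda>x. H (u1 x) (u2 x)) \<in> borel_measurable N"
    if [measurable]: "u1 \<in> borel_measurable N" "u2 \<in> borel_measurable N" for u1 u2 N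
    unfolding H_def by measurable
  have H1: "H y u \<le> 1" for y u using h(2) by (simp add: H_def ennreal_le_1)
  have H_cont: "(\<lambda>k. H y (u k)) \<longlonglongrightarrow> H y v" if "u \<longlonglongrightarrow> v" for y u v
  proof -
    have "continuous_on UNIV (\<lambda>u. h (b y + G y *v u))"
      by (intro continuous_on_compose2[OF h(1)] continuous_intros continuous_on_matrix_vector_mult) auto
    then have "(\<lambda>k. h (b y + G y *v u k)) \<longlonglongrightarrow> h (b y + G y *v v)"
      by (rule continuous_on_tendsto_compose[OF _ that]) auto
    then show ?thesis unfolding H_def by (rule tendsto_ennrealI)
  qed
  define a s where "a k \<omega> = grid_point k (grid_index k (T \<omega>))" and "s k \<omega> = grid_point k (grid_index k (\<delta> (Y \<omega>)))" for k \<omega>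
  have am[measurable]: "a k \<in> borel_measurable M" "s k \<in> borel_measurable M" for k
    unfolding a_def[abs_def] s_def[abs_def] by (auto intro!: measurable_compose_countable[where f = "\<lambda>i _. grid_point k i"])
  have Wt: "W t \<in> borel_measurable M" if "0 \<le> t" for t by (rule measurable_Ft_M[OF that adapted[OF that]])
  define X where "X k \<omega> = (grid_index k (T \<omega>), grid_index k (\<delta> (Y \<omega>)))" for k \<omega>
  have X[measurable]: "X k \<in> M \<rightarrow>\<^sub>M count_space UNIV" for k
  proof (subst measurable_count_space_eq2_countable, safe)
    fix i j
    have "X k -` {(i, j)} \<inter> space M
        = {\<omega>\<in>space M. grid_index k (T \<omega>) = i} \<inter> {\<omega>\<in>space M. grid_index k (\<delta> (Y \<omega>)) = j}"
      by (auto simp: X_def)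
    then show "X k -` {(i, j)} \<inter> space M \<in> sets M" by (simp only:) measurable
  qed auto
  have gp: "0 \<le> grid_point k i" for k i using grid_point_pos[of k i] by simp
  have Wa[measurable]: "(\<lambda>\<omega>. W (a k \<omega>) \<omega>) \<in> borel_measurable M" for k
  proof -
    have "(\<lambda>\<omega>. W (grid_point k (grid_index k (T \<omega>))) \<omega>) \<in> borel_measurable M"
      by (rule measurable_compose_countable[where f = "\<lambda>i \<omega>. W (grid_point k i) \<omega>"]) (use Wt gp in simp, measurable)
    then show ?thesis by (simp add: a_def)
  qed
  have Was[measurable]: "(\<lambda>\<omega>. W (a k \<omega> + s k \<omega>) \<omega>) \<in> borel_measurable M" for k
  proof -
    have "(\<lambda>\<omega>. W (grid_point k (fst (X k \<omega>)) + grid_point k (snd (X k \<omega>))) \<omega>) \<in> borel_measurable M"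
      by (rule measurable_compose_countable[where f = "\<lambda>c \<omega>. W (grid_point k (fst c) + grid_point k (snd c)) \<omega>"])
         (use Wt gp X in \<open>simp_all add: add_nonneg_nonneg\<close>)
    then show ?thesis by (simp add: X_def a_def s_def)
  qed
  have HW[measurable]: "(\<lambda>\<omega>. H (Y \<omega>) (W (a k \<omega> + s k \<omega>) \<omega> - W (a k \<omega>) \<omega>)) \<in> borel_measurable M" for k
    by (rule H_m) measurable
  have discrete: "(\<integral>\<^sup>+\<omega>. indicator E \<omega> * H (Y \<omega>) (W (a k \<omega> + s k \<omega>) \<omega> - W (a k \<omega>) \<omega>) \<partial>M)
      = (\<integral>\<^sup>+\<omega>. indicator E \<omega> * (\<integral>\<^sup>+z. H (Y \<omega>) (sqrt (s k \<omega>) *\<^sub>R z) \<partial>std_gauss) \<partial>M)" for k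
  proof (rule nn_integral_eq_by_cells[OF X[of k]])
    show "(\<lambda>\<omega>. indicator E \<omega> * H (Y \<omega>) (W (a k \<omega> + s k \<omega>) \<omega> - W (a k \<omega>) \<omega>)) \<in> borel_measurable M" by measurable
    show "(\<lambda>\<omega>. indicator E \<omega> * (\<integral>\<^sup>+z. H (Y \<omega>) (sqrt (s k \<omega>) *\<^sub>R z) \<partial>std_gauss)) \<in> borel_measurable M" by measurable
    fix c :: "nat \<times> nat"
    obtain i j where c: "c = (i, j)" by (cases c)
    define u v where "u = grid_point k i" and "v = grid_point k j"
    have u: "0 < u" "0 \<le> u" and v: "0 < v" using grid_point_pos by (auto simp: u_def v_def less_imp_le)
    define T1 where "T1 = (\<lambda>\<omega>. if T \<omega> \<le> u then T \<omega> else 0)"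
    define Y1 where "Y1 = (\<lambda>\<omega>. if T \<omega> \<le> u then Y \<omega> else 0)"
    have m1[measurable]: "T1 \<in> borel_measurable (F u)" "Y1 \<in> borel_measurable (F u)"
      using adapted_stateD(3,4)[OF T u(2)] by (auto simp: T1_def Y1_def)
    define D where "D = {\<omega>\<in>E. T \<omega> \<le> u} \<inter> {\<omega>\<in>space (F u). grid_index k (T1 \<omega>) = i \<and> grid_index k (\<delta> (Y1 \<omega>)) = j}"
    have "{\<omega>\<in>space (F u). grid_index k (T1 \<omega>) = i \<and> grid_index k (\<delta> (Y1 \<omega>)) = j} \<in> sets (F u)"
      by measurable
    moreover have "{\<omega>\<in>E. T \<omega> \<le> u} \<in> sets (F u)" using E u(2) by (auto simp: settled_def)
    ultimately have D[measurable]: "D \<in> sets (F u)" unfolding D_def by (intro sets.Int)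
    have ind: "indicator E \<omega> * indicator {\<omega>. X k \<omega> = c} \<omega> = (indicator D \<omega> :: ennreal)" if \<omega>: "\<omega> \<in> space M" for \<omega>
    proof -
      have "T \<omega> \<le> u" if "grid_index k (T \<omega>) = i"
        using grid_bounds(1)[OF adapted_stateD(1)[OF T \<omega>], of k] that by (simp add: u_def)
      then show ?thesis using \<omega> by (auto simp: D_def X_def c T1_def Y1_def indicator_def space_Ft[OF u(2)])
    qed
    have DX: "a k \<omega> = u" "s k \<omega> = v" "Y \<omega> = Y1 \<omega>" if "\<omega> \<in> D" for \<omega>
      using that by (auto simp: D_def T1_def Y1_def a_def s_def u_def v_def)
    let ?h = "\<lambda>(\<omega>, w). indicator D \<omega> * H (Y1 \<omega>) w"
    have hm': "?h \<in> borel_measurable (F u \<Otimes>\<^sub>M borel)" by measurable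
    have "(\<integral>\<^sup>+\<omega>. indicator E \<omega> * H (Y \<omega>) (W (a k \<omega> + s k \<omega>) \<omega> - W (a k \<omega>) \<omega>) * indicator {\<omega>. X k \<omega> = c} \<omega> \<partial>M)
        = (\<integral>\<^sup>+\<omega>. ?h (\<omega>, W (u + v) \<omega> - W u \<omega>) \<partial>M)"
    proof (rule nn_integral_cong)
      fix \<omega> assume \<omega>: "\<omega> \<in> space M"
      have "indicator E \<omega> * H (Y \<omega>) (W (a k \<omega> + s k \<omega>) \<omega> - W (a k \<omega>) \<omega>) * indicator {\<omega>. X k \<omega> = c} \<omega>
        = indicator D \<omega> * H (Y \<omega>) (W (a k \<omega> + s k \<omega>) \<omega> - W (a k \<omega>) \<omega>)"
        unfolding ind[OF \<omega>, symmetric] by (simp only: mult_ac)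
      then show "indicator E \<omega> * H (Y \<omega>) (W (a k \<omega> + s k \<omega>) \<omega> - W (a k \<omega>) \<omega>) * indicator {\<omega>. X k \<omega> = c} \<omega>
        = ?h (\<omega>, W (u + v) \<omega> - W u \<omega>)"
        using DX by (cases "\<omega> \<in> D") auto
    qed
    also have "\<dots> = (\<integral>\<^sup>+\<omega>. \<integral>\<^sup>+z. ?h (\<omega>, sqrt (u + v - u) *\<^sub>R z) \<partial>std_gauss \<partial>M)"
      using u v by (intro increment_law hm') auto
    also have "\<dots> = (\<integral>\<^sup>+\<omega>. indicator E \<omega> * (\<integral>\<^sup>+z. H (Y \<omega>) (sqrt (s k \<omega>) *\<^sub>R z) \<partial>std_gauss) * indicator {\<omega>. X k \<omega> = c} \<omega> \<partial>M)"
    proof (rule nn_integral_cong)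
      fix \<omega> assume \<omega>: "\<omega> \<in> space M"
      have "indicator E \<omega> * (\<integral>\<^sup>+z. H (Y \<omega>) (sqrt (s k \<omega>) *\<^sub>R z) \<partial>std_gauss) * indicator {\<omega>. X k \<omega> = c} \<omega>
        = indicator D \<omega> * (\<integral>\<^sup>+z. H (Y \<omega>) (sqrt (s k \<omega>) *\<^sub>R z) \<partial>std_gauss)"
        unfolding ind[OF \<omega>, symmetric] by (simp only: mult_ac)
      then show "(\<integral>\<^sup>+z. ?h (\<omega>, sqrt (u + v - u) *\<^sub>R z) \<partial>std_gauss)
        = indicator E \<omega> * (\<integral>\<^sup>+z. H (Y \<omega>) (sqrt (s k \<omega>) *\<^sub>R z) \<partial>std_gauss) * indicator {\<omega>. X k \<omega> = c} \<omega>"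
        using DX by (cases "\<omega> \<in> D") auto
    qed
    finally show "(\<integral>\<^sup>+\<omega>. indicator E \<omega> * H (Y \<omega>) (W (a k \<omega> + s k \<omega>) \<omega> - W (a k \<omega>) \<omega>) * indicator {\<omega>. X k \<omega> = c} \<omega> \<partial>M)
      = (\<integral>\<^sup>+\<omega>. indicator E \<omega> * (\<integral>\<^sup>+z. H (Y \<omega>) (sqrt (s k \<omega>) *\<^sub>R z) \<partial>std_gauss) * indicator {\<omega>. X k \<omega> = c} \<omega> \<partial>M)" .
  qed
  have Y'[measurable]: "(\<lambda>\<omega>. b (Y \<omega>) + G (Y \<omega>) *v (W (T \<omega> + \<delta> (Y \<omega>)) \<omega> - W (T \<omega>) \<omega>)) \<in> borel_measurable M"
    by (rule adapted_state_measurable(2)[OF adapted_state_step[OF T \<delta> \<delta>_pos b G]])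
  have conv_a: "(\<lambda>k. a k \<omega>) \<longlonglongrightarrow> T \<omega>" "0 \<le> a k \<omega>" if "\<omega> \<in> space M" for \<omega> k
    unfolding a_def using adapted_stateD(1)[OF T that] grid_point_pos by (auto intro!: grid_tendsto less_imp_le)
  have conv_s: "(\<lambda>k. s k \<omega>) \<longlonglongrightarrow> \<delta> (Y \<omega>)" "0 \<le> s k \<omega>" for \<omega> k
    unfolding s_def using \<delta>_pos grid_point_pos by (auto intro!: grid_tendsto less_imp_le)
  have L: "(\<lambda>k. \<integral>\<^sup>+\<omega>. indicator E \<omega> * H (Y \<omega>) (W (a k \<omega> + s k \<omega>) \<omega> - W (a k \<omega>) \<omega>) \<partial>M)
    \<longlonglongrightarrow> (\<integral>\<^sup>+\<omega>. indicator E \<omega> * H (Y \<omega>) (W (T \<omega> + \<delta> (Y \<omega>)) \<omega> - W (T \<omega>) \<omega>) \<partial>M)"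
  proof (rule nn_integral_dominated_convergence[where w = "\<lambda>_. 1"])
    show "(\<lambda>\<omega>. indicator E \<omega> * H (Y \<omega>) (W (T \<omega> + \<delta> (Y \<omega>)) \<omega> - W (T \<omega>) \<omega>)) \<in> borel_measurable M"
      unfolding H_def by measurable
    show "AE \<omega> in M. indicator E \<omega> * H (Y \<omega>) (W (a k \<omega> + s k \<omega>) \<omega> - W (a k \<omega>) \<omega>) \<le> 1" for k
      using H1 by (auto simp: indicator_def)
    have "AE \<omega> in M. \<omega> \<notin> bad" by (rule AE_not_in[OF bad(1)])
    then show "AE \<omega> in M. (\<lambda>k. indicator E \<omega> * H (Y \<omega>) (W (a k \<omega> + s k \<omega>) \<omega> - W (a k \<omega>) \<omega>))
        \<longlonglongrightarrow> indicator E \<omega> * H (Y \<omega>) (W (T \<omega> + \<delta> (Y \<omega>)) \<omega> - W (T \<omega>) \<omega>)"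
    proof (rule AE_mp, intro AE_I2 impI)
      fix \<omega> assume \<omega>: "\<omega> \<in> space M" "\<omega> \<notin> bad"
      have "(\<lambda>k. H (Y \<omega>) (W (a k \<omega> + s k \<omega>) \<omega> - W (a k \<omega>) \<omega>)) \<longlonglongrightarrow> H (Y \<omega>) (W (T \<omega> + \<delta> (Y \<omega>)) \<omega> - W (T \<omega>) \<omega>)"
        using conv_a[OF \<omega>(1)] conv_s adapted_stateD(1)[OF T \<omega>(1)] \<delta>_pos[of "Y \<omega>"]
        by (intro H_cont tendsto_diff path_tendsto[OF \<omega>] tendsto_add add_nonneg_nonneg) auto
      then show "(\<lambda>k. indicator E \<omega> * H (Y \<omega>) (W (a k \<omega> + s k \<omega>) \<omega> - W (a k \<omega>) \<omega>))
        \<longlonglongrightarrow> indicator E \<omega> * H (Y \<omega>) (W (T \<omega> + \<delta> (Y \<omega>)) \<omega> - W (T \<omega>) \<omega>)"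
        by (cases "\<omega> \<in> E") auto
    qed
  qed (auto simp: emeasure_space_1)
  have R: "(\<lambda>k. \<integral>\<^sup>+\<omega>. indicator E \<omega> * (\<integral>\<^sup>+z. H (Y \<omega>) (sqrt (s k \<omega>) *\<^sub>R z) \<partial>std_gauss) \<partial>M)
    \<longlonglongrightarrow> (\<integral>\<^sup>+\<omega>. indicator E \<omega> * (\<integral>\<^sup>+z. H (Y \<omega>) (sqrt (\<delta> (Y \<omega>)) *\<^sub>R z) \<partial>std_gauss) \<partial>M)"
  proof (rule nn_integral_dominated_convergence[where w = "\<lambda>_. 1"])
    have prob1: "(\<integral>\<^sup>+z. 1 \<partial>(std_gauss :: (real ^ 'm) measure)) = 1"
      using prob_space.emeasure_space_1[OF prob_space_std_gauss] by simp
    have "(\<integral>\<^sup>+z. H (Y \<omega>) (sqrt (s k \<omega>) *\<^sub>R z) \<partial>std_gauss) \<le> (\<integral>\<^sup>+z. 1 \<partial>(std_gauss :: (real ^ 'm) measure))" for k \<omega>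
      by (intro nn_integral_mono H1)
    then show "AE \<omega> in M. indicator E \<omega> * (\<integral>\<^sup>+z. H (Y \<omega>) (sqrt (s k \<omega>) *\<^sub>R z) \<partial>std_gauss) \<le> 1" for k
      unfolding prob1 by (auto simp: indicator_def)
    show "AE \<omega> in M. (\<lambda>k. indicator E \<omega> * (\<integral>\<^sup>+z. H (Y \<omega>) (sqrt (s k \<omega>) *\<^sub>R z) \<partial>std_gauss))
      \<longlonglongrightarrow> indicator E \<omega> * (\<integral>\<^sup>+z. H (Y \<omega>) (sqrt (\<delta> (Y \<omega>)) *\<^sub>R z) \<partial>std_gauss)"
    proof (intro AE_I2)
      fix \<omega>
      have "(\<lambda>k. \<integral>\<^sup>+z. H (Y \<omega>) (sqrt (s k \<omega>) *\<^sub>R z) \<partial>std_gauss) \<longlonglongrightarrow> (\<integral>\<^sup>+z. H (Y \<omega>) (sqrt (\<delta> (Y \<omega>)) *\<^sub>R z) \<partial>std_gauss)"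
      proof (rule nn_integral_dominated_convergence[where w = "\<lambda>_. 1"])
        show "AE z in std_gauss. (\<lambda>k. H (Y \<omega>) (sqrt (s k \<omega>) *\<^sub>R z)) \<longlonglongrightarrow> H (Y \<omega>) (sqrt (\<delta> (Y \<omega>)) *\<^sub>R z)"
          by (intro AE_I2 H_cont tendsto_scaleR tendsto_real_sqrt conv_s tendsto_const)
      qed (use H1 prob1 in auto)
      then show "(\<lambda>k. indicator E \<omega> * (\<integral>\<^sup>+z. H (Y \<omega>) (sqrt (s k \<omega>) *\<^sub>R z) \<partial>std_gauss))
        \<longlonglongrightarrow> indicator E \<omega> * (\<integral>\<^sup>+z. H (Y \<omega>) (sqrt (\<delta> (Y \<omega>)) *\<^sub>R z) \<partial>std_gauss)"
        by (cases "\<omega> \<in> E") auto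
    qed
  qed (auto simp: emeasure_space_1)
  show ?thesis
    using LIMSEQ_unique[OF L[unfolded discrete] R] unfolding H_def .
qed

end

section \<open>The Markov property of the scheme\<close>

lemma em_transition_kernel [measurable]:
  fixes f :: "real ^ 'd \<Rightarrow> real ^ 'd" and g :: "real ^ 'd \<Rightarrow> real ^ 'm ^ 'd"
  assumes [measurable]: "f \<in> borel_measurable borel" "g \<in> borel_measurable borel" "\<delta> \<in> borel_measurable borel"
  shows "em_transition f g \<delta> \<in> borel \<rightarrow>\<^sub>M prob_algebra borel"
  unfolding em_transition_def[abs_def]
proof (rule measurable_distr_prob_space2[where M = borel])
  show "(\<lambda>_. std_gauss) \<in> borel \<rightarrow>\<^sub>M prob_algebra borel"
    by (simp add: space_prob_algebra prob_space_std_gauss)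
  show "(\<lambda>(x, z). x + \<delta> x *\<^sub>R f x + g x *v (sqrt (\<delta> x) *\<^sub>R z)) \<in> borel \<Otimes>\<^sub>M borel \<rightarrow>\<^sub>M borel"
    by measurable
qed

context brownian_motion
begin

lemma strong_markov:
  fixes Y :: "'w \<Rightarrow> real ^ 'd" and f :: "real ^ 'd \<Rightarrow> real ^ 'd" and g :: "real ^ 'd \<Rightarrow> real ^ 'm ^ 'd"
  assumes T: "adapted_state T Y" and \<delta>_pos: "\<And>y. 0 < \<delta> y"
    and meas[measurable]: "f \<in> borel_measurable borel" "g \<in> borel_measurable borel" "\<delta> \<in> borel_measurable borel"
    and E: "E \<in> settled T" and h: "h \<in> borel_measurable borel"
  defines "Y' \<equiv> \<lambda>\<omega>. Y \<omega> + \<delta> (Y \<omega>) *\<^sub>R f (Y \<omega>) + g (Y \<omega>) *v (W (T \<omega> + \<delta> (Y \<omega>)) \<omega> - W (T \<omega>) \<omega>)"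
  shows "(\<integral>\<^sup>+\<omega>. indicator E \<omega> * h (Y' \<omega>) \<partial>M) = (\<integral>\<^sup>+\<omega>. indicator E \<omega> * (\<integral>\<^sup>+y. h y \<partial>em_transition f g \<delta> (Y \<omega>)) \<partial>M)"
proof -
  let ?D = "density M (indicator E)"
  let ?Q = "\<lambda>\<omega>. em_transition f g \<delta> (Y \<omega>)"
  have b: "(\<lambda>y. y + \<delta> y *\<^sub>R f y) \<in> borel_measurable borel" by measurable
  have E_M[measurable]: "E \<in> sets M" by (rule settled_events[OF T E])
  have Y: "Y \<in> borel_measurable M" by (rule adapted_state_measurable[OF T])
  have Y'[measurable]: "Y' \<in> borel_measurable M"
    unfolding Y'_def by (rule adapted_state_measurable(2)[OF adapted_state_step[OF T meas(3) \<delta>_pos b meas(2)]])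
  have Q: "?Q \<in> M \<rightarrow>\<^sub>M subprob_algebra borel"
    by (rule measurable_compose[OF Y measurable_prob_algebraD[OF em_transition_kernel[OF meas]]])
  then have QD: "?Q \<in> ?D \<rightarrow>\<^sub>M subprob_algebra borel" by simp
  have fin: "finite_measure ?D"
    using emeasure_space_1 by (intro finite_measureI) (simp add: emeasure_density less_top[symmetric] emeasure_eq_measure)
  have int1: "(\<integral>\<^sup>+y. k y \<partial>distr ?D borel Y') = (\<integral>\<^sup>+\<omega>. indicator E \<omega> * k (Y' \<omega>) \<partial>M)"
    if [measurable]: "k \<in> borel_measurable borel" for k :: "real ^ 'd \<Rightarrow> ennreal"
    by (subst nn_integral_distr) (auto simp: nn_integral_density)
  have int2: "(\<integral>\<^sup>+y. k y \<partial>(?D \<bind> ?Q)) = (\<integral>\<^sup>+\<omega>. indicator E \<omega> * (\<integral>\<^sup>+y. k y \<partial>?Q \<omega>) \<partial>M)"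
    if k: "k \<in> borel_measurable borel" for k :: "real ^ 'd \<Rightarrow> ennreal"
  proof -
    have "(\<lambda>\<omega>. \<integral>\<^sup>+y. k y \<partial>?Q \<omega>) \<in> borel_measurable M"
      using nn_integral_measurable_subprob_algebra[OF k] Q by (rule measurable_compose[rotated])
    then show ?thesis by (subst nn_integral_bind[OF k QD]) (simp add: nn_integral_density)
  qed
  have "distr ?D borel Y' = ?D \<bind> ?Q"
  proof (rule finite_measure_eqI_continuous)
    show "sets (distr ?D borel Y') = sets borel" by simp
    show sb: "sets (?D \<bind> ?Q) = sets borel" by (rule sets_bind_measurable[OF QD]) (simp add: not_empty)
    show "finite_measure (distr ?D borel Y')" using fin by (rule finite_measure.finite_measure_distr) simp
    show "finite_measure (?D \<bind> ?Q)"
    proof (rule finite_measureI)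
      have "emeasure (?D \<bind> ?Q) (space (?D \<bind> ?Q)) = (\<integral>\<^sup>+y. 1 \<partial>(?D \<bind> ?Q))" by simp
      also have "\<dots> = (\<integral>\<^sup>+\<omega>. indicator E \<omega> * (\<integral>\<^sup>+y. 1 \<partial>?Q \<omega>) \<partial>M)" by (rule int2) simp
      also have "\<dots> \<le> (\<integral>\<^sup>+\<omega>. 1 \<partial>M)"
      proof (rule nn_integral_mono)
        fix \<omega> assume "\<omega> \<in> space M"
        then have "emeasure (?Q \<omega>) (space (?Q \<omega>)) \<le> 1"
          using measurable_space[OF Q] by (intro subprob_space.emeasure_space_le_1) (auto simp: space_subprob_algebra)
        then show "indicator E \<omega> * (\<integral>\<^sup>+y. 1 \<partial>?Q \<omega>) \<le> 1" by (auto simp: indicator_def)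
      qed
      finally show "emeasure (?D \<bind> ?Q) (space (?D \<bind> ?Q)) \<noteq> \<infinity>"
        by (auto simp: emeasure_space_1 top_unique)
    qed
    fix k :: "real ^ 'd \<Rightarrow> real" assume k: "continuous_on UNIV k" "\<And>x. 0 \<le> k x \<and> k x \<le> 1"
    have km[measurable]: "k \<in> borel_measurable borel" using k(1) by (rule borel_measurable_continuous_onI)
    have kem: "(\<lambda>y. ennreal (k y)) \<in> borel_measurable borel" by measurable
    have "(\<integral>\<^sup>+y. ennreal (k y) \<partial>?Q \<omega>) = (\<integral>\<^sup>+z. ennreal (k (Y \<omega> + \<delta> (Y \<omega>) *\<^sub>R f (Y \<omega>) + g (Y \<omega>) *v (sqrt (\<delta> (Y \<omega>)) *\<^sub>R z))) \<partial>std_gauss)" for \<omega>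
      unfolding em_transition_def by (rule nn_integral_distr) measurable
    then show "(\<integral>\<^sup>+y. ennreal (k y) \<partial>distr ?D borel Y') = (\<integral>\<^sup>+y. ennreal (k y) \<partial>(?D \<bind> ?Q))"
      using strong_markov_continuous[OF T meas(3) \<delta>_pos b meas(2) E k] int1[OF kem] int2[OF kem]
      by (simp add: Y'_def)
  qed
  then show ?thesis using int1[OF h] int2[OF h] by simp
qed

end

locale euler_maruyama = brownian_motion M F W
  for M :: "'w measure" and F :: "real \<Rightarrow> 'w measure" and W :: "real \<Rightarrow> 'w \<Rightarrow> real ^ 'm" +
  fixes f :: "real ^ 'd \<Rightarrow> real ^ 'd" and g :: "real ^ 'd \<Rightarrow> real ^ 'm ^ 'd" and \<delta> :: "real ^ 'd \<Rightarrow> real"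
  assumes f_meas: "f \<in> borel_measurable borel" and g_meas: "g \<in> borel_measurable borel"
    and \<delta>_meas: "\<delta> \<in> borel_measurable borel" and \<delta>_pos: "\<And>x. 0 < \<delta> x"
begin

lemmas Q_kernel = em_transition_kernel[OF f_meas g_meas \<delta>_meas]

abbreviation Q where "Q \<equiv> em_transition f g \<delta>"
abbreviation X where "X \<equiv> em_value f g \<delta> W"

definition em_time :: "real ^ 'd \<Rightarrow> nat \<Rightarrow> 'w \<Rightarrow> real" where
  "em_time x0 n \<omega> = fst (adaptive_em f g \<delta> W x0 n \<omega>)"

lemma em_time_Suc: "em_time x0 (Suc n) = (\<lambda>\<omega>. em_time x0 n \<omega> + \<delta> (X x0 n \<omega>))"
  by (simp add: em_time_def em_value_def Let_def split_beta fun_eq_iff)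

lemma em_value_Suc: "X x0 (Suc n) = (\<lambda>\<omega>. X x0 n \<omega> + \<delta> (X x0 n \<omega>) *\<^sub>R f (X x0 n \<omega>)
    + g (X x0 n \<omega>) *v (W (em_time x0 n \<omega> + \<delta> (X x0 n \<omega>)) \<omega> - W (em_time x0 n \<omega>) \<omega>))"
  by (simp add: em_time_def em_value_def Let_def split_beta fun_eq_iff)

lemma em_adapted: "adapted_state (em_time x0 n) (X x0 n)"
proof (induction n)
  case 0
  have "{\<omega> \<in> space M. 0 \<le> t} \<in> sets (F t)" if "0 \<le> t" for t
    using that sets.top[of "F t"] by (simp add: space_Ft)
  then show ?case by (auto simp: adapted_state_def em_time_def em_value_def)
next
  case (Suc n)
  have "(\<lambda>y. y + \<delta> y *\<^sub>R f y) \<in> borel_measurable borel"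
    using f_meas \<delta>_meas by measurable
  from adapted_state_step[OF Suc \<delta>_meas \<delta>_pos this g_meas] show ?case
    unfolding em_time_Suc em_value_Suc .
qed

lemma em_value_measurable: "X x0 n \<in> borel_measurable M"
  by (rule adapted_state_measurable[OF em_adapted])

lemma em_time_mono: "i \<le> n \<Longrightarrow> em_time x0 i \<omega> \<le> em_time x0 n \<omega>"
  by (induction n) (auto simp: le_Suc_eq em_time_Suc intro: order_trans less_imp_le[OF \<delta>_pos] add_increasing2)

text \<open>
  The step kernel is split off at the front, \<open>P\<^sup>k\<^sup>+\<^sup>1 = P P\<^sup>k\<close>, so that the induction advances the time
  \<open>n\<close> while the event \<open>E\<close> stays in the past.
\<close>

lemma em_markov:
  assumes E: "E \<in> settled (em_time x0 n)" and A: "A \<in> sets borel"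
  shows "emeasure M (E \<inter> X x0 (n + k) -` A) = (\<integral>\<^sup>+\<omega>. indicator E \<omega> * emeasure (kernel_power borel Q k (X x0 n \<omega>)) A \<partial>M)"
  using E
proof (induction k arbitrary: n)
  case 0
  have "E \<in> sets M" by (rule settled_events[OF em_adapted 0])
  then have "E \<inter> X x0 n -` A \<in> sets M"
    using measurable_sets[OF em_value_measurable A, of x0 n] sets.sets_into_space[of E M]
    by (metis (no_types, lifting) Int_assoc Int_absorb2 Int_commute sets.Int)
  then have "emeasure M (E \<inter> X x0 n -` A) = (\<integral>\<^sup>+\<omega>. indicator (E \<inter> X x0 n -` A) \<omega> \<partial>M)" by simp
  also have "\<dots> = (\<integral>\<^sup>+\<omega>. indicator E \<omega> * emeasure (kernel_power borel Q 0 (X x0 n \<omega>)) A \<partial>M)"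
    using A by (intro nn_integral_cong) (simp add: indicator_def)
  finally show ?case by simp
next
  case (Suc k)
  have E': "E \<in> settled (em_time x0 (Suc n))"
    by (rule settled_mono[OF em_adapted _ Suc.prems]) (rule em_time_mono, simp)
  let ?h = "\<lambda>y. emeasure (kernel_power borel Q k y) A"
  have hm: "?h \<in> borel_measurable borel"
    using A by (intro measurable_emeasure_kernel[OF measurable_prob_algebraD[OF kernel_power_measurable[OF Q_kernel]]])
  have "emeasure M (E \<inter> X x0 (n + Suc k) -` A) = (\<integral>\<^sup>+\<omega>. indicator E \<omega> * ?h (X x0 (Suc n) \<omega>) \<partial>M)"
    using Suc.IH[OF E'] by simp
  also have "\<dots> = (\<integral>\<^sup>+\<omega>. indicator E \<omega> * (\<integral>\<^sup>+y. ?h y \<partial>Q (X x0 n \<omega>)) \<partial>M)"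
    unfolding em_value_Suc by (rule strong_markov[OF em_adapted \<delta>_pos f_meas g_meas \<delta>_meas Suc.prems hm])
  also have "\<dots> = (\<integral>\<^sup>+\<omega>. indicator E \<omega> * emeasure (kernel_power borel Q (Suc k) (X x0 n \<omega>)) A \<partial>M)"
    using emeasure_kernel_power_Suc[OF Q_kernel _ A] by (simp del: kernel_power.simps)
  finally show ?case .
qed

lemma em_kernel_eq: "em_kernel f g \<delta> W M k x = kernel_power borel Q k x"
proof (rule measure_eqI)
  have K: "kernel_power borel Q k x \<in> space (prob_algebra borel)"
    by (rule measurable_space[OF kernel_power_measurable[OF Q_kernel]]) simp
  show "sets (em_kernel f g \<delta> W M k x) = sets (kernel_power borel Q k x)"
    using prob_algebraD[OF K] by (simp add: em_kernel_def)
  fix A assume "A \<in> sets (em_kernel f g \<delta> W M k x)"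
  then have A: "A \<in> sets borel" by (simp add: em_kernel_def)
  have "emeasure (em_kernel f g \<delta> W M k x) A = emeasure M (space M \<inter> X x (0 + k) -` A)"
    unfolding em_kernel_def using A em_value_measurable by (simp add: emeasure_distr Int_commute)
  also have "\<dots> = (\<integral>\<^sup>+\<omega>. indicator (space M) \<omega> * emeasure (kernel_power borel Q k (X x 0 \<omega>)) A \<partial>M)"
    by (rule em_markov[OF settled_space[OF em_adapted] A])
  also have "\<dots> = (\<integral>\<^sup>+\<omega>. emeasure (kernel_power borel Q k x) A \<partial>M)"
    by (intro nn_integral_cong) (simp add: em_value_def)
  finally show "emeasure (em_kernel f g \<delta> W M k x) A = emeasure (kernel_power borel Q k x) A"
    by (simp add: emeasure_space_1)
qed

text \<open>
  The history of the chain belongs to the past of \<open>W\<close> up to the current time, because the times \<open>t\<^sub>n\<close> are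
  increasing.
\<close>

lemma natural_sigma_settled:
  assumes "G \<in> sets (natural_sigma M (X x0) n)"
  shows "G \<in> settled (em_time x0 n)"
proof -
  have "(\<Union>i\<le>n. {X x0 i -` A \<inter> space M |A. A \<in> sets borel}) \<subseteq> Pow (space M)" by auto
  then have "G \<in> sigma_sets (space M) (\<Union>i\<le>n. {X x0 i -` A \<inter> space M |A. A \<in> sets borel})"
    using assms by (simp add: natural_sigma_def)
  then show ?thesis
  proof induction
    case (Basic G)
    then obtain i A where "i \<le> n" "A \<in> sets borel" "G = X x0 i -` A \<inter> space M" by auto
    then show ?case
      using settled_mono[OF em_adapted _ settled_state_event[OF em_adapted]] em_time_mono by blast
  next
    case Empty
    show ?case by (simp add: settled_def)
  next
    case (Compl G)
    then show ?case by (intro settled_Diff[OF em_adapted])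
  next
    case (Union G)
    then show ?case by (intro settled_UN)
  qed
qed

lemma em_homogeneous_markov_chain: "homogeneous_markov_chain M (X x0) (em_kernel f g \<delta> W M)"
  unfolding homogeneous_markov_chain_def
proof (intro conjI allI ballI)
  have K: "em_kernel f g \<delta> W M k \<in> borel \<rightarrow>\<^sub>M prob_algebra borel" for k
    unfolding em_kernel_eq[abs_def] using kernel_power_measurable[OF Q_kernel, of k] by simp
  then show "em_kernel f g \<delta> W M k \<in> borel \<rightarrow>\<^sub>M prob_algebra borel" for k .
  show "X x0 n \<in> borel_measurable M" for n by (rule em_value_measurable)
  fix n k and A :: "(real ^ 'd) set" assume A[measurable]: "A \<in> sets borel"
  let ?G = "natural_sigma M (X x0) n"
  let ?f = "indicator (X x0 (n + k) -` A \<inter> space M) :: 'w \<Rightarrow> real"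
  let ?k = "\<lambda>\<omega>. measure (em_kernel f g \<delta> W M k (X x0 n \<omega>)) A"
  have gen: "(\<Union>i\<le>n. {X x0 i -` A \<inter> space M |A. A \<in> sets borel}) \<subseteq> Pow (space M)" by auto
  have space_G: "space ?G = space M" by (simp add: natural_sigma_def space_measure_of[OF gen])
  have sets_G: "sets ?G = sigma_sets (space M) (\<Union>i\<le>n. {X x0 i -` A \<inter> space M |A. A \<in> sets borel})"
    by (simp add: natural_sigma_def sets_measure_of[OF gen])
  have sub: "subalgebra M ?G"
    using settled_events[OF em_adapted natural_sigma_settled] by (auto simp: subalgebra_def space_G)
  interpret G: finite_measure_subalgebra M ?G by standard (rule sub)
  have XG: "X x0 n \<in> ?G \<rightarrow>\<^sub>M borel"
    by (rule measurableI) (auto simp: space_G sets_G)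
  have kG: "?k \<in> borel_measurable ?G"
    using measurable_compose[OF XG measurable_prob_algebraD[OF K]] A by measurable
  have kM: "?k \<in> borel_measurable M"
    using measurable_compose[OF em_value_measurable measurable_prob_algebraD[OF K]] A by measurable
  have k1: "?k \<omega> \<le> 1" for \<omega>
    using measurable_space[OF K, of "X x0 n \<omega>" k] by (intro prob_space.prob_le_1) (simp add: space_prob_algebra)
  have fset: "X x0 (n + k) -` A \<inter> space M \<in> sets M" by (rule measurable_sets[OF em_value_measurable A])
  show "AE \<omega> in M. real_cond_exp M ?G ?f \<omega> = ?k \<omega>"
  proof (rule G.real_cond_exp_charact)
    show "integrable M ?f" using fset by (simp add: emeasure_eq_measure)
    show ki: "integrable M ?k" using k1 kM by (intro integrable_const_bound[of _ 1]) auto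
    show "?k \<in> borel_measurable ?G" by (rule kG)
    fix E assume "E \<in> sets ?G"
    then have E: "E \<in> settled (em_time x0 n)" by (rule natural_sigma_settled)
    have E_M: "E \<in> sets M" by (rule settled_events[OF em_adapted E])
    have EM: "E \<inter> space M = E" using sets.sets_into_space[OF E_M] by auto
    have "(\<integral>\<omega>\<in>E. ?f \<omega> \<partial>M) = (\<integral>\<omega>. indicator (E \<inter> (X x0 (n + k) -` A \<inter> space M)) \<omega> \<partial>M)"
      unfolding set_lebesgue_integral_def by (intro Bochner_Integration.integral_cong) (auto simp: indicator_def)
    also have "\<dots> = measure M (E \<inter> X x0 (n + k) -` A)"
      using EM by (simp add: Int_assoc[symmetric] Int_commute Int_left_commute)
    finally have l: "(\<integral>\<omega>\<in>E. ?f \<omega> \<partial>M) = measure M (E \<inter> X x0 (n + k) -` A)" .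
    have "ennreal (\<integral>\<omega>\<in>E. ?k \<omega> \<partial>M) = (\<integral>\<^sup>+\<omega>. ennreal (indicator E \<omega> * ?k \<omega>) \<partial>M)"
      unfolding set_lebesgue_integral_def real_scaleR_def
      using integrable_mult_indicator[OF E_M ki] by (intro nn_integral_eq_integral[symmetric]) auto
    also have "\<dots> = (\<integral>\<^sup>+\<omega>. indicator E \<omega> * emeasure (kernel_power borel Q k (X x0 n \<omega>)) A \<partial>M)"
    proof (rule nn_integral_cong)
      fix \<omega>
      have "finite_measure (em_kernel f g \<delta> W M k (X x0 n \<omega>))"
        using measurable_space[OF K, of "X x0 n \<omega>" k] by (simp add: space_prob_algebra prob_space_def)
      then show "ennreal (indicator E \<omega> * ?k \<omega>) = indicator E \<omega> * emeasure (kernel_power borel Q k (X x0 n \<omega>)) A"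
        by (simp add: em_kernel_eq finite_measure.emeasure_eq_measure ennreal_mult ennreal_indicator)
    qed
    also have "\<dots> = ennreal (measure M (E \<inter> X x0 (n + k) -` A))"
      using em_markov[OF E A, of k] by (simp add: emeasure_eq_measure)
    finally have "(\<integral>\<omega>\<in>E. ?k \<omega> \<partial>M) = measure M (E \<inter> X x0 (n + k) -` A)"
      by (subst (asm) ennreal_inj) (auto simp: set_lebesgue_integral_def intro!: integral_nonneg_AE)
    with l show "(\<integral>\<omega>\<in>E. ?f \<omega> \<partial>M) = (\<integral>\<omega>\<in>E. ?k \<omega> \<partial>M)" by simp
  qed
qed

end

section \<open>The adaptive scheme satisfies drift and minorization\<close>

lemma continuous_on_if_locally_lipschitz:
  fixes f :: "'a::real_normed_vector \<Rightarrow> 'b::real_normed_vector"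
  assumes "\<And>R. R > 0 \<Longrightarrow> \<exists>C>0. \<forall>x y. max (norm x) (norm y) \<le> R \<longrightarrow> norm (f x - f y) \<le> C * norm (x - y)"
  shows "continuous_on UNIV f"
  unfolding continuous_on_iff
proof (intro ballI allI impI)
  fix x :: 'a and e :: real assume e: "0 < e"
  have "0 < norm x + 1" by (simp add: add_nonneg_pos)
  from assms[OF this] obtain C where C: "0 < C"
    "\<And>u v. max (norm u) (norm v) \<le> norm x + 1 \<Longrightarrow> norm (f u - f v) \<le> C * norm (u - v)" by blast
  show "\<exists>d>0. \<forall>x'\<in>UNIV. dist x' x < d \<longrightarrow> dist (f x') (f x) < e"
  proof (intro exI[of _ "min 1 (e / C)"] conjI ballI impI)
    show "0 < min 1 (e / C)" using e C by simp
    fix x' assume d: "dist x' x < min 1 (e / C)"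
    have "norm x' \<le> norm x + norm (x' - x)" by (rule norm_triangle_sub)
    then have "max (norm x') (norm x) \<le> norm x + 1" using d by (simp add: dist_norm)
    then have "norm (f x' - f x) \<le> C * norm (x' - x)" by (rule C(2))
    also have "\<dots> < C * (e / C)" using d C by (intro mult_strict_left_mono) (auto simp: dist_norm)
    finally show "dist (f x') (f x) < e" using C by (simp add: dist_norm)
  qed
qed

lemma loewner_le_norm:
  fixes G :: "real ^ 'm ^ 'd"
  assumes "loewner_le (\<kappa> *\<^sub>R mat 1) (G ** transpose G)"
  shows "\<kappa> * (norm v)\<^sup>2 \<le> (norm (transpose G *v v))\<^sup>2"
proof -
  have "0 \<le> v \<bullet> ((G ** transpose G - \<kappa> *\<^sub>R mat 1) *v v)" using assms by (simp add: loewner_le_def)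
  also have "(G ** transpose G - \<kappa> *\<^sub>R mat 1) *v v = G *v (transpose G *v v) - \<kappa> *\<^sub>R v"
    by (simp only: matrix_vector_mult_diff_rdistrib matrix_vector_mul_assoc scaleR_matrix_vector_assoc[symmetric] matrix_vector_mul_lid)
  also have "v \<bullet> (G *v (transpose G *v v) - \<kappa> *\<^sub>R v) = (norm (transpose G *v v))\<^sup>2 - \<kappa> * (norm v)\<^sup>2"
    by (simp add: inner_diff_right dot_lmul_matrix[symmetric] power2_norm_eq_inner)
  finally show ?thesis by simp
qed

lemma em_transition_affine:
  "em_transition f g \<delta> x = distr std_gauss borel (\<lambda>z. (x + \<delta> x *\<^sub>R f x) + (sqrt (\<delta> x) *\<^sub>R g x) *v z)"
  unfolding em_transition_def by (simp add: matrix_vector_mult_scaleR scaleR_matrix_vector_assoc)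

lemma em_elliptic:
  assumes "0 < \<delta> x" "loewner_le (\<kappa> *\<^sub>R mat 1) (g x ** transpose (g x))"
  shows "\<delta> x * \<kappa> * (norm v)\<^sup>2 \<le> (norm (transpose (sqrt (\<delta> x) *\<^sub>R g x) *v v))\<^sup>2"
proof -
  have "transpose (sqrt (\<delta> x) *\<^sub>R g x) *v v = sqrt (\<delta> x) *\<^sub>R (transpose (g x) *v v)"
    by (simp only: transpose_scalar scaleR_matrix_vector_assoc)
  then have "(norm (transpose (sqrt (\<delta> x) *\<^sub>R g x) *v v))\<^sup>2 = \<delta> x * (norm (transpose (g x) *v v))\<^sup>2"
    using assms(1) by (simp only: norm_scaleR power_mult_distrib) simp
  then show ?thesis
    using mult_left_mono[OF loewner_le_norm[OF assms(2), of v], of "\<delta> x"] assms(1) by (simp add: mult.assoc)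
qed

text \<open>
  On a ball the drift and diffusion terms are bounded and \<open>\<delta>\<close> is bounded away from 0, so that the
  constants of \<open>affine_gauss_minorization\<close> can be chosen uniformly.
\<close>

lemma em_minorization:
  fixes f :: "real ^ 'd \<Rightarrow> real ^ 'd" and g :: "real ^ 'd \<Rightarrow> real ^ 'm ^ 'd" and \<delta> :: "real ^ 'd \<Rightarrow> real"
  assumes cont: "continuous_on UNIV f" "continuous_on UNIV g" "continuous_on UNIV \<delta>"
    and \<delta>_pos: "\<And>x. 0 < \<delta> x" and \<kappa>: "0 < \<kappa>"
    and ell: "\<And>x. loewner_le (\<kappa> *\<^sub>R mat 1) (g x ** transpose (g x))" and \<rho>: "0 < \<rho>"
  obtains c where "0 < c" "\<And>x A. norm x \<le> \<rho> \<Longrightarrow> A \<in> sets borel \<Longrightarrow>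
    ennreal c * emeasure lborel (A \<inter> cball 0 \<rho>) \<le> emeasure (em_transition f g \<delta> x) A"
proof -
  have cont': "continuous_on (cball 0 \<rho>) f" "continuous_on (cball 0 \<rho>) g" "continuous_on (cball 0 \<rho>) \<delta>"
    using cont continuous_on_subset by blast+
  have "\<exists>x0\<in>cball 0 \<rho>. \<forall>x\<in>cball 0 \<rho>. \<delta> x0 \<le> \<delta> x"
    using \<rho> by (intro continuous_attains_inf cont') auto
  then obtain x0 where "\<forall>x\<in>cball 0 \<rho>. \<delta> x0 \<le> \<delta> x" by blast
  then have x0: "\<delta> x0 \<le> \<delta> x" if "norm x \<le> \<rho>" for x using that by simp
  let ?K = "\<lambda>x. norm (x + \<delta> x *\<^sub>R f x) + norm (sqrt (\<delta> x) *\<^sub>R g x)"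
  have "bounded (?K ` cball 0 \<rho>)"
    by (intro compact_imp_bounded compact_continuous_image continuous_intros cont') simp
  then obtain K where "\<forall>v\<in>?K ` cball 0 \<rho>. norm v \<le> K" unfolding bounded_iff by blast
  then have "norm (?K x) \<le> K" if "norm x \<le> \<rho>" for x using that by simp
  then have K: "?K x \<le> K" if "norm x \<le> \<rho>" for x using that abs_ge_self[of "?K x"] unfolding real_norm_def by (meson order_trans)
  have "0 \<le> ?K 0" by (intro add_nonneg_nonneg) auto
  also have "\<dots> \<le> K" using \<rho> by (intro K) simp
  finally have r: "0 < \<rho> + K" using \<rho> by simp
  have "0 < \<delta> x0 * \<kappa>" using \<delta>_pos \<kappa> by simp
  from affine_gauss_minorization[OF this r, of \<rho>]
  obtain c where c: "0 < c" "\<And>(B :: real ^ 'm ^ 'd) b A. A \<in> sets borel \<Longrightarrow>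
      (\<And>v. \<delta> x0 * \<kappa> * (norm v)\<^sup>2 \<le> (norm (transpose B *v v))\<^sup>2) \<Longrightarrow>
      (\<And>z a. norm z \<le> 1 \<Longrightarrow> norm a \<le> \<rho> \<Longrightarrow> norm (a - (b + B *v z)) \<le> \<rho> + K) \<Longrightarrow>
      ennreal c * emeasure lborel (A \<inter> cball 0 \<rho>) \<le> emeasure (distr std_gauss borel (\<lambda>z. b + B *v z)) A"
    by blast
  show thesis
  proof (rule that[OF c(1)])
    fix x :: "real ^ 'd" and A :: "(real ^ 'd) set"
    assume x: "norm x \<le> \<rho>" and A: "A \<in> sets borel"
    show "ennreal c * emeasure lborel (A \<inter> cball 0 \<rho>) \<le> emeasure (em_transition f g \<delta> x) A"
      unfolding em_transition_affine
    proof (rule c(2)[OF A])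
      fix v :: "real ^ 'd"
      have "\<delta> x0 * \<kappa> * (norm v)\<^sup>2 \<le> \<delta> x * \<kappa> * (norm v)\<^sup>2" using x0[OF x] \<kappa> by (intro mult_right_mono) auto
      also have "\<dots> \<le> (norm (transpose (sqrt (\<delta> x) *\<^sub>R g x) *v v))\<^sup>2" by (rule em_elliptic[where \<delta> = \<delta> and g = g and x = x and \<kappa> = \<kappa>, OF \<delta>_pos ell])
      finally show "\<delta> x0 * \<kappa> * (norm v)\<^sup>2 \<le> (norm (transpose (sqrt (\<delta> x) *\<^sub>R g x) *v v))\<^sup>2" .
    next
      fix z :: "real ^ 'm" and a :: "real ^ 'd" assume z: "norm z \<le> 1" and a: "norm a \<le> \<rho>"
      let ?b = "x + \<delta> x *\<^sub>R f x" and ?B = "sqrt (\<delta> x) *\<^sub>R g x"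
      have "norm (?B *v z) \<le> norm ?B * 1"
        using norm_matrix_vector_le[of ?B z] mult_left_mono[OF z norm_ge_zero[of ?B]] by linarith
      then show "norm (a - (?b + ?B *v z)) \<le> \<rho> + K"
        using K[OF x] a norm_triangle_ineq4[of a "?b + ?B *v z"] norm_triangle_ineq[of ?b "?B *v z"] by linarith
    qed
  qed
qed

text \<open>
  A set that is charged by some irreducibility measure is reached from the origin, hence is not a
  Lebesgue null set.
\<close>

lemma irreducible_imp_lborel_maximal:
  fixes K :: "nat \<Rightarrow> real ^ 'd \<Rightarrow> (real ^ 'd) measure"
  assumes irr: "irreducible_wrt lborel K"
    and ac: "\<And>n x A. 1 \<le> n \<Longrightarrow> A \<in> null_sets lborel \<Longrightarrow> emeasure (K n x) A = 0"
  shows "maximal_irreducibility_measure lborel K"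
proof -
  have dom: "absolutely_continuous lborel \<phi>" if \<phi>: "sets \<phi> = sets borel" "irreducible_wrt \<phi> K" for \<phi>
    unfolding absolutely_continuous_def
  proof
    fix A assume A: "A \<in> null_sets (lborel :: (real ^ 'd) measure)"
    then have A': "A \<in> sets borel" by auto
    have "emeasure \<phi> A = 0"
    proof (rule ccontr)
      assume "emeasure \<phi> A \<noteq> 0"
      then have "emeasure \<phi> A > 0" by (simp add: zero_less_iff_neq_zero)
      then obtain n where "1 \<le> n" "emeasure (K n 0) A > 0"
        using \<phi>(2) A' unfolding irreducible_wrt_def by blast
      then show False using ac[OF _ A] by simp
    qed
    then show "A \<in> null_sets \<phi>" using \<phi>(1) A' by (intro null_setsI) auto
  qed
  have "emeasure (lborel :: (real ^ 'd) measure) UNIV > 0" by simp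
  then show ?thesis using irr dom unfolding maximal_irreducibility_measure_def by simp
qed

text \<open>
  Some class of a cycle has positive Lebesgue measure and is therefore entered from itself in one step,
  while the cycle prescribes the next class with probability 1.
\<close>

lemma one_step_positive_imp_aperiodic:
  fixes K :: "nat \<Rightarrow> real ^ 'd \<Rightarrow> (real ^ 'd) measure"
  assumes max: "maximal_irreducibility_measure lborel K"
    and pos: "\<And>x A. A \<in> sets borel \<Longrightarrow> emeasure lborel A > 0 \<Longrightarrow> emeasure (K 1 x) A > 0"
    and K: "\<And>x. prob_space (K 1 x)" "\<And>x. sets (K 1 x) = sets borel"
  shows "aperiodic K"
  unfolding aperiodic_def
proof (intro exI[of _ lborel] conjI allI impI max)
  fix d D assume cyc: "is_cycle (lborel :: (real ^ 'd) measure) K d D"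
  then have D: "\<And>i. i < d \<Longrightarrow> D i \<in> sets borel" and disj: "disjoint_family_on D {..<d}" and d: "1 \<le> d"
    and step: "\<And>i x. i < d \<Longrightarrow> x \<in> D i \<Longrightarrow> emeasure (K 1 x) (D (Suc i mod d)) = 1"
    and null: "- (\<Union>i<d. D i) \<in> null_sets lborel"
    unfolding is_cycle_def by blast+
  have "\<exists>i<d. emeasure lborel (D i) > 0"
  proof (rule ccontr)
    assume "\<not> ?thesis"
    then have "D i \<in> null_sets lborel" if "i < d" for i using that D by (auto simp: null_sets_def)
    then have "(\<Union>i<d. D i) \<in> null_sets lborel" by (intro null_sets_UN') auto
    then have "(\<Union>i<d. D i) \<union> - (\<Union>i<d. D i) \<in> null_sets lborel" using null by (rule null_sets.Un)
    then have "(UNIV :: (real ^ 'd) set) \<in> null_sets lborel" by (simp only: Compl_partition)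
    then show False by (auto simp: null_sets_def)
  qed
  then obtain i where i: "i < d" "emeasure lborel (D i) > 0" by auto
  then have "D i \<noteq> {}" by auto
  then obtain x where x: "x \<in> D i" by auto
  have posi: "emeasure (K 1 x) (D i) > 0" by (rule pos[OF D[OF i(1)] i(2)])
  show "d = 1"
  proof (rule ccontr)
    assume "d \<noteq> 1"
    have j: "Suc i mod d < d" using d by simp
    have "Suc i mod d \<noteq> i"
    proof (cases "Suc i = d")
      case True
      then show ?thesis using \<open>d \<noteq> 1\<close> by simp
    next
      case False
      then show ?thesis using i(1) by simp
    qed
    then have "D i \<inter> D (Suc i mod d) = {}"
      using disj i(1) j unfolding disjoint_family_on_def by (metis lessThan_iff)
    then have "emeasure (K 1 x) (D i) + emeasure (K 1 x) (D (Suc i mod d)) = emeasure (K 1 x) (D i \<union> D (Suc i mod d))"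
      by (intro plus_emeasure) (simp_all only: K D[OF i(1)] D[OF j])
    also have "\<dots> \<le> 1" using prob_space.emeasure_le_1[OF K(1)] .
    finally have "1 + emeasure (K 1 x) (D i) \<le> 1 + 0" using step[OF i(1) x] by (simp add: add.commute)
    then have "emeasure (K 1 x) (D i) \<le> 0" unfolding ennreal_add_left_cancel_le by simp
    then show False using posi by simp
  qed
qed

lemma tv_dist_bounds:
  assumes "\<And>A. A \<in> sets borel \<Longrightarrow> \<bar>measure \<mu> A - measure \<nu> A\<bar> \<le> e"
  shows "0 \<le> tv_dist \<mu> \<nu>" "tv_dist \<mu> \<nu> \<le> e"
proof -
  show "tv_dist \<mu> \<nu> \<le> e" unfolding tv_dist_def using assms by (intro cSUP_least) auto
  have "bdd_above ((\<lambda>A. \<bar>measure \<mu> A - measure \<nu> A\<bar>) ` sets borel)" using assms by (auto intro!: bdd_aboveI2)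
  from cSUP_upper[OF sets.empty_sets this] show "0 \<le> tv_dist \<mu> \<nu>" by (simp add: tv_dist_def)
qed

lemma nn_integral_uniform_ball_finite:
  fixes h :: "real ^ 'd \<Rightarrow> real"
  assumes h: "h \<in> borel_measurable borel" and \<rho>: "0 < \<rho>" and le: "\<And>x. norm x \<le> \<rho> \<Longrightarrow> h x \<le> K"
  shows "(\<integral>\<^sup>+x. ennreal (h x) \<partial>uniform_measure lborel (cball 0 \<rho>)) < \<infinity>"
proof -
  let ?\<nu> = "uniform_measure lborel (cball (0 :: real ^ 'd) \<rho>)"
  have pos: "emeasure lborel (cball (0 :: real ^ 'd) \<rho>) \<noteq> 0"
    using content_cball_pos[OF \<rho>, of "0 :: real ^ 'd"] by (auto simp: measure_def)
  have fin: "emeasure lborel (cball (0 :: real ^ 'd) \<rho>) \<noteq> \<infinity>"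
    using emeasure_lborel_cball_finite[of "0 :: real ^ 'd" \<rho>] by simp
  interpret nu: prob_space ?\<nu> by (rule prob_space_uniform_measure[OF pos fin])
  have "AE x in ?\<nu>. ennreal (h x) \<le> ennreal K"
    by (rule AE_uniform_measureI) (auto intro!: AE_I2 ennreal_leI le)
  then have "(\<integral>\<^sup>+x. ennreal (h x) \<partial>?\<nu>) \<le> (\<integral>\<^sup>+x. ennreal K \<partial>?\<nu>)" by (rule nn_integral_mono_AE)
  also have "\<dots> < \<infinity>" using nu.emeasure_space_1 by simp
  finally show ?thesis .
qed

text \<open>
  The minorization holds on balls of every radius, so that the ball of the drift condition may be
  enlarged until the condition on the values of \<open>V\<close> outside holds.
\<close>

lemma em_ergodic_kernel:
  fixes f :: "real ^ 'd \<Rightarrow> real ^ 'd" and g :: "real ^ 'd \<Rightarrow> real ^ 'm ^ 'd" and \<delta> :: "real ^ 'd \<Rightarrow> real"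
  assumes cont: "continuous_on UNIV f" "continuous_on UNIV g" "continuous_on UNIV \<delta>"
    and p: "2 \<le> p" and K: "0 < K6" "0 \<le> K7"
    and dissipative: "\<And>x. x \<bullet> f x + (p - 1) / 2 * (norm (g x))\<^sup>2 \<le> - K6 * (norm x)\<^sup>2 + K7"
    and \<delta>_pos: "\<And>x. 0 < \<delta> x" and \<delta>_lim: "(\<delta> \<longlongrightarrow> 0) at_infinity"
    and \<gamma>: "\<gamma> \<le> 1 / 3"
    and f_\<delta>: "\<And>x. norm (f x) * \<delta> x powr \<gamma> \<le> 1 + norm x"
    and g_\<delta>: "\<And>x. (norm (g x))\<^sup>2 * \<delta> x powr \<gamma> \<le> (1 + norm x)\<^sup>2"
    and l: "0 < l" and \<theta>: "0 < \<theta>" "\<theta> < 1"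
    and \<delta>_lower: "\<And>x. \<delta> x \<ge> l * (1 + (norm x)\<^sup>2) powr (- (p * \<theta> / 2))"
    and \<kappa>: "0 < \<kappa>" and ell: "\<And>x. loewner_le (\<kappa> *\<^sub>R mat 1) (g x ** transpose (g x))"
  obtains C \<nu> \<epsilon> c b where
    "ergodic_kernel borel (em_transition f g \<delta>) C \<nu> \<epsilon> (\<lambda>x. (1 + (norm x)\<^sup>2) powr (p / 2)) \<theta> c b"
proof -
  define V :: "real ^ 'd \<Rightarrow> real" where "V x = (1 + (norm x)\<^sup>2) powr (p / 2)" for x
  let ?Q = "em_transition f g \<delta>"
  have meas: "f \<in> borel_measurable borel" "g \<in> borel_measurable borel" "\<delta> \<in> borel_measurable borel"
    using cont by (auto intro: borel_measurable_continuous_onI)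
  have V_meas: "V \<in> borel_measurable borel" unfolding V_def[abs_def] by measurable
  have V1: "1 \<le> V x" for x using p by (simp add: V_def ge_one_powr_ge_zero)
  have V_eq: "V = (\<lambda>x. (1 + (norm x)\<^sup>2) powr (p / 2))" by (simp add: V_def fun_eq_iff)
  obtain R c b where c: "0 < c" and b: "0 \<le> b"
    and drift: "\<And>x. (\<integral>y. V y \<partial>?Q x) + c * V x powr (1 - \<theta>) \<le> V x + b * indicator (cball 0 R) x"
    by (rule em_drift[OF cont p K dissipative \<delta>_pos \<delta>_lim \<gamma> f_\<delta> g_\<delta> l \<theta> \<delta>_lower])
       (rule that, assumption+, simp only: V_def)
  \<comment> \<open>The exponent for which \<open>V\<^bsup>1-\<theta>\<^esup> = (1 + |x|\<^sup>2)\<^bsup>s\<^esup>\<close>; the radius \<open>\<rho>\<close> makes this exceed \<open>2 b / c\<close>.\<close>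
  define s where "s = p / 2 * (1 - \<theta>)"
  have s: "0 < s" using p \<theta> by (simp add: s_def)
  define \<rho> where "\<rho> = max 1 (max R (sqrt ((2 * b / c + 1) powr (1 / s))))"
  have \<rho>: "0 < \<rho>" "R \<le> \<rho>" by (auto simp: \<rho>_def)
  have high: "2 * b \<le> c * V x powr (1 - \<theta>)" if "x \<notin> cball 0 \<rho>" for x
  proof -
    have bc: "0 \<le> 2 * b / c" using b c by simp
    have "(2 * b / c + 1) powr (1 / s) = (sqrt ((2 * b / c + 1) powr (1 / s)))\<^sup>2" by simp
    also have "\<dots> \<le> (norm x)\<^sup>2" using that by (intro power_mono) (auto simp: \<rho>_def)
    also have "\<dots> \<le> 1 + (norm x)\<^sup>2" by simp
    finally have "((2 * b / c + 1) powr (1 / s)) powr s \<le> (1 + (norm x)\<^sup>2) powr s"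
      using s by (intro powr_mono2) auto
    moreover have "((2 * b / c + 1) powr (1 / s)) powr s = 2 * b / c + 1" using s bc by (simp add: powr_powr)
    moreover have "(1 + (norm x)\<^sup>2) powr s = V x powr (1 - \<theta>)" by (simp add: V_def powr_powr s_def)
    ultimately have "2 * b / c \<le> V x powr (1 - \<theta>)" by linarith
    then show ?thesis using c by (simp add: pos_divide_le_eq mult.commute)
  qed
  from em_minorization[OF cont \<delta>_pos \<kappa> ell \<rho>(1)]
  obtain c1 where c1: "0 < c1" "\<And>x A. norm x \<le> \<rho> \<Longrightarrow> A \<in> sets borel \<Longrightarrow>
    ennreal c1 * emeasure lborel (A \<inter> cball 0 \<rho>) \<le> emeasure (?Q x) A" by blast
  let ?C = "cball (0 :: real ^ 'd) \<rho>"
  define L where "L = measure lborel ?C"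
  have L: "0 < L" using content_cball_pos[OF \<rho>(1), of "0 :: real ^ 'd"] by (simp add: L_def)
  have em: "emeasure lborel ?C = ennreal L"
    using emeasure_lborel_cball_finite[of "0 :: real ^ 'd" \<rho>] by (simp add: L_def emeasure_eq_ennreal_measure less_top)
  let ?\<nu> = "uniform_measure lborel ?C"
  have "ergodic_kernel borel ?Q ?C ?\<nu> (c1 * L) V \<theta> c b"
  proof
    show "?Q \<in> borel \<rightarrow>\<^sub>M prob_algebra borel" by (rule em_transition_kernel[OF meas])
    show "?C \<in> sets borel" by simp
    show "?\<nu> \<in> space (prob_algebra borel)"
      using prob_space_uniform_measure[of lborel ?C] em L by (simp add: space_prob_algebra)
    show "0 < c1 * L" using c1 L by simp
    show "ennreal (c1 * L) * emeasure ?\<nu> A \<le> emeasure (?Q x) A" if "x \<in> ?C" "A \<in> sets borel" for x A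
    proof -
      have "ennreal (c1 * L) * emeasure ?\<nu> A = ennreal c1 * (ennreal L * (emeasure lborel (A \<inter> ?C) / ennreal L))"
        using that(2) c1 L em by (simp add: ennreal_mult mult.assoc Int_commute)
      also have "ennreal L * (emeasure lborel (A \<inter> ?C) / ennreal L) = emeasure lborel (A \<inter> ?C)"
        using L by (simp add: ennreal_times_divide mult.commute[of "ennreal L"] mult_divide_eq_ennreal)
      finally show ?thesis using c1(2)[of x A] that by simp
    qed
    show "V \<in> borel_measurable borel" by (rule V_meas)
    show "1 \<le> V x" for x by (rule V1)
    show "0 < \<theta>" "\<theta> < 1" "0 < c" "0 \<le> b" by (fact \<theta> c b)+
    show "(\<integral>\<^sup>+y. V y \<partial>?Q x) + ennreal (c * V x powr (1 - \<theta>)) \<le> ennreal (V x + b * indicator ?C x)" for x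
    proof -
      have "integrable (?Q x) V"
        unfolding em_transition_affine using V_meas p
        by (subst integrable_distr_eq) (auto simp: V_def intro!: integrable_affine_powr)
      then have int: "(\<integral>\<^sup>+y. V y \<partial>?Q x) = ennreal (\<integral>y. V y \<partial>?Q x)"
        by (intro nn_integral_eq_integral AE_I2 order_trans[OF zero_le_one V1])
      have nn: "0 \<le> (\<integral>y. V y \<partial>?Q x)" by (intro integral_nonneg_AE AE_I2 order_trans[OF zero_le_one V1])
      have "b * indicator (cball 0 R) x \<le> b * indicator ?C x"
        using b \<rho>(2) by (intro mult_left_mono) (auto simp: indicator_def)
      then have "(\<integral>y. V y \<partial>?Q x) + c * V x powr (1 - \<theta>) \<le> V x + b * indicator ?C x"
        using drift[of x] by linarith
      then show ?thesis using nn c by (simp add: int ennreal_plus[symmetric] ennreal_leI del: ennreal_plus)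
    qed
    show "(\<integral>\<^sup>+y. V y \<partial>?\<nu>) < \<infinity>"
    proof (rule nn_integral_uniform_ball_finite[OF V_meas \<rho>(1)])
      show "V x \<le> (1 + \<rho>\<^sup>2) powr (p / 2)" if "norm x \<le> \<rho>" for x
        unfolding V_def using that p by (intro powr_mono2 add_mono power_mono) auto
    qed
    show "2 * b \<le> c * V x powr (1 - \<theta>)" if "x \<notin> ?C" for x by (rule high[OF that])
  qed
  then show thesis using that unfolding V_eq by blast
qed

section \<open>Ergodicity of the adaptive scheme\<close>

theorem proposition8p10:
  fixes M :: "'w measure" and F :: "real \<Rightarrow> 'w measure"
    and W :: "real \<Rightarrow> 'w \<Rightarrow> real ^ 'm"
    and f :: "real ^ 'd \<Rightarrow> real ^ 'd" and g :: "real ^ 'd \<Rightarrow> real ^ 'm ^ 'd"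
    and \<delta> :: "real ^ 'd \<Rightarrow> real"
    and p K6 K7 \<delta>max \<gamma> l \<theta> lam :: real
  assumes bm: "brownian_motion M F W"
    and local_lipschitz: "\<And>R. R > 0 \<Longrightarrow> \<exists>C>0. \<forall>x y. max (norm x) (norm y) \<le> R \<longrightarrow>
          norm (f x - f y) + norm (g x - g y) \<le> C * norm (x - y)"
    and "p \<ge> 2" and "K6 > 0" and "K7 \<ge> 0"
    and dissipative: "\<And>x. x \<bullet> f x + (p - 1) / 2 * (norm (g x))\<^sup>2 \<le> - K6 * (norm x)\<^sup>2 + K7"
    and "\<delta>max > 0"
    and \<delta>_range: "\<And>x. 0 < \<delta> x \<and> \<delta> x \<le> \<delta>max"
    and \<delta>_cont: "continuous_on UNIV \<delta>"
    and \<delta>_lim: "(\<delta> \<longlongrightarrow> 0) at_infinity"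
    and "0 < \<gamma>" and "\<gamma> \<le> 1 / 3"
    and f_\<delta>: "\<And>x. norm (f x) * \<delta> x powr \<gamma> \<le> 1 + norm x"
    and g_\<delta>: "\<And>x. (norm (g x))\<^sup>2 * \<delta> x powr \<gamma> \<le> (1 + norm x)\<^sup>2"
    and "l > 0" and "0 < \<theta>" and "\<theta> < 1"
    and \<delta>_lower: "\<And>x. \<delta> x \<ge> l * (1 + (norm x)\<^sup>2) powr (- (p * \<theta> / 2))"
    and "lam > 0"
    and elliptic: "\<And>x. loewner_le (lam *\<^sub>R mat 1) (g x ** transpose (g x))"
  shows "(\<forall>x0. homogeneous_markov_chain M (em_value f g \<delta> W x0) (em_kernel f g \<delta> W M)) \<and>
    irreducible_wrt lborel (em_kernel f g \<delta> W M) \<and>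
    aperiodic (em_kernel f g \<delta> W M) \<and>
    (\<exists>\<mu>. invariant_prob (em_kernel f g \<delta> W M) \<mu> \<and>
         (\<forall>\<nu>. invariant_prob (em_kernel f g \<delta> W M) \<nu> \<longrightarrow> \<nu> = \<mu>) \<and>
         (\<forall>x0. (\<lambda>n. real n powr ((1 - \<theta>) / \<theta>) * tv_dist (em_kernel f g \<delta> W M n x0) \<mu>)
                 \<longlonglongrightarrow> 0))"
proof -
  have f_cont: "continuous_on UNIV f"
  proof (rule continuous_on_if_locally_lipschitz)
    fix R :: real assume "R > 0"
    from local_lipschitz[OF this] obtain C where C: "C > 0"
      "\<And>x y. max (norm x) (norm y) \<le> R \<Longrightarrow> norm (f x - f y) + norm (g x - g y) \<le> C * norm (x - y)" by blast
    have "norm (f x - f y) \<le> C * norm (x - y)" if "max (norm x) (norm y) \<le> R" for x y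
      using C(2)[OF that] norm_ge_zero[of "f x - f y"] norm_ge_zero[of "g x - g y"] by linarith
    then show "\<exists>C>0. \<forall>x y. max (norm x) (norm y) \<le> R \<longrightarrow> norm (f x - f y) \<le> C * norm (x - y)"
      using C(1) by blast
  qed
  have g_cont: "continuous_on UNIV g"
  proof (rule continuous_on_if_locally_lipschitz)
    fix R :: real assume "R > 0"
    from local_lipschitz[OF this] obtain C where C: "C > 0"
      "\<And>x y. max (norm x) (norm y) \<le> R \<Longrightarrow> norm (f x - f y) + norm (g x - g y) \<le> C * norm (x - y)" by blast
    have "norm (g x - g y) \<le> C * norm (x - y)" if "max (norm x) (norm y) \<le> R" for x y
      using C(2)[OF that] norm_ge_zero[of "f x - f y"] norm_ge_zero[of "g x - g y"] by linarith
    then show "\<exists>C>0. \<forall>x y. max (norm x) (norm y) \<le> R \<longrightarrow> norm (g x - g y) \<le> C * norm (x - y)"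
      using C(1) by blast
  qed
  have \<delta>_pos: "\<And>x. 0 < \<delta> x" using \<delta>_range by blast
  have meas: "f \<in> borel_measurable borel" "g \<in> borel_measurable borel" "\<delta> \<in> borel_measurable borel"
    using f_cont g_cont \<delta>_cont by (auto intro: borel_measurable_continuous_onI)
  interpret B: brownian_motion M F W by (rule bm)
  interpret euler_maruyama M F W f g \<delta>
    by standard (fact meas \<delta>_pos)+
  from em_ergodic_kernel[OF f_cont g_cont \<delta>_cont \<open>p \<ge> 2\<close> \<open>K6 > 0\<close> \<open>K7 \<ge> 0\<close> dissipative \<delta>_pos \<delta>_lim
      \<open>\<gamma> \<le> 1 / 3\<close> f_\<delta> g_\<delta> \<open>l > 0\<close> \<open>0 < \<theta>\<close> \<open>\<theta> < 1\<close> \<delta>_lower \<open>lam > 0\<close> elliptic]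
  obtain C \<nu>0 \<epsilon> c b where erg: "ergodic_kernel borel Q C \<nu>0 \<epsilon> (\<lambda>x. (1 + (norm x)\<^sup>2) powr (p / 2)) \<theta> c b"
    by blast
  interpret E: ergodic_kernel borel Q C \<nu>0 \<epsilon> "\<lambda>x. (1 + (norm x)\<^sup>2) powr (p / 2)" \<theta> c b by (rule erg)
  let ?K = "em_kernel f g \<delta> W M"
  have K: "?K n x = kernel_power borel Q n x" for n x by (rule em_kernel_eq)
  have Q_prob: "Q x \<in> space (prob_algebra borel)" for x
    by (rule measurable_space[OF Q_kernel]) simp
  have K1: "?K 1 x = Q x" for x
    using prob_algebraD(2)[OF Q_prob] by (simp add: K bind_return'')
  have Q_pos: "emeasure (Q x) A > 0" if A: "A \<in> sets borel" "emeasure lborel A > 0" for x A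
  proof -
    have "\<exists>n. emeasure lborel (A \<inter> cball 0 (real n)) \<noteq> 0"
    proof (rule ccontr)
      assume "\<not> ?thesis"
      then have "A \<inter> cball 0 (real n) \<in> null_sets lborel" for n using A by (auto simp: null_sets_def)
      then have "(\<Union>n. A \<inter> cball 0 (real n)) \<in> null_sets lborel" by (rule null_sets_UN)
      moreover have "(\<Union>n. A \<inter> cball 0 (real n)) = A" using real_arch_simple by auto
      ultimately show False using A by (simp add: null_sets_def)
    qed
    then obtain n where n: "emeasure lborel (A \<inter> cball 0 (real n)) \<noteq> 0" by blast
    define \<rho> where "\<rho> = max 1 (max (real n) (norm x))"
    have \<rho>: "0 < \<rho>" "norm x \<le> \<rho>" "real n \<le> \<rho>" by (auto simp: \<rho>_def)
    from em_minorization[OF f_cont g_cont \<delta>_cont \<delta>_pos \<open>lam > 0\<close> elliptic \<rho>(1)]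
    obtain c1 where c1: "0 < c1" "\<And>x A. norm x \<le> \<rho> \<Longrightarrow> A \<in> sets borel \<Longrightarrow>
      ennreal c1 * emeasure lborel (A \<inter> cball 0 \<rho>) \<le> emeasure (Q x) A" by blast
    have "emeasure lborel (A \<inter> cball 0 (real n)) \<le> emeasure lborel (A \<inter> cball 0 \<rho>)"
      using A \<rho> by (intro emeasure_mono) auto
    then have "emeasure lborel (A \<inter> cball 0 \<rho>) \<noteq> 0" using n by auto
    then have "0 < ennreal c1 * emeasure lborel (A \<inter> cball 0 \<rho>)"
      using c1(1) by (simp add: zero_less_iff_neq_zero)
    also have "\<dots> \<le> emeasure (Q x) A" by (rule c1(2)[OF \<rho>(2) A(1)])
    finally show ?thesis .
  qed
  have Q_null: "emeasure (Q x) A = 0" if "A \<in> null_sets lborel" for x A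
    unfolding em_transition_affine
    by (rule affine_gauss_null[OF that, of "\<delta> x * lam"])
       (use \<delta>_pos \<open>lam > 0\<close> em_elliptic[where \<delta> = \<delta> and g = g and x = x and \<kappa> = lam, OF \<delta>_pos elliptic] in auto)
  have irr: "irreducible_wrt lborel ?K"
    unfolding irreducible_wrt_def using Q_pos K1 by (metis order_refl)
  have max: "maximal_irreducibility_measure lborel ?K"
  proof (rule irreducible_imp_lborel_maximal[OF irr])
    fix n :: nat and x :: "real ^ 'd" and A :: "(real ^ 'd) set"
    assume n: "1 \<le> n" and A: "A \<in> null_sets lborel"
    have A': "A \<in> sets borel" using A by auto
    have "emeasure (kernel_power borel Q (Suc k) x) A = 0" for k x
    proof (induction k arbitrary: x)
      case 0
      show ?case using K1[of x] Q_null[OF A] by (simp add: K)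
    next
      case (Suc k)
      show ?case
        using Suc by (subst emeasure_kernel_power_Suc[OF Q_kernel _ A']) (simp_all del: kernel_power.simps)
    qed
    then show "emeasure (?K n x) A = 0" using n K by (cases n) auto
  qed
  have aper: "aperiodic ?K"
    by (rule one_step_positive_imp_aperiodic[OF max]) (use Q_pos K1 prob_algebraD[OF Q_prob] in auto)
  have inv_iff: "invariant_prob ?K \<mu> \<longleftrightarrow> E.invariant_measure \<mu>" for \<mu>
    unfolding invariant_prob_def E.invariant_measure_def K1 by (auto simp: space_prob_algebra)
  obtain \<mu> where \<mu>: "E.invariant_measure \<mu>" "\<And>\<mu>'. E.invariant_measure \<mu>' \<Longrightarrow> \<mu>' = \<mu>"
    and rate: "\<And>x. x \<in> space borel \<Longrightarrow> \<exists>e. (\<forall>n\<ge>1. \<forall>A\<in>sets borel. \<bar>measure (kernel_power borel Q n x) A - measure \<mu> A\<bar> \<le> e n) \<and>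
        (\<lambda>n. real n powr ((1 - \<theta>) / \<theta>) * e n) \<longlonglongrightarrow> 0"
    using E.polynomial_ergodicity by blast
  have "(\<lambda>n. real n powr ((1 - \<theta>) / \<theta>) * tv_dist (?K n x0) \<mu>) \<longlonglongrightarrow> 0" for x0
  proof -
    obtain e where e: "\<And>n A. 1 \<le> n \<Longrightarrow> A \<in> sets borel \<Longrightarrow> \<bar>measure (?K n x0) A - measure \<mu> A\<bar> \<le> e n"
      and lim: "(\<lambda>n. real n powr ((1 - \<theta>) / \<theta>) * e n) \<longlonglongrightarrow> 0"
      using rate[of x0] unfolding K by auto
    have tv: "0 \<le> tv_dist (?K n x0) \<mu>" "tv_dist (?K n x0) \<mu> \<le> e n" if "1 \<le> n" for n
      using tv_dist_bounds[of "?K n x0" \<mu> "e n"] e[OF that] by auto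
    show ?thesis
    proof (rule tendsto_sandwich[OF _ _ tendsto_const lim])
      show "\<forall>\<^sub>F n in sequentially. 0 \<le> real n powr ((1 - \<theta>) / \<theta>) * tv_dist (?K n x0) \<mu>"
        unfolding eventually_sequentially using tv by (intro exI[of _ 1]) auto
      show "\<forall>\<^sub>F n in sequentially. real n powr ((1 - \<theta>) / \<theta>) * tv_dist (?K n x0) \<mu> \<le> real n powr ((1 - \<theta>) / \<theta>) * e n"
        unfolding eventually_sequentially using tv by (intro exI[of _ 1]) (auto intro!: mult_left_mono)
    qed
  qed
  then show ?thesis
    using em_homogeneous_markov_chain irr aper \<mu> unfolding inv_iff by blast
qed

end
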